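(* Let \[ \mathcal{E}_d:=\{ f\in\mathrm{End}_d^2 : \mathcal{C}_f \text{ is smooth and irreducible}\}. \] (a) For $d\ge1$, $\mathcal{E}_d$ is a non-empty Zariski open subset of $\mathrm{End}_d^2$. (b) For $d\ge2$, $\mathcal{E}_d$ contains no post-critically periodic maps. (c) For all $d\ge2$, the set $\{f\in\mathrm{End}_d^2 : f \text{ is post-critically periodic}\}$ is not Zariski dense in $\mathrm{End}_d^2$.
   Context: Work over an algebraically closed field $\mathbb{F}$ of characteristic $0$. $\mathrm{End}_d^n$ is the set of morphisms $f:\mathbb{P}^n\to\mathbb{P}^n$ of algebraic degree $d$ (i.e. $f=[f_0:\dots:f_n]$, $f_i$ homogeneous of degree $d$ with no common zero), viewed as a Zariski open subset of $\mathbb{P}^N$, $N=(n+1)\binom{d+n}{n}-1$. The critical locus is $\mathcal{C}_f=\{\det(\partial f_i/\partial x_j)=0\}$. A map $f$ is post-critically periodic if $f^k(\mathcal{C}_f)\subseteq\mathcal{C}_f$ for some $k\ge1$. *)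

theory Defs
  imports "HOL-Library.Poly_Mapping" "HOL-Library.Numeral_Type"
          "HOL-Computational_Algebra.Polynomial"
begin

type_synonym ('v, 'k) mpol = "('v \<Rightarrow>\<^sub>0 nat) \<Rightarrow>\<^sub>0 'k"

definition mon_deg :: "('v \<Rightarrow>\<^sub>0 nat) \<Rightarrow> nat" where
  "mon_deg m = (\<Sum>v\<in>Poly_Mapping.keys m. Poly_Mapping.lookup m v)"

definition mp_eval :: "('v, 'k::comm_ring_1) mpol \<Rightarrow> ('v \<Rightarrow> 'k) \<Rightarrow> 'k" where
  "mp_eval p x = (\<Sum>m\<in>Poly_Mapping.keys p. Poly_Mapping.lookup p m * (\<Prod>v\<in>Poly_Mapping.keys m. x v ^ Poly_Mapping.lookup m v))"

definition homog :: "nat \<Rightarrow> ('v, 'k::zero) mpol \<Rightarrow> bool" where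
  "homog d p \<longleftrightarrow> (\<forall>m\<in>Poly_Mapping.keys p. mon_deg m = d)"

definition is_homog :: "('v, 'k::zero) mpol \<Rightarrow> bool" where
  "is_homog p \<longleftrightarrow> (\<exists>d. homog d p)"

definition mp_pderiv :: "'v \<Rightarrow> ('v, 'k::comm_ring_1) mpol \<Rightarrow> ('v, 'k) mpol" where
  "mp_pderiv j p = Abs_poly_mapping
     (\<lambda>m. of_nat (Poly_Mapping.lookup m j + 1) * Poly_Mapping.lookup p (m + Poly_Mapping.single j 1))"

text \<open>Homogeneous coordinates x0,x1,x2 are indexed by the type 3; a point of the
affine cone is a map 3 \<Rightarrow> 'k.  A map f = [f0:f1:f2] is a triple of polynomials.\<close>

type_synonym 'k pol3 = "(3, 'k) mpol"
type_synonym 'k endo = "3 \<Rightarrow> 'k pol3"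

definition End2 :: "nat \<Rightarrow> 'k::comm_ring_1 endo set" where
  "End2 d = {f. (\<forall>i. homog d (f i)) \<and>
                (\<forall>x. (\<forall>i. mp_eval (f i) x = 0) \<longrightarrow> (\<forall>i. x i = 0))}"

definition apply_endo :: "'k::comm_ring_1 endo \<Rightarrow> (3 \<Rightarrow> 'k) \<Rightarrow> (3 \<Rightarrow> 'k)" where
  "apply_endo f x = (\<lambda>i. mp_eval (f i) x)"

definition det3 :: "(3 \<Rightarrow> 3 \<Rightarrow> 'a::comm_ring_1) \<Rightarrow> 'a" where
  "det3 M = M 0 0 * M 1 1 * M 2 2 + M 0 1 * M 1 2 * M 2 0 + M 0 2 * M 1 0 * M 2 1
          - M 0 2 * M 1 1 * M 2 0 - M 0 0 * M 1 2 * M 2 1 - M 0 1 * M 1 0 * M 2 2"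

definition jac :: "'k::comm_ring_1 endo \<Rightarrow> 'k pol3" where
  "jac f = det3 (\<lambda>i j. mp_pderiv j (f i))"

text \<open>The critical locus C_f, as a cone in k^3 minus 0 (its projectivisation is
the subset of P^2).\<close>
definition crit :: "'k::comm_ring_1 endo \<Rightarrow> (3 \<Rightarrow> 'k) set" where
  "crit f = {x. (\<exists>i. x i \<noteq> 0) \<and> mp_eval (jac f) x = 0}"

definition zclosed_P2 :: "(3 \<Rightarrow> 'k::comm_ring_1) set \<Rightarrow> bool" where
  "zclosed_P2 A \<longleftrightarrow> (\<exists>P. (\<forall>p\<in>P. is_homog p) \<and>
       A = {x. (\<exists>i. x i \<noteq> 0) \<and> (\<forall>p\<in>P. mp_eval p x = 0)})"

text \<open>Irreducibility of a closed set (no nonemptiness required).\<close>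
definition irreducible_P2 :: "(3 \<Rightarrow> 'k::comm_ring_1) set \<Rightarrow> bool" where
  "irreducible_P2 Z \<longleftrightarrow> (\<forall>A B. zclosed_P2 A \<longrightarrow> zclosed_P2 B \<longrightarrow> Z \<subseteq> A \<union> B
       \<longrightarrow> Z \<subseteq> A \<or> Z \<subseteq> B)"

text \<open>Smoothness of the plane curve {J = 0} (Jacobian criterion).\<close>
definition smooth_crit :: "'k::comm_ring_1 endo \<Rightarrow> bool" where
  "smooth_crit f \<longleftrightarrow> (\<forall>x\<in>crit f. \<exists>j. mp_eval (mp_pderiv j (jac f)) x \<noteq> 0)"

definition Ed :: "nat \<Rightarrow> 'k::comm_ring_1 endo set" where
  "Ed d = {f\<in>End2 d. smooth_crit f \<and> irreducible_P2 (crit f)}"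

definition pcp :: "'k::comm_ring_1 endo \<Rightarrow> bool" where
  "pcp f \<longleftrightarrow> (\<exists>k\<ge>1. \<forall>x\<in>crit f. (apply_endo f ^^ k) x \<in> crit f)"

text \<open>Homogeneous coordinates of f in P^N: the coefficients of f_i at the
monomials m of degree d, indexed by (i, m).\<close>
definition coord :: "'k::comm_ring_1 endo \<Rightarrow> (3 \<times> (3 \<Rightarrow>\<^sub>0 nat)) \<Rightarrow> 'k" where
  "coord f = (\<lambda>(i, m). Poly_Mapping.lookup (f i) m)"

definition coord_poly :: "nat \<Rightarrow> (3 \<times> (3 \<Rightarrow>\<^sub>0 nat), 'k::comm_ring_1) mpol \<Rightarrow> bool" where
  "coord_poly d p \<longleftrightarrow> is_homog p \<and>
     (\<forall>m\<in>Poly_Mapping.keys p. \<forall>(i, n)\<in>Poly_Mapping.keys m. mon_deg n = d)"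

definition zclosed_End :: "nat \<Rightarrow> 'k::comm_ring_1 endo set \<Rightarrow> bool" where
  "zclosed_End d Z \<longleftrightarrow> (\<exists>P. (\<forall>p\<in>P. coord_poly d p) \<and>
       Z = {f\<in>End2 d. \<forall>p\<in>P. mp_eval p (coord f) = 0})"

definition zopen_End :: "nat \<Rightarrow> 'k::comm_ring_1 endo set \<Rightarrow> bool" where
  "zopen_End d U \<longleftrightarrow> U \<subseteq> End2 d \<and> zclosed_End d (End2 d - U)"

definition zdense_End :: "nat \<Rightarrow> 'k::comm_ring_1 endo set \<Rightarrow> bool" where
  "zdense_End d S \<longleftrightarrow> (\<forall>Z. zclosed_End d Z \<longrightarrow> S \<subseteq> Z \<longrightarrow> Z = End2 d)"

end

theory Submission
  imports Defs "Berlekamp_Zassenhaus.Unique_Factorization_Poly" "Jordan_Normal_Form.Spectral_Radius"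
begin

text \<open>Let \<open>J\<close> be the Jacobian determinant of \<open>f\<close>, a form of degree \<open>3(d - 1)\<close>. Two plane curves always meet,
  so a smooth \<open>J\<close> is irreducible, and \<open>\<E>\<^sub>d\<close> is given by smoothness alone; smoothness is open by
  elimination theory, in the form of the projective Nullstellensatz.

  Suppose that \<open>g = f\<^sup>k\<close> maps the smooth critical curve \<open>C\<close> into itself. As \<open>C\<close> is critical, \<open>Dg\<close> is singular
  along \<open>C\<close>. Either the normal derivative of \<open>g\<close> along \<open>C\<close> is not identically zero, and then the tangential one is;
  or \<open>\<nabla>J(g)\<close> is a left null vector of \<open>Dg\<close>, and then \<open>adj Dg = v \<otimes> \<nabla>J(g)\<close> on \<open>C\<close> for a section \<open>v\<close>
  of degree \<open>2(deg g - 1) - (deg J - 1) deg g < 0\<close>, so that \<open>v = 0\<close>. In both cases \<open>g\<close> has zero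
  derivative along \<open>C\<close>, hence is constant on \<open>C\<close>, which is impossible for a morphism of the plane.\<close>


section \<open>Substitution and evaluation\<close>

abbreviation "lookup \<equiv> Poly_Mapping.lookup"
abbreviation "keys \<equiv> Poly_Mapping.keys"
abbreviation "single \<equiv> Poly_Mapping.single"

lemma sum_single_keys: "(\<Sum>m\<in>keys p. single m (lookup p m)) = p"
  by (rule poly_mapping_eqI)
    (auto simp: lookup_sum lookup_single when_def in_keys_iff sum.delta)

lemma single_add_induct [case_names zero single add]:
  fixes P :: "('a \<Rightarrow>\<^sub>0 'b::comm_monoid_add) \<Rightarrow> bool"
  assumes "P 0" "\<And>m c. P (single m c)" "\<And>p q. P p \<Longrightarrow> P q \<Longrightarrow> P (p + q)"
  shows "P p"
proof -
  have "P (\<Sum>m\<in>A. single m (lookup p m))" for A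
    by (induction A rule: infinite_finite_induct) (auto intro: assms)
  thus ?thesis using sum_single_keys[of p] by metis
qed

lemma diff_single_add: "k \<le> lookup m v \<Longrightarrow> m - single v k + single v k = m"
  for m :: "'v \<Rightarrow>\<^sub>0 nat"
  by (intro poly_mapping_eqI) (auto simp: lookup_add lookup_minus lookup_single when_def)

lemma mon_deg_superset:
  assumes "finite K" "keys m \<subseteq> K"
  shows "mon_deg m = (\<Sum>v\<in>K. lookup m v)"
  unfolding mon_deg_def using assms by (intro sum.mono_neutral_left) (auto simp: in_keys_iff)

lemma mon_deg_0 [simp]: "mon_deg 0 = 0"
  by (simp add: mon_deg_def)

lemma mon_deg_single [simp]: "mon_deg (single v n) = n"
  by (cases "n = 0") (simp_all add: mon_deg_def)

lemma mon_deg_add: "mon_deg (a + b) = mon_deg a + mon_deg b"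
proof -
  let ?K = "keys a \<union> keys b"
  have "keys (a + b) \<subseteq> ?K" by (rule keys_add)
  thus ?thesis by (simp add: mon_deg_superset[of ?K] lookup_add sum.distrib)
qed

lemma lookup_le_mon_deg: "lookup m v \<le> mon_deg m"
  by (cases "v \<in> keys m") (auto simp: mon_deg_def in_keys_iff intro!: member_le_sum)

lemma mon_deg_eq_0_iff [simp]: "mon_deg m = 0 \<longleftrightarrow> m = 0"
  using lookup_le_mon_deg[of m] by (auto intro: poly_mapping_eqI)

definition mon_eval :: "('v \<Rightarrow> 'r::comm_ring_1) \<Rightarrow> ('v \<Rightarrow>\<^sub>0 nat) \<Rightarrow> 'r" where
  "mon_eval s m = (\<Prod>v\<in>keys m. s v ^ lookup m v)"

lemma mon_eval_superset:
  assumes "finite K" "keys m \<subseteq> K"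
  shows "mon_eval s m = (\<Prod>v\<in>K. s v ^ lookup m v)"
  unfolding mon_eval_def using assms by (intro prod.mono_neutral_left) (auto simp: in_keys_iff)

lemma mon_eval_0 [simp]: "mon_eval s 0 = 1"
  by (simp add: mon_eval_def)

lemma mon_eval_single [simp]: "mon_eval s (single v n) = s v ^ n"
  by (cases "n = 0") (simp_all add: mon_eval_def)

lemma mon_eval_add: "mon_eval s (a + b) = mon_eval s a * mon_eval s b"
proof -
  let ?K = "keys a \<union> keys b"
  have "keys (a + b) \<subseteq> ?K" by (rule keys_add)
  thus ?thesis by (simp add: mon_eval_superset[of ?K] lookup_add power_add prod.distrib)
qed

lemma mon_eval_axis:
  "mon_eval ((\<lambda>_. 0)(v := 1)) m = (if keys m \<subseteq> {v} then 1 else (0::'r::comm_ring_1))"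
proof (cases "keys m \<subseteq> {v}")
  case False
  then obtain w where "w \<in> keys m" "w \<noteq> v" by blast
  hence "mon_eval ((\<lambda>_. 0)(v := 1)) m = (0::'r)"
    unfolding mon_eval_def
    by (intro prod_zero) (auto simp: in_keys_iff zero_power intro!: bexI[of _ w])
  with False show ?thesis by simp
qed (simp add: mon_eval_superset[of "{v}"])

definition mp_subst ::
    "('k::comm_ring_1 \<Rightarrow> 'r::comm_ring_1) \<Rightarrow> ('v \<Rightarrow> 'r) \<Rightarrow> ('v, 'k) mpol \<Rightarrow> 'r" where
  "mp_subst h s p = (\<Sum>m\<in>keys p. h (lookup p m) * mon_eval s m)"

lemma mp_eval_eq_mp_subst: "mp_eval p x = mp_subst (\<lambda>c. c) x p"
  by (simp add: mp_eval_def mp_subst_def mon_eval_def)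

context comm_ring_hom
begin

lemma mp_subst_single: "mp_subst hom s (single m c) = hom c * mon_eval s m"
  by (simp add: mp_subst_def)

lemma mp_subst_superset:
  assumes "finite K" "keys p \<subseteq> K"
  shows "mp_subst hom s p = (\<Sum>m\<in>K. hom (lookup p m) * mon_eval s m)"
  unfolding mp_subst_def using assms
  by (intro sum.mono_neutral_left) (auto simp: in_keys_iff)

lemma mp_subst_add: "mp_subst hom s (p + q) = mp_subst hom s p + mp_subst hom s q"
proof -
  let ?K = "keys p \<union> keys q"
  have "keys (p + q) \<subseteq> ?K" by (rule keys_add)
  thus ?thesis
    by (simp add: mp_subst_superset[of ?K] lookup_add hom_distribs distrib_right sum.distrib)
qed

lemma mp_subst_mult: "mp_subst hom s (p * q) = mp_subst hom s p * mp_subst hom s q"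
proof (induction p rule: single_add_induct)
  case (single a c)
  show ?case
    by (induction q rule: single_add_induct)
      (simp_all add: mult_single mp_subst_single mp_subst_add mon_eval_add hom_distribs
        algebra_simps, simp add: mp_subst_def)
qed (simp_all add: mp_subst_def[of _ _ 0] mp_subst_add distrib_right)

lemma comm_ring_hom_mp_subst: "comm_ring_hom (mp_subst hom s)"
  by unfold_locales
    (simp_all add: mp_subst_add mp_subst_mult mp_subst_single mp_subst_def[of _ _ 0] flip: single_one)

end

lemma comm_ring_hom_comp:
  assumes "comm_ring_hom f" "comm_ring_hom g" shows "comm_ring_hom (\<lambda>x. f (g x))"
proof -
  interpret f: comm_ring_hom f by fact
  interpret g: comm_ring_hom g by fact
  show ?thesis by unfold_locales (simp_all add: hom_distribs)
qed

lemma comm_ring_hom_ident: "comm_ring_hom (\<lambda>c :: 'a::comm_ring_1. c)"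
  by unfold_locales simp_all

interpretation mp_eval: comm_ring_hom "\<lambda>p. mp_eval p x" for x :: "'v \<Rightarrow> 'k::comm_ring_1"
  unfolding mp_eval_eq_mp_subst by (rule comm_ring_hom.comm_ring_hom_mp_subst[OF comm_ring_hom_ident])

definition Cst :: "'k::comm_ring_1 \<Rightarrow> ('v, 'k) mpol" where
  "Cst c = single 0 c"

definition Var :: "'v \<Rightarrow> ('v, 'k::comm_ring_1) mpol" where
  "Var v = single (single v 1) 1"

interpretation Cst: comm_ring_hom Cst
  by unfold_locales (simp_all add: Cst_def single_add mult_single)

lemma Cst_mult_inverse: "c \<noteq> 0 \<Longrightarrow> Cst c * Cst (inverse c) = 1" for c :: "'k::field"
  by (simp flip: Cst.hom_mult)

lemma lookup_Cst_mult: "lookup (Cst c * p) m = c * lookup p m"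
  by (simp add: Cst_def Poly_Mapping.map.rep_eq when_def flip: mult_map_scale_conv_mult)

lemma Var_power: "Var v ^ n = single (single v n) 1"
  by (induction n) (simp_all add: Var_def mult_single flip: single_add)

lemma Var_nonzero [simp]: "Var v \<noteq> (0 :: ('v, 'k::comm_ring_1) mpol)"
proof
  assume "Var v = (0 :: ('v, 'k) mpol)"
  hence "lookup (Var v :: ('v, 'k) mpol) (single v 1) = 0" by (simp only: lookup_zero)
  thus False by (simp add: Var_def)
qed

lemma mon_eval_Var: "mon_eval Var m = (single m 1 :: ('v, 'k::comm_ring_1) mpol)"
proof -
  have "(\<Prod>v\<in>A. single (single v (e v)) (1::'k)) = single (\<Sum>v\<in>A. single v (e v)) 1" for A and e :: "'v \<Rightarrow> nat"
    by (induction A rule: infinite_finite_induct) (simp_all add: mult_single)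
  thus ?thesis by (simp add: mon_eval_def Var_power sum_single_keys)
qed

lemma single_eq_Cst_mult: "single m c = Cst c * mon_eval Var m"
  by (simp add: mon_eval_Var Cst_def mult_single)

lemma mpol_induct [case_names Cst Var add mult]:
  assumes "\<And>c. P (Cst c)" "\<And>v. P (Var v)"
    "\<And>p q. P p \<Longrightarrow> P q \<Longrightarrow> P (p + q)" "\<And>p q. P p \<Longrightarrow> P q \<Longrightarrow> P (p * q)"
  shows "P p"
proof (induction p rule: single_add_induct)
  case (single m c)
  have P_1: "P 1" using assms(1)[of 1] by simp
  have "P (Var v ^ n)" for v n
    by (induction n) (auto intro: P_1 assms)
  hence "P (\<Prod>v\<in>A. Var v ^ e v)" for A e
    by (induction A rule: infinite_finite_induct) (auto intro: P_1 assms)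
  thus ?case unfolding single_eq_Cst_mult mon_eval_def by (intro assms)
qed (use assms(1)[of 0] assms(3) in auto)

context comm_ring_hom
begin

lemma mp_subst_Cst [simp]: "mp_subst hom s (Cst c) = hom c"
  by (simp add: Cst_def mp_subst_single)

lemma mp_subst_Var [simp]: "mp_subst hom s (Var v) = s v"
  by (simp add: Var_def mp_subst_single)

lemma hom_mp_subst: "hom (mp_subst h s p) = mp_subst (\<lambda>c. hom (h c)) (\<lambda>v. hom (s v)) p"
  by (simp add: mp_subst_def mon_eval_def hom_distribs)

end

lemma mpol_hom_eqI:
  assumes "comm_ring_hom F" "comm_ring_hom G"
    and "\<And>c. F (Cst c) = G (Cst c)" "\<And>v. F (Var v) = G (Var v)"
  shows "F p = G p"
proof -
  interpret F: comm_ring_hom F by fact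
  interpret G: comm_ring_hom G by fact
  show ?thesis by (induction p rule: mpol_induct) (simp_all add: assms hom_distribs)
qed

lemma mp_eval_Cst [simp]: "mp_eval (Cst c) x = c"
  and mp_eval_Var [simp]: "mp_eval (Var v) x = x v"
  by (simp_all add: mp_eval_eq_mp_subst comm_ring_hom.mp_subst_Cst[OF comm_ring_hom_ident]
      comm_ring_hom.mp_subst_Var[OF comm_ring_hom_ident])

lemma mp_eval_single: "mp_eval (single m c) x = c * mon_eval x m"
  by (simp add: mp_eval_eq_mp_subst comm_ring_hom.mp_subst_single[OF comm_ring_hom_ident])

abbreviation pullback :: "('w \<Rightarrow> ('v, 'k::comm_ring_1) mpol) \<Rightarrow> ('w, 'k) mpol \<Rightarrow> ('v, 'k) mpol" where
  "pullback \<equiv> mp_subst Cst"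

interpretation pullback: comm_ring_hom "pullback g" for g :: "'w \<Rightarrow> ('v, 'k::comm_ring_1) mpol"
  by (rule Cst.comm_ring_hom_mp_subst)

lemma pullback_Var [simp]: "pullback Var p = p"
  by (simp add: mp_subst_def mon_eval_Var Cst_def mult_single sum_single_keys)

lemma mp_eval_pullback: "mp_eval (pullback g p) x = mp_eval p (\<lambda>v. mp_eval (g v) x)"
  by (simp add: mp_eval.hom_mp_subst) (simp add: mp_eval_eq_mp_subst)


section \<open>Partial derivatives\<close>

lemma lookup_mp_pderiv:
  "lookup (mp_pderiv j p) m = of_nat (lookup m j + 1) * lookup p (m + single j 1)"
proof -
  let ?f = "\<lambda>m. of_nat (lookup m j + 1) * lookup p (m + single j 1)"
  have "{m. ?f m \<noteq> 0} \<subseteq> (\<lambda>m. m - single j 1) ` keys p"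
  proof
    fix m assume "m \<in> {m. ?f m \<noteq> 0}"
    hence "m + single j 1 \<in> keys p" by (auto simp: in_keys_iff)
    thus "m \<in> (\<lambda>m. m - single j 1) ` keys p" by (rule rev_image_eqI) simp
  qed
  hence "finite {m. ?f m \<noteq> 0}" by (rule finite_subset) simp
  thus ?thesis by (simp add: mp_pderiv_def)
qed

lemma mp_pderiv_0 [simp]: "mp_pderiv j 0 = 0"
  and mp_pderiv_add: "mp_pderiv j (p + q) = mp_pderiv j p + mp_pderiv j q"
  and mp_pderiv_diff: "mp_pderiv j (p - q) = mp_pderiv j p - mp_pderiv j q"
  by (rule poly_mapping_eqI, simp add: lookup_mp_pderiv lookup_add lookup_minus algebra_simps)+

lemma mp_pderiv_sum: "mp_pderiv j (sum f A) = (\<Sum>i\<in>A. mp_pderiv j (f i))"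
  by (induction A rule: infinite_finite_induct) (simp_all add: mp_pderiv_add)

lemma mp_pderiv_single:
  "mp_pderiv j (single m c) = single (m - single j 1) (of_nat (lookup m j) * c)"
proof (rule poly_mapping_eqI)
  fix n
  have "m = n + single j 1 \<longleftrightarrow> lookup m j > 0 \<and> m - single j 1 = n"
    using diff_single_add[of 1 m j] by (auto simp: lookup_add)
  thus "lookup (mp_pderiv j (single m c)) n
      = lookup (single (m - single j 1) (of_nat (lookup m j) * c)) n"
    by (cases "m = n + single j 1") (auto simp: lookup_mp_pderiv lookup_single when_def lookup_add)
qed

lemma mp_pderiv_mult: "mp_pderiv j (p * q) = mp_pderiv j p * q + p * mp_pderiv j q"
proof (induction p rule: single_add_induct)
  case (single a c)
  have shift: "single (a + b - single j 1) (of_nat (lookup a j) * x)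
     = single (a - single j 1 + b) (of_nat (lookup a j) * x)" for a b :: "'a \<Rightarrow>\<^sub>0 nat" and x :: 'b
  proof (cases "lookup a j = 0")
    case False
    hence "a + b - single j 1 = a - single j 1 + b"
      by (intro poly_mapping_eqI) (auto simp: lookup_add lookup_minus lookup_single when_def)
    thus ?thesis by simp
  qed simp
  show ?case
  proof (induction q rule: single_add_induct)
    case (single b d)
    have "mp_pderiv j (single a c * single b d) =
        single (a + b - single j 1) (of_nat (lookup a j) * (c * d)) +
        single (b + a - single j 1) (of_nat (lookup b j) * (c * d))"
      by (simp add: mult_single mp_pderiv_single lookup_add algebra_simps flip: single_add)
    thus ?case unfolding shift by (simp add: mult_single mp_pderiv_single ac_simps)
  qed (simp_all add: mp_pderiv_add algebra_simps)
qed (simp_all add: mp_pderiv_add algebra_simps)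

lemma mp_pderiv_Cst [simp]: "mp_pderiv j (Cst c) = 0"
  by (simp add: Cst_def mp_pderiv_single)

lemma mp_pderiv_of_nat [simp]: "mp_pderiv j (of_nat n) = 0"
  using mp_pderiv_Cst[of j "of_nat n"] by (simp add: Cst.hom_of_nat)

lemma mp_pderiv_numeral [simp]: "mp_pderiv j (numeral n) = 0"
  using mp_pderiv_of_nat[of j "numeral n"] by simp

lemma mp_pderiv_1 [simp]: "mp_pderiv j 1 = 0"
  using mp_pderiv_of_nat[of j 1] by simp

lemma mp_pderiv_Var: "mp_pderiv j (Var v) = (if v = j then 1 else 0)"
  by (auto simp: Var_def mp_pderiv_single lookup_single when_def)

lemma mp_pderiv_power: "mp_pderiv j (p ^ n) = of_nat n * p ^ (n - 1) * mp_pderiv j p"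
proof (induction n)
  case (Suc n)
  have "p * mp_pderiv j (p ^ n) = of_nat n * p ^ n * mp_pderiv j p"
    unfolding Suc by (cases n) (simp_all add: ac_simps)
  thus ?case by (simp add: mp_pderiv_mult algebra_simps)
qed simp

lemma mp_pderiv_pullback:
  fixes g :: "'w::finite \<Rightarrow> ('v, 'k::comm_ring_1) mpol"
  shows "mp_pderiv j (pullback g p) = (\<Sum>i\<in>UNIV. pullback g (mp_pderiv i p) * mp_pderiv j (g i))"
proof (induction p rule: mpol_induct)
  case (Var v)
  have "(\<Sum>i\<in>UNIV. pullback g (mp_pderiv i (Var v)) * mp_pderiv j (g i))
     = (\<Sum>i\<in>UNIV. if i = v then mp_pderiv j (g i) else 0)"
    by (intro sum.cong) (auto simp: mp_pderiv_Var)
  thus ?case by simp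
qed (simp_all add: hom_distribs mp_pderiv_add mp_pderiv_mult algebra_simps sum.distrib sum_distrib_left)


section \<open>Homogeneous polynomials\<close>

lemma homog_0 [simp]: "homog n 0"
  by (simp add: homog_def)

lemma homog_single: "mon_deg m = n \<Longrightarrow> homog n (single m c)"
  by (auto simp: homog_def)

lemma homog_Cst: "homog 0 (Cst c)"
  by (simp add: Cst_def homog_single)

lemma homog_1: "homog 0 (1 :: ('v, 'k::comm_ring_1) mpol)"
  using homog_Cst[of 1] by simp

lemma homog_of_nat: "homog 0 (of_nat n :: ('v, 'k::comm_ring_1) mpol)"
  using homog_Cst[of "of_nat n"] by (simp add: Cst.hom_of_nat)

lemma homog_Var: "homog 1 (Var v)"
  by (simp add: Var_def homog_single)

lemma homog_add: "homog n p \<Longrightarrow> homog n q \<Longrightarrow> homog n (p + q)"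
  using keys_add[of p q] by (auto simp: homog_def)

lemma homog_diff: "homog n p \<Longrightarrow> homog n q \<Longrightarrow> homog n (p - q)"
  for p :: "('v, 'k::ab_group_add) mpol"
  using keys_diff[of p q] by (auto simp: homog_def)

lemma homog_sum: "(\<And>i. i \<in> A \<Longrightarrow> homog n (f i)) \<Longrightarrow> homog n (sum f A)"
  by (induction A rule: infinite_finite_induct) (auto intro: homog_add)

lemma homog_mult:
  fixes p q :: "('v, 'k::comm_ring_1) mpol"
  assumes "homog n p" "homog m q"
  shows "homog (n + m) (p * q)"
  unfolding homog_def
proof
  fix k assume "k \<in> keys (p * q)"
  then obtain a b where "a \<in> keys p" "b \<in> keys q" "k = a + b" using keys_mult by blast
  thus "mon_deg k = n + m" using assms by (auto simp: homog_def mon_deg_add)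
qed

lemma homog_power: "homog n p \<Longrightarrow> homog (n * k) (p ^ k)"
  for p :: "('v, 'k::comm_ring_1) mpol"
  by (induction k) (auto intro: homog_mult homog_1)

lemma homog_prod:
  fixes f :: "'i \<Rightarrow> ('v, 'k::comm_ring_1) mpol"
  shows "(\<And>i. i \<in> A \<Longrightarrow> homog (e i) (f i)) \<Longrightarrow> homog (sum e A) (prod f A)"
  by (induction A rule: infinite_finite_induct) (auto intro: homog_mult homog_1)

lemma homog_Cst_mult: "homog n p \<Longrightarrow> homog n (Cst c * p)"
  using homog_mult[OF homog_Cst, of n p c] by simp

lemma homog_Var_power: "homog n (Var v ^ n)"
  using homog_power[OF homog_Var, of n] by simp

lemma homog_mp_pderiv:
  assumes "homog n p" shows "homog (n - 1) (mp_pderiv j p)"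
  unfolding homog_def
proof
  fix m assume "m \<in> keys (mp_pderiv j p)"
  hence "m + single j 1 \<in> keys p" by (auto simp: in_keys_iff lookup_mp_pderiv)
  thus "mon_deg m = n - 1" using assms by (auto simp: homog_def mon_deg_add)
qed

lemma homog_mon_eval:
  fixes g :: "'w \<Rightarrow> ('v, 'k::comm_ring_1) mpol"
  assumes "\<And>i. homog D (g i)"
  shows "homog (mon_deg m * D) (mon_eval g m)"
proof -
  have "homog (\<Sum>v\<in>keys m. D * lookup m v) (mon_eval g m)"
    unfolding mon_eval_def by (intro homog_prod homog_power assms)
  thus ?thesis by (simp add: mon_deg_def sum_distrib_left mult.commute)
qed

lemma homog_pullback:
  fixes g :: "'w \<Rightarrow> ('v, 'k::comm_ring_1) mpol"
  assumes "homog n p" "\<And>i. homog D (g i)"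
  shows "homog (n * D) (pullback g p)"
  unfolding mp_subst_def using assms homog_mon_eval[of D g]
  by (intro homog_sum homog_Cst_mult) (auto simp: homog_def)

lemma homog_unique: "homog a p \<Longrightarrow> homog b p \<Longrightarrow> p \<noteq> 0 \<Longrightarrow> a = b"
  using keys_eq_empty[of p] by (auto simp: homog_def simp del: keys_eq_empty)

lemma homog_0_eq_Cst: "homog 0 p \<Longrightarrow> p = Cst (lookup p 0)"
  by (rule poly_mapping_eqI) (auto simp: Cst_def lookup_single when_def homog_def in_keys_iff)

lemma mon_eq_single:
  assumes "keys m \<subseteq> {v}" shows "m = single v (mon_deg m)"
proof (rule poly_mapping_eqI)
  fix w
  have "mon_deg m = lookup m v" using mon_deg_superset[of "{v}" m] assms by simp
  thus "lookup m w = lookup (single v (mon_deg m)) w"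
    using assms by (auto simp: lookup_single when_def in_keys_iff subset_iff)
qed

lemma mp_eval_axis:
  assumes "homog n p"
  shows "mp_eval p ((\<lambda>_. 0)(v := 1)) = lookup p (single v n)"
proof -
  have "keys m \<subseteq> {v} \<longleftrightarrow> m = single v n" if "m \<in> keys p" for m
    using that assms mon_eq_single[of m v] by (auto simp: homog_def split: if_splits)
  hence "mp_eval p ((\<lambda>_. 0)(v := 1)) = (\<Sum>m\<in>keys p. if m = single v n then lookup p m else 0)"
    unfolding mp_eval_eq_mp_subst mp_subst_def mon_eval_axis by (intro sum.cong) auto
  thus ?thesis by (simp add: sum.delta in_keys_iff)
qed

lemma mp_eval_scale:
  assumes "homog n p"
  shows "mp_eval p (\<lambda>v. c * x v) = c ^ n * mp_eval p x"
proof -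
  have "mon_eval (\<lambda>v. c * x v) m = c ^ mon_deg m * mon_eval x m" for m
    by (simp add: mon_eval_def mon_deg_def power_mult_distrib prod.distrib power_sum)
  thus ?thesis using assms
    by (simp add: mp_eval_eq_mp_subst mp_subst_def homog_def sum_distrib_left ac_simps)
qed

lemma mp_eval_origin: "homog n p \<Longrightarrow> n \<ge> 1 \<Longrightarrow> mp_eval p (\<lambda>_. 0) = 0"
  using mp_eval_scale[of n p 0] by (simp add: zero_power)

lemma Euler_homog:
  fixes p :: "('v::finite, 'k::comm_ring_1) mpol"
  assumes "homog n p"
  shows "(\<Sum>j\<in>UNIV. Var j * mp_pderiv j p) = of_nat n * p"
proof -
  have Euler_single: "(\<Sum>j\<in>UNIV. Var j * mp_pderiv j (single m c)) = of_nat (mon_deg m) * single m c"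
    for m :: "'v \<Rightarrow>\<^sub>0 nat" and c :: 'k
  proof -
    have "Var j * mp_pderiv j (single m c) = single m (of_nat (lookup m j) * c)" for j
      by (cases "lookup m j = 0")
        (use diff_single_add[of 1 m j] in \<open>simp_all add: Var_def mp_pderiv_single mult_single add.commute\<close>)
    hence "(\<Sum>j\<in>UNIV. Var j * mp_pderiv j (single m c)) = (\<Sum>j\<in>UNIV. single m (of_nat (lookup m j) * c))"
      by simp
    also have "\<dots> = single m (of_nat (mon_deg m) * c)"
      by (rule poly_mapping_eqI)
        (simp add: lookup_sum mon_deg_superset[of UNIV] lookup_single when_def sum_distrib_right)
    finally show ?thesis by (simp add: mult_single flip: single_of_nat)
  qed
  have "(\<Sum>j\<in>UNIV. Var j * mp_pderiv j p)
      = (\<Sum>m\<in>keys p. \<Sum>j\<in>UNIV. Var j * mp_pderiv j (single m (lookup p m)))"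
    by (subst sum_single_keys[of p, symmetric], subst sum.swap)
      (simp add: mp_pderiv_sum sum_distrib_left)
  also have "\<dots> = (\<Sum>m\<in>keys p. of_nat n * single m (lookup p m))"
    using assms by (intro sum.cong) (auto simp: Euler_single homog_def)
  also have "\<dots> = of_nat n * p"
    by (simp add: sum_single_keys flip: sum_distrib_left)
  finally show ?thesis .
qed

lemma Euler_homog_mp_eval:
  fixes p :: "('v::finite, 'k::comm_ring_1) mpol"
  assumes "homog n p"
  shows "(\<Sum>j\<in>UNIV. x j * mp_eval (mp_pderiv j p) x) = of_nat n * mp_eval p x"
  using arg_cong[OF Euler_homog[OF assms], of "\<lambda>p. mp_eval p x"] by (simp add: hom_distribs)

definition hcomp :: "nat \<Rightarrow> ('v, 'k::comm_ring_1) mpol \<Rightarrow> ('v, 'k) mpol" where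
  "hcomp n p = (\<Sum>m\<in>{m\<in>keys p. mon_deg m = n}. single m (lookup p m))"

lemma lookup_hcomp: "lookup (hcomp n p) m = (if mon_deg m = n then lookup p m else 0)"
proof -
  have "finite {m\<in>keys p. mon_deg m = n}" by simp
  thus ?thesis by (auto simp: hcomp_def lookup_sum lookup_single when_def sum.delta in_keys_iff)
qed

lemma keys_hcomp: "keys (hcomp n p) = {m\<in>keys p. mon_deg m = n}"
  by (auto simp: in_keys_iff lookup_hcomp split: if_splits)

lemma homog_hcomp: "homog n (hcomp n p)"
  by (simp add: homog_def keys_hcomp)

lemma hcomp_homog: "homog n p \<Longrightarrow> hcomp m p = (if m = n then p else 0)"
  by (rule poly_mapping_eqI) (auto simp: lookup_hcomp homog_def in_keys_iff)

lemma hcomp_0 [simp]: "hcomp n 0 = 0"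
  and hcomp_add: "hcomp n (p + q) = hcomp n p + hcomp n q"
  by (rule poly_mapping_eqI, simp add: lookup_hcomp lookup_add)+

lemma hcomp_sum: "hcomp n (sum f A) = (\<Sum>i\<in>A. hcomp n (f i))"
  by (induction A rule: infinite_finite_induct) (simp_all add: hcomp_add)

lemma ex_sum_hcomp: "\<exists>N. (\<Sum>n<N. hcomp n p) = p"
proof -
  define N where "N = Suc (Max (mon_deg ` keys p))"
  have "mon_deg m < N" if "m \<in> keys p" for m
    using that by (auto simp: N_def less_Suc_eq_le)
  hence "(\<Sum>n<N. hcomp n p) = p"
    by (intro poly_mapping_eqI) (auto simp: lookup_sum lookup_hcomp in_keys_iff sum.delta')
  thus ?thesis ..
qed

lemma ex_hcomp_mp_eval_nonzero:
  assumes "mp_eval p x \<noteq> 0"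
  shows "\<exists>n. mp_eval (hcomp n p) x \<noteq> 0"
proof (rule ccontr)
  assume "\<nexists>n. mp_eval (hcomp n p) x \<noteq> 0"
  moreover obtain N where "(\<Sum>n<N. hcomp n p) = p" using ex_sum_hcomp by blast
  ultimately have "mp_eval p x = 0" by (metis mp_eval.hom_sum sum.neutral)
  with assms show False by simp
qed

lemma hcomp_mult_homog:
  assumes homog_h: "homog d h"
  shows "hcomp n (a * h) = (if d \<le> n then hcomp (n - d) a * h else 0)"
proof (induction a rule: single_add_induct)
  case (single m c)
  have "homog (mon_deg m + d) (single m c * h)" by (intro homog_mult homog_single homog_h refl)
  thus ?case by (auto simp: hcomp_homog hcomp_homog[OF homog_single[OF refl]])
qed (simp_all add: hcomp_add distrib_right)


section \<open>The projective Nullstellensatz\<close>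

definition polys_in :: "'v set \<Rightarrow> ('v, 'k::comm_ring_1) mpol set" where
  "polys_in V = {p. \<forall>m\<in>keys p. keys m \<subseteq> V}"

lemma polys_in_mono: "V \<subseteq> W \<Longrightarrow> polys_in V \<subseteq> polys_in W"
  by (auto simp: polys_in_def)

lemma polys_in_UNIV [simp]: "polys_in UNIV = UNIV"
  by (auto simp: polys_in_def)

lemma polys_in_0 [simp]: "0 \<in> polys_in V"
  by (simp add: polys_in_def)

lemma polys_in_Cst [simp]: "Cst c \<in> polys_in V"
  by (simp add: polys_in_def Cst_def)

lemma polys_in_1 [simp]: "1 \<in> polys_in V"
  using polys_in_Cst[of 1 V] by simp

lemma polys_in_Var: "v \<in> V \<Longrightarrow> Var v \<in> polys_in V"
  by (auto simp: polys_in_def Var_def)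

lemma polys_in_add: "p \<in> polys_in V \<Longrightarrow> q \<in> polys_in V \<Longrightarrow> p + q \<in> polys_in V"
  using keys_add[of p q] by (auto simp: polys_in_def)

lemma polys_in_mult:
  assumes "p \<in> polys_in V" "q \<in> polys_in V" shows "p * q \<in> polys_in V"
  unfolding polys_in_def
proof clarify
  fix k v assume "k \<in> keys (p * q)" and v: "v \<in> keys k"
  then obtain a b where monomials: "a \<in> keys p" "b \<in> keys q" "k = a + b" using keys_mult by blast
  hence "v \<in> keys a \<union> keys b" using v keys_add[of a b] by auto
  thus "v \<in> V" using monomials assms by (auto simp: polys_in_def)
qed

lemma polys_in_sum: "(\<And>i. i \<in> A \<Longrightarrow> f i \<in> polys_in V) \<Longrightarrow> sum f A \<in> polys_in V"
  by (induction A rule: infinite_finite_induct) (auto intro: polys_in_add)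

lemma polys_in_prod: "(\<And>i. i \<in> A \<Longrightarrow> f i \<in> polys_in V) \<Longrightarrow> prod f A \<in> polys_in V"
  by (induction A rule: infinite_finite_induct) (auto intro: polys_in_mult)

lemma polys_in_hcomp: "p \<in> polys_in V \<Longrightarrow> hcomp n p \<in> polys_in V"
  by (auto simp: polys_in_def keys_hcomp)

lemma polys_in_det:
  assumes A: "A \<in> carrier_mat n n"
    and entries: "\<And>i j. i < n \<Longrightarrow> j < n \<Longrightarrow> A $$ (i, j) \<in> polys_in V"
  shows "det A \<in> polys_in V"
  unfolding det_def'[OF A] Cst.hom_of_int[symmetric]
proof (intro polys_in_sum polys_in_mult polys_in_Cst polys_in_prod entries)
  fix \<pi> i assume "\<pi> \<in> {\<pi>. \<pi> permutes {0..<n}}" "i \<in> {0..<n}"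
  thus "i < n" "\<pi> i < n" using permutes_in_image[of \<pi> "{0..<n}" i] by auto
qed

lemma mp_subst_cong_polys_in:
  assumes "p \<in> polys_in V" "\<And>v. v \<in> V \<Longrightarrow> s v = t v"
  shows "mp_subst h s p = mp_subst h t p"
  unfolding mp_subst_def mon_eval_def
proof (intro sum.cong prod.cong arg_cong2[where f = "(*)"] refl)
  fix m w assume "m \<in> keys p" "w \<in> keys m"
  hence "w \<in> V" using assms(1) by (auto simp: polys_in_def)
  thus "s w ^ lookup m w = t w ^ lookup m w" by (simp add: assms(2))
qed

lemma mp_eval_cong_polys_in:
  "p \<in> polys_in V \<Longrightarrow> (\<And>v. v \<in> V \<Longrightarrow> x v = y v) \<Longrightarrow> mp_eval p x = mp_eval p y"
  unfolding mp_eval_eq_mp_subst by (rule mp_subst_cong_polys_in)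

definition var_coeff :: "'v \<Rightarrow> nat \<Rightarrow> ('v, 'k::comm_ring_1) mpol \<Rightarrow> ('v, 'k) mpol" where
  "var_coeff v i p = (\<Sum>m\<in>{m\<in>keys p. lookup m v = i}. single (m - single v i) (lookup p m))"

lemma lookup_var_coeff:
  "lookup (var_coeff v i p) m = (if lookup m v = 0 then lookup p (m + single v i) else 0)"
proof -
  have shift_eq: "m' - single v i = m \<longleftrightarrow> lookup m v = 0 \<and> m' = m + single v i" if "lookup m' v = i" for m'
    using that diff_single_add[of i m' v] lookup_add[of m "single v i" v]
    by (metis add_diff_cancel_right' add_eq_self_zero add.commute lookup_single_eq order_refl)
  have "lookup (var_coeff v i p) m = (\<Sum>m'\<in>{m'\<in>keys p. lookup m' v = i}.
      if m' = m + single v i then (if lookup m v = 0 then lookup p m' else 0) else 0)"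
    unfolding var_coeff_def lookup_sum
    by (intro sum.cong) (auto simp: lookup_single when_def shift_eq)
  thus ?thesis by (auto simp: sum.delta in_keys_iff lookup_add)
qed

lemma polys_in_var_coeff:
  assumes "p \<in> polys_in (insert v V)"
  shows "var_coeff v i p \<in> polys_in V"
  unfolding polys_in_def
proof clarify
  fix m w assume "m \<in> keys (var_coeff v i p)" and w: "w \<in> keys m"
  hence m: "lookup m v = 0" "m + single v i \<in> keys p"
    by (auto simp: in_keys_iff lookup_var_coeff split: if_splits)
  hence "w \<in> keys (m + single v i)" using w by (auto simp: in_keys_iff lookup_add lookup_single)
  hence "w \<in> insert v V" using assms m(2) by (auto simp: polys_in_def)
  thus "w \<in> V" using m(1) w by (auto simp: in_keys_iff)
qed

lemma homog_var_coeff: "homog n p \<Longrightarrow> homog (n - i) (var_coeff v i p)"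
  by (auto simp: homog_def in_keys_iff lookup_var_coeff mon_deg_add split: if_splits
      dest!: bspec[of _ _ "_ + single v i"])

lemma sum_var_coeff:
  assumes "\<And>m. m \<in> keys p \<Longrightarrow> lookup m v < n"
  shows "(\<Sum>i<n. var_coeff v i p * Var v ^ i) = p"
proof -
  define K where "K i = {m\<in>keys p. lookup m v = i}" for i
  have "var_coeff v i p * Var v ^ i = (\<Sum>m\<in>K i. single m (lookup p m))" for i
    unfolding var_coeff_def sum_distrib_right Var_power K_def
    by (intro sum.cong) (auto simp: mult_single diff_single_add)
  hence "(\<Sum>i<n. var_coeff v i p * Var v ^ i) = (\<Sum>i<n. \<Sum>m\<in>K i. single m (lookup p m))" by simp
  also have "\<dots> = (\<Sum>m\<in>(\<Union>i<n. K i). single m (lookup p m))"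
    by (subst sum.UNION_disjoint) (auto simp: K_def)
  also have "(\<Union>i<n. K i) = keys p" using assms by (auto simp: K_def)
  finally show ?thesis by (simp add: sum_single_keys)
qed

lemma var_coeff_expansion:
  obtains n where "(\<Sum>i<n. var_coeff v i p * Var v ^ i) = p" "\<And>i. i \<ge> n \<Longrightarrow> var_coeff v i p = 0"
proof
  define n where "n = Suc (Max ((\<lambda>m. lookup m v) ` keys p))"
  have bound: "lookup m v < n" if "m \<in> keys p" for m
    using that by (auto simp: n_def less_Suc_eq_le)
  thus "(\<Sum>i<n. var_coeff v i p * Var v ^ i) = p" by (rule sum_var_coeff)
  show "var_coeff v i p = 0" if "i \<ge> n" for i
  proof -
    have "{m\<in>keys p. lookup m v = i} = {}" using bound that by fastforce
    thus ?thesis by (simp only: var_coeff_def sum.empty)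
  qed
qed

lemma homog_sum_var_coeff:
  assumes "homog n p"
  shows "(\<Sum>i<Suc n. var_coeff v i p * Var v ^ i) = p"
  using assms lookup_le_mon_deg[of _ v] by (intro sum_var_coeff) (auto simp: homog_def less_Suc_eq_le)

lemma homog_expand_var:
  assumes "homog n p"
  shows "p = Cst (lookup p (single v n)) * Var v ^ n + (\<Sum>i<n. var_coeff v i p * Var v ^ i)"
proof -
  have "p = (\<Sum>i<Suc n. var_coeff v i p * Var v ^ i)" by (rule homog_sum_var_coeff[OF assms, symmetric])
  moreover have "var_coeff v n p = Cst (lookup p (single v n))"
    using homog_0_eq_Cst[of "var_coeff v n p"] homog_var_coeff[OF assms, of n v]
    by (simp add: lookup_var_coeff)
  ultimately show ?thesis by (simp add: add.commute)
qed

definition fiber_poly :: "('v \<Rightarrow> 'k::comm_ring_1) \<Rightarrow> 'v \<Rightarrow> ('v, 'k) mpol \<Rightarrow> 'k poly" where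
  "fiber_poly a v = mp_subst (\<lambda>c. [:c:]) ((\<lambda>w. [:a w:])(v := [:0, 1:]))"

interpretation fiber_poly: comm_ring_hom "fiber_poly a v" for a :: "'v \<Rightarrow> 'k::comm_ring_1" and v
  unfolding fiber_poly_def by (rule coeff_lift_hom.comm_ring_hom_mp_subst)

lemma fiber_poly_Cst [simp]: "fiber_poly a v (Cst c) = [:c:]"
  and fiber_poly_Var_same [simp]: "fiber_poly a v (Var v) = [:0, 1:]"
  by (simp_all add: fiber_poly_def)

lemma poly_fiber_poly: "poly (fiber_poly a v p) c = mp_eval p (a(v := c))"
  by (rule mpol_hom_eqI[OF comm_ring_hom_comp[OF poly_hom.comm_ring_hom_axioms
        fiber_poly.comm_ring_hom_axioms] mp_eval.comm_ring_hom_axioms]) (auto simp: fiber_poly_def)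

lemma fiber_poly_polys_in:
  assumes "p \<in> polys_in V" "v \<notin> V"
  shows "fiber_poly a v p = [:mp_eval p a:]"
proof -
  have "fiber_poly a v p = mp_subst (\<lambda>c. [:c:]) (\<lambda>w. [:a w:]) p"
    unfolding fiber_poly_def using assms by (intro mp_subst_cong_polys_in) auto
  thus ?thesis by (simp add: mp_eval_eq_mp_subst coeff_lift_hom.hom_mp_subst)
qed

lemma fiber_poly_surj: "\<exists>q\<in>polys_in {v}. fiber_poly a v q = p"
proof (induction p)
  case (pCons c p)
  then obtain q where "q \<in> polys_in {v}" "fiber_poly a v q = p" by blast
  thus ?case
    by (intro bexI[of _ "Cst c + Var v * q"])
      (auto simp: hom_distribs intro!: polys_in_add polys_in_mult polys_in_Var)
qed (auto intro: bexI[of _ 0])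

lemma coeff_fiber_poly:
  assumes "p \<in> polys_in (insert v V)" "v \<notin> V"
  shows "coeff (fiber_poly a v p) i = mp_eval (var_coeff v i p) a"
proof -
  obtain n where n: "(\<Sum>i<n. var_coeff v i p * Var v ^ i) = p" "\<And>i. i \<ge> n \<Longrightarrow> var_coeff v i p = 0"
    by (rule var_coeff_expansion) blast
  have "fiber_poly a v p = (\<Sum>i<n. monom (mp_eval (var_coeff v i p) a) i)"
    by (subst n(1)[symmetric])
      (simp add: hom_distribs fiber_poly_polys_in[OF polys_in_var_coeff[OF assms(1)] assms(2)] monom_altdef)
  thus ?thesis using n(2)[of i] by (cases "i < n") (simp_all add: coeff_sum sum.delta)
qed

interpretation ideal: Modules.module "(*) :: 'a::comm_ring_1 \<Rightarrow> 'a \<Rightarrow> 'a"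
  by unfold_locales (simp_all add: algebra_simps)

declare ideal.scale_scale [simp del] \<comment> \<open>the reverse of \<open>mult.assoc\<close>\<close>

abbreviation is_ideal :: "'a::comm_ring_1 set \<Rightarrow> bool" where
  "is_ideal \<equiv> ideal.subspace"

lemma det_mult_in_ideal:
  assumes A: "A \<in> carrier_mat n n" and I: "is_ideal I"
    and rows: "\<And>i. i < n \<Longrightarrow> (\<Sum>j<n. A $$ (i, j) * z j) \<in> I" and k_less: "k < n"
  shows "det A * z k \<in> I"
proof -
  have "(\<Sum>i<n. adj_mat A $$ (k, i) * A $$ (i, j)) = (if k = j then det A else 0)" if "j < n" for j
  proof -
    have "(adj_mat A * A) $$ (k, j) = (\<Sum>i<n. adj_mat A $$ (k, i) * A $$ (i, j))"
      using A adj_mat(1)[OF A] k_less that by (auto simp: scalar_prod_def atLeast0LessThan)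
    thus ?thesis using adj_mat(3)[OF A] k_less that by (cases "k = j") simp_all
  qed
  hence "det A * z k = (\<Sum>j<n. (\<Sum>i<n. adj_mat A $$ (k, i) * A $$ (i, j)) * z j)"
    using k_less by (simp add: if_distrib[of "\<lambda>x. x * _"] cong: if_cong)
  also have "\<dots> = (\<Sum>i<n. adj_mat A $$ (k, i) * (\<Sum>j<n. A $$ (i, j) * z j))"
    by (simp add: sum_distrib_left sum_distrib_right mult.assoc) (rule sum.swap)
  also have "\<dots> \<in> I"
    using rows by (auto intro: ideal.subspace_sum[OF I] ideal.subspace_scale[OF I])
  finally show ?thesis .
qed

lemma sum_shift_coeffs:
  fixes z :: "'a::comm_ring_1"
  assumes "i + N \<le> L" "\<And>l. l \<ge> N \<Longrightarrow> s l = 0"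
  shows "(\<Sum>j<L. (if i \<le> j then s (j - i) else 0) * z ^ j) = z ^ i * (\<Sum>l<N. s l * z ^ l)"
proof -
  have "(\<Sum>j<L. (if i \<le> j then s (j - i) else 0) * z ^ j) = (\<Sum>j=i..<i + N. s (j - i) * z ^ j)"
    using assms by (intro sum.mono_neutral_cong_right) auto
  also have "\<dots> = (\<Sum>l<N. s l * z ^ (l + i))"
    using sum.shift_bounds_nat_ivl[of "\<lambda>j. s (j - i) * z ^ j" 0 i N] by (simp add: add.commute atLeast0LessThan)
  finally show ?thesis by (simp add: power_add sum_distrib_left ac_simps)
qed

text \<open>The determinant is the Sylvester resultant of \<open>f = \<Sum> s\<^sub>i v\<^sup>i\<close> and the monic \<open>\<Sum> t\<^sub>i v\<^sup>i\<close>; at \<open>a\<close>,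
  where \<open>f\<close> specializes to \<open>1\<close>, the matrix is unitriangular.\<close>

lemma eliminate_variable:
  fixes I :: "('v, 'k::comm_ring_1) mpol set"
  assumes I: "is_ideal I"
    and s: "\<And>i. s i \<in> polys_in V" "\<And>i. i \<ge> N \<Longrightarrow> s i = 0" "(\<Sum>i<N. s i * Var v ^ i) \<in> I"
    and s_a: "\<And>i. mp_eval (s i) a = (if i = 0 then 1 else 0)"
    and t: "\<And>i. t i \<in> polys_in V" "t n = 1" "\<And>i. i > n \<Longrightarrow> t i = 0" "(\<Sum>i<Suc n. t i * Var v ^ i) \<in> I"
  shows "\<exists>r\<in>I \<inter> polys_in V. mp_eval r a = 1"
proof -
  define A where "A = mat (n + N) (n + N) (\<lambda>(i, j).
     if i < n then (if i \<le> j then s (j - i) else 0) else (if i - n \<le> j then t (j - (i - n)) else 0))"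
  have A: "A \<in> carrier_mat (n + N) (n + N)" by (simp add: A_def)
  have "(\<Sum>j<n + N. A $$ (i, j) * Var v ^ j) \<in> I" if i: "i < n + N" for i
  proof (cases "i < n")
    case True
    have "(\<Sum>j<n + N. A $$ (i, j) * Var v ^ j)
        = (\<Sum>j<n + N. (if i \<le> j then s (j - i) else 0) * Var v ^ j)"
      using True by (intro sum.cong) (simp_all add: A_def)
    also have "\<dots> = Var v ^ i * (\<Sum>l<N. s l * Var v ^ l)"
      using True s(2) by (intro sum_shift_coeffs) auto
    also have "\<dots> \<in> I" by (rule ideal.subspace_scale[OF I s(3)])
    finally show ?thesis .
  next
    case False
    have "(\<Sum>j<n + N. A $$ (i, j) * Var v ^ j)
        = (\<Sum>j<n + N. (if i - n \<le> j then t (j - (i - n)) else 0) * Var v ^ j)"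
      using False i by (intro sum.cong) (simp_all add: A_def)
    also have "\<dots> = Var v ^ (i - n) * (\<Sum>l<Suc n. t l * Var v ^ l)"
      using False i t(3) by (intro sum_shift_coeffs) auto
    also have "\<dots> \<in> I" by (rule ideal.subspace_scale[OF I t(4)])
    finally show ?thesis .
  qed
  moreover have "0 < n + N" using s_a[of 0] s(2)[of 0] by (cases N) auto
  ultimately have "det A * Var v ^ 0 \<in> I" by (intro det_mult_in_ideal[OF A I])
  moreover have "det A \<in> polys_in V"
    using s(1) t(1) by (intro polys_in_det[OF A]) (auto simp: A_def)
  moreover have "mp_eval (det A) a = 1"
  proof -
    define A\<^sub>a where "A\<^sub>a = map_mat (\<lambda>p. mp_eval p a) A"
    have "det A\<^sub>a = prod_list (diag_mat A\<^sub>a)"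
      by (rule det_lower_triangular[of "n + N"]) (auto simp: A\<^sub>a_def A_def s_a t(3))
    also have "diag_mat A\<^sub>a = replicate (n + N) 1"
      by (intro nth_equalityI) (auto simp: diag_mat_def A\<^sub>a_def A_def s_a t(2))
    finally show ?thesis by (simp add: A\<^sub>a_def mp_eval.hom_det)
  qed
  ultimately show ?thesis by auto
qed

definition homog_ideal :: "('v, 'k::comm_ring_1) mpol set \<Rightarrow> bool" where
  "homog_ideal I \<longleftrightarrow> is_ideal I \<and> (\<forall>p\<in>I. \<forall>n. hcomp n p \<in> I)"

definition zeros_in :: "'v set \<Rightarrow> ('v, 'k::comm_ring_1) mpol set \<Rightarrow> ('v \<Rightarrow> 'k) set" where
  "zeros_in W I = {x. (\<forall>w. w \<notin> W \<longrightarrow> x w = 0) \<and> (\<forall>f\<in>I \<inter> polys_in W. mp_eval f x = 0)}"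

lemma ex_monic_in_homog_ideal:
  fixes I :: "('v, 'k::field) mpol set"
  assumes I: "homog_ideal I" and zeros: "zeros_in W I \<subseteq> {\<lambda>_. 0}" and w: "w \<in> W"
  shows "\<exists>n. \<exists>f\<in>I \<inter> polys_in W. homog n f \<and> lookup f (single w n) = 1"
proof -
  have "(\<lambda>_. 0)(w := 1) \<noteq> (\<lambda>_. 0 :: 'k)" by (metis fun_upd_same zero_neq_one)
  hence "(\<lambda>_. 0)(w := 1) \<notin> zeros_in W I" using zeros by blast
  then obtain f n where f: "f \<in> I" "f \<in> polys_in W" "mp_eval (hcomp n f) ((\<lambda>_. 0)(w := 1)) \<noteq> 0"
    using w ex_hcomp_mp_eval_nonzero unfolding zeros_in_def by fastforce
  define b where "b = lookup (hcomp n f) (single w n)"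
  have b: "b \<noteq> 0" using f(3) by (simp add: mp_eval_axis[OF homog_hcomp] b_def)
  define g where "g = Cst (inverse b) * hcomp n f"
  have g: "homog n g" unfolding g_def by (intro homog_Cst_mult homog_hcomp)
  moreover have "lookup g (single w n) = 1"
    using b mp_eval_axis[OF g, of w] by (simp add: g_def hom_distribs mp_eval_axis[OF homog_hcomp] b_def)
  moreover have "g \<in> I \<inter> polys_in W"
    using f I unfolding g_def homog_ideal_def
    by (auto intro: ideal.subspace_scale polys_in_mult polys_in_hcomp)
  ultimately show ?thesis by blast
qed

locale algebraically_closed =
  fixes field_type :: "'k::field itself"
  assumes ex_root: "degree p \<ge> 1 \<Longrightarrow> \<exists>x. poly (p :: 'k poly) x = 0"
begin

lemma one_in_poly_ideal:
  assumes I: "is_ideal I" and no_root: "\<And>c. \<exists>p\<in>I. poly p c \<noteq> (0 :: 'k)"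
  shows "1 \<in> I"
proof -
  obtain p0 where "p0 \<in> I \<and> p0 \<noteq> 0" using no_root[of 0] by fastforce
  then obtain d where d: "d \<in> I" "d \<noteq> 0" and least: "\<And>p. p \<in> I \<Longrightarrow> p \<noteq> 0 \<Longrightarrow> degree d \<le> degree p"
    using ex_has_least_nat[of "\<lambda>p. p \<in> I \<and> p \<noteq> 0" p0 degree] by auto
  have d_dvd: "d dvd p" if "p \<in> I" for p
  proof (rule ccontr)
    assume "\<not> d dvd p"
    hence "p mod d \<noteq> 0" by (simp add: dvd_eq_mod_eq_0)
    moreover have "p mod d \<in> I"
      using ideal.subspace_diff[OF I that ideal.subspace_scale[OF I d(1), of "p div d"]]
      unfolding minus_div_mult_eq_mod .
    ultimately show False using least[of "p mod d"] degree_mod_less'[OF d(2), of p] by simp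
  qed
  have "degree d = 0"
  proof (rule ccontr)
    assume "degree d \<noteq> 0"
    then obtain c where "poly d c = 0" using ex_root[of d] by auto
    hence "poly p c = 0" if "p \<in> I" for p
      using d_dvd[OF that] by (meson dvd_trans poly_eq_0_iff_dvd)
    thus False using no_root[of c] by blast
  qed
  then obtain c where d_const: "d = [:c:]" "c \<noteq> 0" using d(2) degree_eq_zeroE by (metis pCons_0_0)
  hence "[:inverse c:] * d = 1" by simp
  thus ?thesis using ideal.subspace_scale[OF I d(1), of "[:inverse c:]"] by simp
qed

lemma extend_common_zero:
  fixes I :: "('v, 'k) mpol set"
  assumes v: "v \<notin> V" and I: "is_ideal I"
    and t: "\<And>i. t i \<in> polys_in V" "Var v ^ n + (\<Sum>i<n. t i * Var v ^ i) \<in> I"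
    and zero: "\<And>f. f \<in> I \<inter> polys_in V \<Longrightarrow> mp_eval f a = 0"
  shows "\<exists>c. \<forall>f\<in>I \<inter> polys_in (insert v V). mp_eval f (a(v := c)) = 0"
proof (rule ccontr)
  assume no_zero: "\<nexists>c. \<forall>f\<in>I \<inter> polys_in (insert v V). mp_eval f (a(v := c)) = 0"
  have "is_ideal (fiber_poly a v ` (I \<inter> polys_in (insert v V)))"
  proof (rule ideal.subspaceI)
    show "0 \<in> fiber_poly a v ` (I \<inter> polys_in (insert v V))"
      using ideal.subspace_0[OF I] by (intro image_eqI[of _ _ 0]) auto
  next
    fix p q assume "p \<in> fiber_poly a v ` (I \<inter> polys_in (insert v V))"
      "q \<in> fiber_poly a v ` (I \<inter> polys_in (insert v V))"
    thus "p + q \<in> fiber_poly a v ` (I \<inter> polys_in (insert v V))"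
      by (auto intro: imageI ideal.subspace_add[OF I] polys_in_add simp flip: fiber_poly.hom_add)
  next
    fix c :: "'k poly" and p assume "p \<in> fiber_poly a v ` (I \<inter> polys_in (insert v V))"
    moreover obtain q where "q \<in> polys_in {v}" "fiber_poly a v q = c" using fiber_poly_surj[of v a c] by blast
    moreover have "polys_in {v} \<subseteq> polys_in (insert v V)" by (intro polys_in_mono) simp
    ultimately show "c * p \<in> fiber_poly a v ` (I \<inter> polys_in (insert v V))"
      by (auto intro!: imageI ideal.subspace_scale[OF I] polys_in_mult simp flip: fiber_poly.hom_mult)
  qed
  hence "1 \<in> fiber_poly a v ` (I \<inter> polys_in (insert v V))"
    using no_zero by (intro one_in_poly_ideal) (auto simp: poly_fiber_poly)
  then obtain f where f: "f \<in> I" "f \<in> polys_in (insert v V)" "fiber_poly a v f = 1" by auto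
  obtain N where N: "(\<Sum>i<N. var_coeff v i f * Var v ^ i) = f" "\<And>i. i \<ge> N \<Longrightarrow> var_coeff v i f = 0"
    by (rule var_coeff_expansion) blast
  have "\<exists>r\<in>I \<inter> polys_in V. mp_eval r a = 1"
  proof (rule eliminate_variable[OF I])
    show "var_coeff v i f \<in> polys_in V" for i using f(2) by (rule polys_in_var_coeff)
    show "mp_eval (var_coeff v i f) a = (if i = 0 then 1 else 0)" for i
      using coeff_fiber_poly[OF f(2) v, of a i] f(3) by (cases "i = 0") simp_all
    show "(if i < n then t i else if i = n then 1 else 0) \<in> polys_in V" for i using t(1) by auto
    show "(\<Sum>i<Suc n. (if i < n then t i else if i = n then 1 else 0) * Var v ^ i) \<in> I"
      using t(2) by (simp add: add.commute)
  qed (use f(1) N in auto)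
  thus False using zero by fastforce
qed

lemma zeros_in_trivial_of_insert:
  fixes I :: "('v, 'k) mpol set"
  assumes w: "w \<notin> W" and I: "homog_ideal I" and zeros: "zeros_in (insert w W) I \<subseteq> {\<lambda>_. 0}"
  shows "zeros_in W I \<subseteq> {\<lambda>_. 0}"
proof
  fix x assume x: "x \<in> zeros_in W I"
  obtain n f where f: "f \<in> I" "f \<in> polys_in (insert w W)" "homog n f" "lookup f (single w n) = 1"
    using ex_monic_in_homog_ideal[OF I zeros, of w] by auto
  have "\<exists>c. \<forall>f\<in>I \<inter> polys_in (insert w W). mp_eval f (x(w := c)) = 0"
  proof (rule extend_common_zero[OF w])
    show "is_ideal I" using I by (simp add: homog_ideal_def)
    show "var_coeff w i f \<in> polys_in W" for i using f(2) by (rule polys_in_var_coeff)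
    show "Var w ^ n + (\<Sum>i<n. var_coeff w i f * Var w ^ i) \<in> I"
      using f(1,4) homog_expand_var[OF f(3), of w] by simp
    show "mp_eval f x = 0" if "f \<in> I \<inter> polys_in W" for f
      using x that by (auto simp: zeros_in_def)
  qed
  then obtain c where "x(w := c) \<in> zeros_in (insert w W) I" using x by (auto simp: zeros_in_def)
  hence "x(w := c) = (\<lambda>_. 0)" using zeros by auto
  moreover have "x w = 0" using x w by (auto simp: zeros_in_def)
  ultimately have "x v = 0" for v by (metis fun_upd_other)
  thus "x \<in> {\<lambda>_. 0}" by auto
qed

lemma Var_power_in_homog_ideal:
  fixes I :: "('v, 'k) mpol set"
  assumes "finite V" "i \<notin> V" and I: "homog_ideal I" and "zeros_in (insert i V) I \<subseteq> {\<lambda>_. 0}"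
  shows "\<exists>N. Var i ^ N \<in> I"
  using assms(1,2,4)
proof (induction V rule: finite_induct)
  case empty
  from ex_monic_in_homog_ideal[OF I empty(2)] obtain n f where
    f: "f \<in> I" "f \<in> polys_in {i}" "homog n f" "lookup f (single i n) = 1" by auto
  have "m = single i n" if "m \<in> keys f" for m
    using f that mon_eq_single[of m i] by (auto simp: polys_in_def homog_def)
  hence "f = Var i ^ n"
    unfolding Var_power using f(4)
    by (intro poly_mapping_eqI) (auto simp: lookup_single when_def in_keys_iff)
  thus ?case using f(1) by auto
next
  case (insert v V)
  have "v \<notin> insert i V" using insert.hyps(2) insert.prems(1) by auto
  moreover have "zeros_in (insert v (insert i V)) I \<subseteq> {\<lambda>_. 0}"
    using insert.prems(2) by (simp only: insert_commute[of v i])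
  ultimately have "zeros_in (insert i V) I \<subseteq> {\<lambda>_. 0}" by (rule zeros_in_trivial_of_insert[OF _ I])
  thus ?case using insert.IH insert.prems(1) by simp
qed

end

lemma span_image_eq_sum:
  assumes "finite K" "p \<in> ideal.span (h ` K)"
  shows "\<exists>c. p = (\<Sum>i\<in>K. c i * h i)"
  using assms(2)
proof (induction rule: ideal.span_induct_alt)
  case base
  show ?case by (intro exI[of _ "\<lambda>_. 0"]) simp
next
  case (step r x y)
  then obtain i c where i: "i \<in> K" "x = h i" and y_eq: "y = (\<Sum>j\<in>K. c j * h j)" by blast
  have "r * x = (\<Sum>j\<in>K. (if j = i then r else 0) * h j)"
    using i assms(1) by (simp add: if_distrib[of "\<lambda>x. x * _"] cong: if_cong)
  hence "r * x + y = (\<Sum>j\<in>K. ((if j = i then r else 0) + c j) * h j)"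
    by (simp add: y_eq distrib_right sum.distrib)
  thus ?case by (rule exI[of _ "\<lambda>j. (if j = i then r else 0) + c j"])
qed

lemma hcomp_span_homog:
  assumes K: "finite K" and h: "\<And>i. i \<in> K \<Longrightarrow> homog (d i) (h i)" and p: "p \<in> ideal.span (h ` K)"
  shows "\<exists>c. (\<forall>i\<in>K. homog (n - d i) (c i)) \<and> hcomp n p = (\<Sum>i\<in>K. c i * h i)"
proof -
  obtain c where p_eq: "p = (\<Sum>i\<in>K. c i * h i)" using span_image_eq_sum[OF K p] by blast
  define c' where "c' i = (if d i \<le> n then hcomp (n - d i) (c i) else 0)" for i
  have "hcomp n p = (\<Sum>i\<in>K. c' i * h i)"
    unfolding p_eq hcomp_sum by (intro sum.cong) (auto simp: c'_def hcomp_mult_homog[OF h])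
  moreover have "homog (n - d i) (c' i)" for i by (simp add: c'_def homog_hcomp)
  ultimately show ?thesis by blast
qed

definition monomials :: "nat \<Rightarrow> ('v \<Rightarrow>\<^sub>0 nat) set" where
  "monomials n = {m. mon_deg m = n}"

context algebraically_closed
begin

theorem projective_nullstellensatz:
  fixes h :: "'i \<Rightarrow> ('v::finite, 'k) mpol"
  assumes K: "finite K" and h: "\<And>i. i \<in> K \<Longrightarrow> homog (d i) (h i)"
    and zero: "\<And>x. (\<forall>i\<in>K. mp_eval (h i) x = 0) \<Longrightarrow> x = (\<lambda>_. 0)"
  shows "\<exists>N. \<forall>n\<ge>N. \<forall>p. homog n p \<longrightarrow>
    (\<exists>c. (\<forall>i\<in>K. homog (n - d i) (c i)) \<and> p = (\<Sum>i\<in>K. c i * h i))"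
proof -
  define I where "I = ideal.span (h ` K)"
  have ideal: "is_ideal I" by (simp add: I_def)
  have "(\<Sum>i\<in>K. c i * h i) \<in> I" for c
    unfolding I_def by (rule ideal.span_sum, rule ideal.span_scale, rule ideal.span_base) simp
  hence "hcomp n p \<in> I" if "p \<in> I" for n p
    using hcomp_span_homog[OF K h that[unfolded I_def], of n] by auto
  hence homog: "homog_ideal I" using ideal by (simp add: homog_ideal_def)
  have zeros: "zeros_in UNIV I \<subseteq> {\<lambda>_. 0}"
    using zero by (auto simp: zeros_in_def I_def ideal.span_base)
  have "\<exists>N. Var i ^ N \<in> I" for i
    using zeros by (intro Var_power_in_homog_ideal[of "UNIV - {i}"] homog) (auto simp: insert_absorb)
  then obtain N where N: "\<And>i. Var i ^ N i \<in> I" by metis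
  have monomial: "single m c \<in> I" if m: "mon_deg m \<ge> (\<Sum>i\<in>UNIV. N i)" for m c
  proof -
    have "\<exists>i. lookup m i \<ge> N i"
    proof (rule ccontr)
      assume "\<not> (\<exists>i. lookup m i \<ge> N i)"
      hence "(\<Sum>i\<in>UNIV. lookup m i) < (\<Sum>i\<in>UNIV. N i)" by (intro sum_strict_mono) (auto simp: not_le)
      thus False using m by (simp add: mon_deg_superset[of UNIV])
    qed
    then obtain i where "lookup m i \<ge> N i" ..
    hence "single m c = single (m - single i (N i)) c * Var i ^ N i"
      by (simp add: Var_power mult_single diff_single_add)
    thus ?thesis using ideal.subspace_scale[OF ideal N] by simp
  qed
  have "\<exists>c. (\<forall>i\<in>K. homog (n - d i) (c i)) \<and> p = (\<Sum>i\<in>K. c i * h i)"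
    if "n \<ge> (\<Sum>i\<in>UNIV. N i)" "homog n p" for n p
  proof -
    have "(\<Sum>m\<in>keys p. single m (lookup p m)) \<in> I"
      using that by (intro ideal.subspace_sum[OF ideal] monomial) (auto simp: homog_def)
    hence "p \<in> ideal.span (h ` K)" by (simp add: sum_single_keys I_def)
    from hcomp_span_homog[OF K h this, of n] show ?thesis using that(2) by (simp add: hcomp_homog)
  qed
  thus ?thesis by blast
qed

lemma nullstellensatz_monomials:
  fixes h :: "'i \<Rightarrow> ('v::finite, 'k) mpol"
  assumes "finite K" "\<And>i. i \<in> K \<Longrightarrow> homog (d i) (h i)"
    and "\<And>x. (\<forall>i\<in>K. mp_eval (h i) x = 0) \<Longrightarrow> x = (\<lambda>_. 0)"
  shows "\<exists>N. \<forall>n\<ge>N. \<exists>c. \<forall>m\<in>monomials n.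
    (\<forall>i\<in>K. homog (n - d i) (c m i)) \<and> single m 1 = (\<Sum>i\<in>K. c m i * h i)"
proof -
  obtain N where N: "\<And>n p. n \<ge> N \<Longrightarrow> homog n p \<Longrightarrow>
    \<exists>c. (\<forall>i\<in>K. homog (n - d i) (c i)) \<and> p = (\<Sum>i\<in>K. c i * h i)"
    using projective_nullstellensatz[of K d h] assms by blast
  have "\<exists>c. \<forall>m\<in>monomials n. (\<forall>i\<in>K. homog (n - d i) (c m i)) \<and> single m 1 = (\<Sum>i\<in>K. c m i * h i)"
    if "n \<ge> N" for n
  proof (rule bchoice, rule ballI)
    fix m :: "'v \<Rightarrow>\<^sub>0 nat" assume "m \<in> monomials n"
    thus "\<exists>c. (\<forall>i\<in>K. homog (n - d i) (c i)) \<and> single m 1 = (\<Sum>i\<in>K. c i * h i)"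
      by (intro N[OF that] homog_single) (simp add: monomials_def)
  qed
  thus ?thesis by blast
qed

end


section \<open>Linear relations between forms\<close>

lemma bij_betw_monomials:
  "bij_betw (\<lambda>m. Abs_multiset (lookup m)) (monomials n :: ('v::finite \<Rightarrow>\<^sub>0 nat) set)
     (multisets_of_size UNIV n)"
proof (rule bij_betw_byWitness[where f' = "\<lambda>M. Abs_poly_mapping (count M)"])
  have size: "size M = (\<Sum>v\<in>UNIV. count M v)" for M :: "'v multiset"
    unfolding size_multiset_overloaded_eq by (rule sum.mono_neutral_left) (auto simp: not_in_iff)
  show "(\<lambda>m. Abs_multiset (lookup m)) ` (monomials n :: ('v \<Rightarrow>\<^sub>0 nat) set) \<subseteq> multisets_of_size UNIV n"
    by (auto simp: multisets_of_size_def monomials_def size mon_deg_superset[of UNIV])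
  show "(\<lambda>M. Abs_poly_mapping (count M)) ` multisets_of_size UNIV n \<subseteq> (monomials n :: ('v \<Rightarrow>\<^sub>0 nat) set)"
    by (auto simp: multisets_of_size_def monomials_def size mon_deg_superset[of UNIV])
qed (auto simp: poly_mapping_eq_iff multiset_eq_iff)

lemma finite_monomials [simp]: "finite (monomials n :: ('v::finite \<Rightarrow>\<^sub>0 nat) set)"
  unfolding bij_betw_finite[OF bij_betw_monomials] by (rule finite_multisets_of_size) simp

lemma card_monomials: "card (monomials n :: ('v::finite \<Rightarrow>\<^sub>0 nat) set) = (CARD('v) + n - 1) choose n"
  unfolding bij_betw_same_card[OF bij_betw_monomials] by (simp add: card_multisets_of_size)

lemma card_monomials_3: "2 * card (monomials n :: (3 \<Rightarrow>\<^sub>0 nat) set) = (n + 1) * (n + 2)"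
proof -
  have "card (monomials n :: (3 \<Rightarrow>\<^sub>0 nat) set) = (n + 2) choose 2"
    using binomial_symmetric[of n "n + 2"] by (simp add: card_monomials)
  thus ?thesis by (simp add: choose_two)
qed

lemma card_monomials_3_less:
  assumes "a \<ge> 1" "b \<ge> 1"
  shows "card (monomials (k + a) :: (3 \<Rightarrow>\<^sub>0 nat) set) + card (monomials (k + b) :: (3 \<Rightarrow>\<^sub>0 nat) set)
    < card (monomials (k + a + b) :: (3 \<Rightarrow>\<^sub>0 nat) set) + card (monomials k :: (3 \<Rightarrow>\<^sub>0 nat) set)"
proof -
  have "(k + a + 1) * (k + a + 2) + (k + b + 1) * (k + b + 2) + 2 * (a * b)
      = (k + a + b + 1) * (k + a + b + 2) + (k + 1) * (k + 2)" by (simp add: algebra_simps)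
  moreover have "a * b > 0" using assms by simp
  ultimately show ?thesis
    using card_monomials_3[of "k + a"] card_monomials_3[of "k + b"] card_monomials_3[of "k + a + b"] card_monomials_3[of k]
    by linarith
qed

definition form_of :: "nat \<Rightarrow> (('v \<Rightarrow>\<^sub>0 nat) \<Rightarrow> 'k) \<Rightarrow> ('v, 'k::comm_ring_1) mpol" where
  "form_of n c = (\<Sum>m\<in>monomials n. single m (c m))"

lemma homog_form_of: "homog n (form_of n c)"
  unfolding form_of_def by (intro homog_sum homog_single) (simp add: monomials_def)

lemma lookup_form_of: "lookup (form_of n c) m = (if m \<in> monomials n then c m else 0)"
  for m :: "'v::finite \<Rightarrow>\<^sub>0 nat"
  by (simp add: form_of_def lookup_sum lookup_single when_def)

lemma form_of_eq_0D: "form_of n c = 0 \<Longrightarrow> m \<in> monomials n \<Longrightarrow> c m = 0"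
  for m :: "'v::finite \<Rightarrow>\<^sub>0 nat"
  using lookup_form_of[of n c m] by simp

lemma form_of_eq_sum: "form_of n c = (\<Sum>m\<in>monomials n. Cst (c m) * single m 1)"
  by (simp add: form_of_def Cst_def mult_single)

lemma ex_linear_relation:
  fixes v :: "'a \<Rightarrow> 'b \<Rightarrow> 'k::field"
  assumes "finite A" "finite B" "card B < card A"
  shows "\<exists>c. (\<exists>a\<in>A. c a \<noteq> 0) \<and> (\<forall>b\<in>B. (\<Sum>a\<in>A. c a * v a b) = 0)"
proof -
  define n where "n = card A"
  obtain f where f: "bij_betw f {..<n} A"
    using assms(1) ex_bij_betw_nat_finite n_def atLeast0LessThan by metis
  obtain g where g: "bij_betw g {..<card B} B"
    using assms(2) ex_bij_betw_nat_finite atLeast0LessThan by metis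
  define M where "M = mat n n (\<lambda>(i, j). if i < card B then v (f j) (g i) else 0)"
  have M: "M \<in> carrier_mat n n" by (simp add: M_def)
  have "det M = (\<Sum>j<n. M $$ (n - 1, j) * cofactor M (n - 1) j)"
    using assms(3) by (intro laplace_expansion_row[OF M]) (simp add: n_def)
  hence "det M = 0" using assms(3) by (simp add: M_def n_def)
  then obtain w where w: "w \<in> carrier_vec n" "w \<noteq> 0\<^sub>v n" "M *\<^sub>v w = 0\<^sub>v n"
    using det_0_iff_vec_prod_zero_field[OF M] by blast
  define c where "c a = w $ (the_inv_into {..<n} f a)" for a
  have c_apply: "c (f j) = w $ j" if "j < n" for j
    using that f by (simp add: c_def the_inv_into_f_f bij_betw_def)
  obtain j where j: "j < n" "w $ j \<noteq> 0" using w(1,2) by (metis carrier_vecD eq_vecI index_zero_vec)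
  have "f j \<in> A" using bij_betw_apply[OF f] j(1) by simp
  moreover have "c (f j) \<noteq> 0" using c_apply[OF j(1)] j(2) by simp
  ultimately have "\<exists>a\<in>A. c a \<noteq> 0" by blast
  moreover have "(\<Sum>a\<in>A. c a * v a b) = 0" if "b \<in> B" for b
  proof -
    have "b \<in> g ` {..<card B}" using bij_betw_imp_surj_on[OF g] that by simp
    then obtain i where i: "i < card B" "b = g i" by auto
    have "(\<Sum>a\<in>A. c a * v a b) = (\<Sum>j<n. c (f j) * v (f j) b)"
      by (rule sum.reindex_bij_betw[OF f, symmetric])
    also have "\<dots> = (M *\<^sub>v w) $ i"
      using i assms(3) w(1)
      by (simp add: M_def n_def c_apply[unfolded n_def] scalar_prod_def atLeast0LessThan mult.commute)
    also have "\<dots> = 0" using w(3) i(1) assms(3) by (simp add: n_def)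
    finally show ?thesis .
  qed
  ultimately show ?thesis by blast
qed

lemma ex_form_relation:
  fixes u :: "'i \<Rightarrow> 'j \<Rightarrow> ('v::finite, 'k::field) mpol"
  assumes I: "finite I" and J: "finite J" and u: "\<And>i j. i \<in> I \<Longrightarrow> j \<in> J \<Longrightarrow> homog (t j) (u i j)"
    and less: "(\<Sum>j\<in>J. card (monomials (t j) :: ('v \<Rightarrow>\<^sub>0 nat) set)) < card I"
  shows "\<exists>c. (\<exists>i\<in>I. c i \<noteq> 0) \<and> (\<forall>j\<in>J. (\<Sum>i\<in>I. Cst (c i) * u i j) = 0)"
proof -
  define B :: "('j \<times> ('v \<Rightarrow>\<^sub>0 nat)) set" where "B = (SIGMA j:J. monomials (t j))"
  have "finite B" "card B < card I" using J less by (simp_all add: B_def)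
  then obtain c where relation: "\<exists>i\<in>I. c i \<noteq> 0"
    "\<And>j m. (j, m) \<in> B \<Longrightarrow> (\<Sum>i\<in>I. c i * lookup (u i j) m) = 0"
    using ex_linear_relation[OF I, of B "\<lambda>i (j, m). lookup (u i j) m"] by fastforce
  have "(\<Sum>i\<in>I. Cst (c i) * u i j) = 0" if j: "j \<in> J" for j
  proof (rule poly_mapping_eqI)
    fix m
    have "lookup (\<Sum>i\<in>I. Cst (c i) * u i j) m = (\<Sum>i\<in>I. c i * lookup (u i j) m)"
      by (simp add: lookup_sum lookup_Cst_mult)
    also have "\<dots> = 0"
    proof (cases "m \<in> monomials (t j)")
      case True
      thus ?thesis using relation(2) j by (simp add: B_def)
    next
      case False
      hence "lookup (u i j) m = 0" if "i \<in> I" for i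
        using u[OF that j] by (auto simp: monomials_def homog_def in_keys_iff)
      thus ?thesis by simp
    qed
    finally show "lookup (\<Sum>i\<in>I. Cst (c i) * u i j) m = lookup 0 m" by simp
  qed
  thus ?thesis using relation(1) by blast
qed

lemma ex_algebraic_relation_mod:
  fixes J :: "'k::field pol3" and s :: "3 \<Rightarrow> 'k pol3"
  assumes J: "homog e J" "J \<noteq> 0" and s: "\<And>i. homog D (s i)" "D \<ge> 1"
  shows "\<exists>n F. homog n F \<and> F \<noteq> 0 \<and> J dvd pullback s F"
proof -
  define n where "n = e * (2 * D + 3) + 1"
  define t where "t = n * D - e"
  have "e \<le> n" by (simp add: n_def algebra_simps)
  also have "n \<le> n * D" using s(2) by simp
  finally have t: "e + t = n * D" by (simp add: t_def)
  define I :: "((3 \<Rightarrow>\<^sub>0 nat) + (3 \<Rightarrow>\<^sub>0 nat)) set" where "I = monomials n <+> monomials t"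
  define u where "u = case_sum (mon_eval s) (\<lambda>m. J * single m 1)"
  have "homog (n * D) (u i)" if "i \<in> I" for i
    using that homog_mon_eval[of D s] s(1) homog_mult[OF J(1) homog_single, of _ t] t
    by (auto simp: I_def u_def monomials_def)
  moreover have "card (monomials (n * D) :: (3 \<Rightarrow>\<^sub>0 nat) set) < card I"
  proof -
    have "(n * D + 1) * (n * D + 2) + e * e = (t + 1) * (t + 2) + e * (2 * (n * D) + 3)"
      unfolding t[symmetric] by (simp add: algebra_simps)
    also have "e * (2 * (n * D) + 3) \<le> n * (e * (2 * D + 3))"
      by (cases "e = 0") (simp_all add: n_def algebra_simps)
    also have "\<dots> < (n + 1) * (n + 2)" by (simp add: n_def algebra_simps)
    finally have "(n * D + 1) * (n * D + 2) < (n + 1) * (n + 2) + (t + 1) * (t + 2)" by simp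
    thus ?thesis using card_monomials_3[of n] card_monomials_3[of t] card_monomials_3[of "n * D"]
      by (simp add: I_def card_Plus)
  qed
  ultimately obtain c where relation: "\<exists>i\<in>I. c i \<noteq> 0" "(\<Sum>i\<in>I. Cst (c i) * u i) = 0"
    using ex_form_relation[of I "UNIV :: unit set" "\<lambda>_. n * D" "\<lambda>i _. u i"] by (auto simp: I_def)
  define F where "F = form_of n (\<lambda>m. c (Inl m))"
  define G where "G = form_of t (\<lambda>m. c (Inr m))"
  have pullback_eq: "pullback s F + J * G = 0"
    using relation(2) by (simp add: I_def sum.Plus u_def F_def G_def form_of_eq_sum hom_distribs
        pullback.hom_mult Cst.mp_subst_single sum_distrib_left ac_simps)
  have "F \<noteq> 0"
  proof
    assume "F = 0"
    hence "G = 0" using pullback_eq J(2) by simp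
    thus False using \<open>F = 0\<close> relation(1) form_of_eq_0D unfolding F_def G_def I_def by blast
  qed
  moreover have "homog n F" by (simp add: F_def homog_form_of)
  moreover have "J dvd pullback s F" using pullback_eq by (metis add_eq_0_iff dvd_minus_iff dvd_triv_left)
  ultimately show ?thesis by blast
qed

lemma minimal_algebraic_relation_mod:
  fixes J :: "'k::field pol3" and s :: "3 \<Rightarrow> 'k pol3"
  assumes "homog e J" "J \<noteq> 0" "\<And>i. homog D (s i)" "D \<ge> 1"
  obtains n F where "homog n F" "F \<noteq> 0" "J dvd pullback s F"
    "\<And>m G. m < n \<Longrightarrow> homog m G \<Longrightarrow> J dvd pullback s G \<Longrightarrow> G = 0"
proof -
  let ?P = "\<lambda>n. \<exists>F. homog n F \<and> F \<noteq> 0 \<and> J dvd pullback s F"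
  have "?P (LEAST n. ?P n)" using ex_algebraic_relation_mod[OF assms] by (rule LeastI_ex)
  then obtain F where F: "homog (LEAST n. ?P n) F" "F \<noteq> 0" "J dvd pullback s F" by blast
  show thesis
  proof (rule that[OF F])
    show "G = 0" if "m < (LEAST n. ?P n)" "homog m G" "J dvd pullback s G" for m G
      using not_less_Least[OF that(1)] that(2,3) by blast
  qed
qed


section \<open>Intersections of plane curves\<close>

definition proj_zeros :: "('v, 'k::comm_ring_1) mpol \<Rightarrow> ('v \<Rightarrow> 'k) set" where
  "proj_zeros p = {x. (\<exists>i. x i \<noteq> 0) \<and> mp_eval p x = 0}"

lemma mp_eval_eq_0_of_dvd: "J dvd p \<Longrightarrow> x \<in> proj_zeros J \<Longrightarrow> mp_eval p x = 0"
  by (auto simp: proj_zeros_def hom_distribs)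

text \<open>Let \<open>S\<^sub>n\<close> be the space of forms of degree \<open>n\<close>. If \<open>(p, q) \<mapsto> p A + q B\<close> mapped \<open>S\<^sub>n\<^sub>-\<^sub>a \<times> S\<^sub>n\<^sub>-\<^sub>b\<close> onto \<open>S\<^sub>n\<close>, then
  \<open>dim S\<^sub>n + dim S\<^sub>n\<^sub>-\<^sub>a\<^sub>-\<^sub>b \<le> dim S\<^sub>n\<^sub>-\<^sub>a + dim S\<^sub>n\<^sub>-\<^sub>b\<close>, since the kernel contains all \<open>(r B, - r A)\<close>. But the
  difference of the two sides is \<open>ab\<close>.\<close>

lemma ex_monomial_not_in_ideal_of_two_forms:
  fixes A B :: "'k::field pol3"
  assumes A: "homog a A" "a \<ge> 1" and B: "homog b B" "b \<ge> 1" and nonzero: "A \<noteq> 0 \<or> B \<noteq> 0"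
    and n: "n \<ge> a + b"
  shows "\<exists>m\<in>monomials n. \<forall>p q. homog (n - a) p \<longrightarrow> homog (n - b) q \<longrightarrow> single m 1 \<noteq> p * A + q * B"
proof (rule ccontr)
  assume "\<not> ?thesis"
  then obtain p q where combination: "\<And>m. m \<in> monomials n \<Longrightarrow> homog (n - a) (p m)" "\<And>m. m \<in> monomials n \<Longrightarrow> homog (n - b) (q m)"
    "\<And>m. m \<in> monomials n \<Longrightarrow> single m 1 = p m * A + q m * B" by metis
  obtain k where n_eq: "n = k + a + b" using n by (metis add.assoc le_Suc_ex add.commute)
  define I :: "((3 \<Rightarrow>\<^sub>0 nat) + (3 \<Rightarrow>\<^sub>0 nat)) set" where "I = monomials n <+> monomials k"
  define u where "u i left = (case i of Inl m \<Rightarrow> if left then p m else q m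
    | Inr m \<Rightarrow> if left then single m 1 * B else - single m 1 * A)" for i left
  define t where "t left = (if left then n - a else n - b)" for left
  have "homog (t left) (u i left)" if "i \<in> I" for i left
    using that combination(1,2) homog_mult[OF homog_single B(1), of _ k] homog_mult[OF homog_single A(1), of _ k]
    by (auto simp: I_def u_def t_def n_eq monomials_def add.commute single_uminus[symmetric] simp del: single_uminus)
  moreover have "(\<Sum>left\<in>UNIV. card (monomials (t left) :: (3 \<Rightarrow>\<^sub>0 nat) set)) < card I"
    using card_monomials_3_less[OF A(2) B(2), of k] by (simp add: I_def card_Plus UNIV_bool t_def n_eq ac_simps)
  ultimately obtain c where relation: "\<exists>i\<in>I. c i \<noteq> 0" "\<And>left. (\<Sum>i\<in>I. Cst (c i) * u i left) = 0"
    using ex_form_relation[of I UNIV t u] by (auto simp: I_def)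
  define r where "r = form_of k (\<lambda>m. c (Inr m))"
  define P where "P = (\<Sum>m\<in>monomials n. Cst (c (Inl m)) * p m)"
  define Q where "Q = (\<Sum>m\<in>monomials n. Cst (c (Inl m)) * q m)"
  have left_relation: "P + r * B = 0"
    using relation(2)[of True]
    by (simp add: I_def sum.Plus u_def P_def r_def form_of_eq_sum sum_distrib_right mult.assoc)
  have right_relation: "Q = r * A"
    using relation(2)[of False]
    by (simp add: I_def sum.Plus u_def Q_def r_def form_of_eq_sum sum_distrib_right mult.assoc sum_negf)
  have "form_of n (\<lambda>m. c (Inl m)) = P * A + Q * B"
    using combination(3) by (simp add: form_of_eq_sum P_def Q_def sum_distrib_right distrib_left sum.distrib mult.assoc)
  also have "\<dots> = (P + r * B) * A" unfolding right_relation by (simp add: algebra_simps)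
  finally have Inl_coeff: "c (Inl m) = 0" if "m \<in> monomials n" for m
    using that form_of_eq_0D unfolding left_relation by simp
  have "P = 0" "Q = 0" using Inl_coeff by (simp_all add: P_def Q_def)
  hence "r = 0" using nonzero left_relation right_relation by auto
  hence "c (Inr m) = 0" if "m \<in> monomials k" for m
    using that form_of_eq_0D unfolding r_def by blast
  thus False using relation(1) Inl_coeff by (auto simp: I_def)
qed

context algebraically_closed
begin

theorem plane_curves_intersect:
  fixes A B :: "'k pol3"
  assumes A: "homog a A" "a \<ge> 1" and B: "homog b B" "b \<ge> 1"
  shows "proj_zeros A \<inter> proj_zeros B \<noteq> {}"
proof (cases "A = 0 \<and> B = 0")
  case True
  hence "(\<lambda>_. 1) \<in> proj_zeros A \<inter> proj_zeros B" by (simp add: proj_zeros_def)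
  thus ?thesis by blast
next
  case False
  show ?thesis
  proof
    assume disjoint: "proj_zeros A \<inter> proj_zeros B = {}"
    have "\<exists>N. \<forall>n\<ge>N. \<exists>c. \<forall>m\<in>monomials n. (\<forall>i\<in>UNIV. homog (n - (if i then a else b)) (c m i)) \<and>
        single m 1 = (\<Sum>i\<in>UNIV. c m i * (if i then A else B))"
    proof (rule nullstellensatz_monomials)
      show "homog (if i then a else b) (if i then A else B)" for i using A B by auto
      show "x = (\<lambda>_. 0)" if "\<forall>i\<in>UNIV. mp_eval (if i then A else B) x = 0" for x
        using that[THEN bspec, of True] that[THEN bspec, of False] disjoint
        by (auto simp: proj_zeros_def)
    qed simp
    then obtain N where N: "\<forall>n\<ge>N. \<exists>c. \<forall>m\<in>monomials n. (\<forall>i\<in>UNIV. homog (n - (if i then a else b)) (c m i)) \<and>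
        single m 1 = (\<Sum>i\<in>UNIV. c m i * (if i then A else B))" ..
    have "a + b \<le> N + a + b" by simp
    from ex_monomial_not_in_ideal_of_two_forms[OF A B _ this] False obtain m where
      m: "m \<in> monomials (N + a + b)"
      "\<And>p q. homog (N + a + b - a) p \<Longrightarrow> homog (N + a + b - b) q \<Longrightarrow> single m 1 \<noteq> p * A + q * B" by blast
    obtain c where "\<And>i. homog (N + a + b - (if i then a else b)) (c i)"
      "single m 1 = (\<Sum>i\<in>UNIV. c i * (if i then A else B))"
      using N[rule_format, of "N + a + b"] m(1) by auto
    from this(1)[of True] this(1)[of False] this(2) show False
      using m(2)[of "c True" "c False"] by (simp add: UNIV_bool add.commute)
  qed
qed

end


section \<open>Factorization of forms\<close>

lemma ex_monom_of_mult_eq_monom: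
  fixes p q :: "'a::idom poly"
  assumes "p * q = monom c e" "c \<noteq> 0"
  shows "\<exists>a i. p = monom a i"
proof -
  have nonzero: "p \<noteq> 0" "q \<noteq> 0" using assms by auto
  have "Polynomial.order 0 p + Polynomial.order 0 q = degree p + degree q"
    using assms nonzero order_mult[of p q 0] degree_mult_eq[of p q]
    by (simp add: degree_monom_eq)
  hence order_eq_degree: "Polynomial.order 0 p = degree p"
    using order_degree[OF nonzero(1), of 0] order_degree[OF nonzero(2), of 0] by linarith
  obtain r where r: "p = monom 1 (degree p) * r"
    using order_1[of 0 p] order_eq_degree by (auto simp: monom_altdef)
  hence "degree p = degree p + degree r"
    using nonzero(1) by (metis degree_monom_eq degree_mult_eq mult_eq_0_iff one_neq_zero)
  then obtain a where "r = [:a:]" using degree_eq_zeroE by auto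
  hence "p = monom a (degree p)" using r by (simp add: smult_monom)
  thus ?thesis by blast
qed

definition graded_poly :: "('v, 'k::comm_ring_1) mpol \<Rightarrow> ('v, 'k) mpol poly" where
  "graded_poly = mp_subst (\<lambda>c. [:Cst c:]) (\<lambda>v. monom (Var v) 1)"

interpretation graded_poly: comm_ring_hom graded_poly
  unfolding graded_poly_def
  by (intro comm_ring_hom.comm_ring_hom_mp_subst comm_ring_hom_comp[OF _ Cst.comm_ring_hom_axioms])
    unfold_locales

lemma coeff_graded_poly: "coeff (graded_poly p) n = hcomp n p"
proof -
  have prod_monom: "(\<Prod>v\<in>A. monom (f v) (e v)) = monom (prod f A) (sum e A)"
    for f :: "'a \<Rightarrow> ('a, 'b) mpol" and e A
    by (induction A rule: infinite_finite_induct) (simp_all add: mult_monom)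
  have "[:Cst c:] * mon_eval (\<lambda>v. monom (Var v) 1) m = monom (single m c) (mon_deg m)"
    for m :: "'a \<Rightarrow>\<^sub>0 nat" and c :: 'b
    unfolding mon_eval_def mon_deg_def single_eq_Cst_mult[of m c]
    by (simp add: monom_power prod_monom smult_monom)
  hence "coeff (graded_poly p) n = (\<Sum>m\<in>keys p. if mon_deg m = n then single m (lookup p m) else 0)"
    by (simp add: graded_poly_def mp_subst_def coeff_sum)
  thus ?thesis by (simp add: hcomp_def sum.If_cases Int_def)
qed

lemma homog_factor_left:
  fixes p q :: "('v::linorder, 'k::idom) mpol"
  assumes product: "homog e (p * q)" "p * q \<noteq> 0"
  shows "\<exists>a. homog a p"
proof -
  have "graded_poly (p * q) = monom (p * q) e"
    by (rule poly_eqI) (simp add: coeff_graded_poly hcomp_homog[OF product(1)])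
  hence "graded_poly p * graded_poly q = monom (p * q) e" by (simp add: graded_poly.hom_mult)
  then obtain a i where graded_p: "graded_poly p = monom a i" using ex_monom_of_mult_eq_monom product(2) by blast
  have "homog i (hcomp n p)" for n
    using coeff_graded_poly[of p n] homog_hcomp[of n p] by (cases "i = n") (auto simp: graded_p)
  moreover obtain N where "(\<Sum>n<N. hcomp n p) = p" using ex_sum_hcomp by blast
  ultimately have "homog i p" using homog_sum[of "{..<N}" i "\<lambda>n. hcomp n p"] by simp
  thus ?thesis ..
qed

lemma homog_factors:
  fixes p q :: "('v::linorder, 'k::idom) mpol"
  assumes "homog e (p * q)" "p * q \<noteq> 0"
  obtains a b where "homog a p" "homog b q" "e = a + b"
proof -
  obtain a b where "homog a p" "homog b q"
    using homog_factor_left[of e p q] homog_factor_left[of e q p] assms by (auto simp: mult.commute)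
  thus thesis using that homog_unique[OF assms(1) homog_mult _] assms(2) by blast
qed

lemma homog_dvd_degree_le:
  fixes p q :: "('v::linorder, 'k::idom) mpol"
  assumes "homog a p" "homog b q" "q \<noteq> 0" "p dvd q"
  shows "a \<le> b"
proof -
  obtain r where r: "q = p * r" using assms(4) by (elim dvdE)
  then obtain a' c where "homog a' p" "b = a' + c" using homog_factors[of b p r] assms by metis
  moreover have "p \<noteq> 0" using r assms(3) by auto
  ultimately show ?thesis using homog_unique[of a p a'] assms(1) by simp
qed

lemma homog_0_dvd_1:
  fixes p :: "('v, 'k::field) mpol"
  assumes "homog 0 p" "p \<noteq> 0"
  shows "p dvd 1"
proof -
  define c where "c = lookup p 0"
  have p: "p = Cst c" unfolding c_def by (rule homog_0_eq_Cst[OF assms(1)])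
  hence "c \<noteq> 0" using assms(2) by auto
  hence "p * Cst (inverse c) = 1" by (simp add: p Cst_mult_inverse)
  thus ?thesis by (metis dvd_triv_left)
qed

lemma prime_elem_dvd_prodD:
  assumes "prime_elem p" "finite A" "p dvd prod f A"
  shows "\<exists>a\<in>A. p dvd f a"
  using assms(2,3)
proof (induction A rule: finite_induct)
  case empty
  thus ?case using assms(1) by (simp add: prime_elem_def)
next
  case (insert a A)
  hence "p dvd f a \<or> p dvd prod f A" using prime_elem_dvd_multD[OF assms(1), of "f a" "prod f A"] by simp
  thus ?case using insert.IH by blast
qed

lemma UNIV_3: "(UNIV :: 3 set) = {0, 1, 2}"
proof -
  have "card {0, 1, 2 :: 3} = CARD(3)" by simp
  thus ?thesis by (intro card_subset_eq[symmetric]) auto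
qed

lemma sum_3: "(\<Sum>i\<in>(UNIV :: 3 set). f i) = f 0 + f 1 + f 2"
  unfolding UNIV_3 by (simp add: add.assoc)

lemma exhaust_3: "(i::3) = 0 \<or> i = 1 \<or> i = 2"
  using UNIV_I[of i] unfolding UNIV_3 by blast

text \<open>The isomorphism of \<open>k[x,y,z]\<close> with \<open>k[y][x][z]\<close>, where \<open>x, y, z\<close> are the variables \<open>0, 1, 2\<close>.\<close>

definition nest :: "'k::comm_ring_1 pol3 \<Rightarrow> 'k poly poly poly" where
  "nest = mp_subst (\<lambda>c. [:[:[:c:]:]:])
     (\<lambda>v. if v = 0 then [:[:0, 1:]:] else if v = 1 then [:[:[:0, 1:]:]:] else [:0, 1:])"

definition unnest :: "'k::comm_ring_1 poly poly poly \<Rightarrow> 'k pol3" where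
  "unnest q = poly (map_poly (\<lambda>r. poly (map_poly (\<lambda>s. poly (map_poly Cst s) (Var 1)) r) (Var 0)) q) (Var 2)"

lemma comm_ring_hom_nest_const: "comm_ring_hom (\<lambda>c::'k::comm_ring_1. [:[:[:c:]:]:])"
  by unfold_locales simp_all

interpretation nest: comm_ring_hom nest
  unfolding nest_def by (rule comm_ring_hom.comm_ring_hom_mp_subst[OF comm_ring_hom_nest_const])

lemma nest_Cst: "nest (Cst c) = [:[:[:c:]:]:]"
  and nest_Var: "nest (Var 0) = [:[:0, 1:]:]" "nest (Var 1) = [:[:[:0, 1:]:]:]" "nest (Var 2) = [:0, 1:]"
  by (simp_all add: nest_def comm_ring_hom.mp_subst_Cst[OF comm_ring_hom_nest_const]
      comm_ring_hom.mp_subst_Var[OF comm_ring_hom_nest_const])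

lemma comm_ring_hom_poly_map_poly:
  assumes "comm_ring_hom h"
  shows "comm_ring_hom (\<lambda>p. poly (map_poly h p) a)"
proof -
  interpret comm_ring_hom h by fact
  interpret m: map_poly_comm_ring_hom h ..
  show ?thesis by unfold_locales (simp_all add: m.hom_add m.hom_mult)
qed

lemma comm_ring_hom_unnest: "comm_ring_hom unnest"
  unfolding unnest_def by (intro comm_ring_hom_poly_map_poly Cst.comm_ring_hom_axioms)

lemma unnest_const: "unnest [:[:[:c:]:]:] = Cst c"
  and unnest_generator: "unnest [:pCons 0 1:] = Var 0" "unnest [:[:pCons 0 1:]:] = Var 1"
    "unnest (pCons 0 1) = Var 2"
  by (simp_all add: unnest_def Polynomial.map_poly_pCons)

lemma poly_hom_eqI:
  assumes "comm_ring_hom F" "comm_ring_hom G" "\<And>c. F [:c:] = G [:c:]" "F (pCons 0 1) = G (pCons 0 1)"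
  shows "F p = G p"
proof -
  interpret F: comm_ring_hom F by fact
  interpret G: comm_ring_hom G by fact
  show ?thesis
  proof (induction p)
    case (pCons a p)
    have "pCons a p = [:a:] + pCons 0 1 * p" by simp
    thus ?case by (simp only: F.hom_add G.hom_add F.hom_mult G.hom_mult assms pCons)
  qed simp
qed

lemma unnest_nest: "unnest (nest p) = p"
proof (rule mpol_hom_eqI[OF comm_ring_hom_comp[OF comm_ring_hom_unnest nest.comm_ring_hom_axioms]
      comm_ring_hom_ident])
  show "unnest (nest (Cst c)) = Cst c" for c :: 'a
    by (simp add: nest_Cst unnest_const)
  show "unnest (nest (Var v)) = (Var v :: 'a pol3)" for v
    using exhaust_3[of v] by (auto simp: nest_Var unnest_generator)
qed

lemma nest_unnest: "nest (unnest q) = q"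
proof -
  note hom = comm_ring_hom_comp[OF nest.comm_ring_hom_axioms comm_ring_hom_unnest]
  note const = coeff_lift_hom.comm_ring_hom_axioms
  note const_const = comm_ring_hom_comp[OF const const]
  have inner: "nest (unnest [:[:s:]:]) = [:[:s:]:]" for s :: "'a poly"
    by (rule poly_hom_eqI[OF comm_ring_hom_comp[OF hom const_const] const_const])
      (simp_all add: unnest_const unnest_generator nest_Cst nest_Var)
  have "nest (unnest [:r:]) = [:r:]" for r :: "'a poly poly"
    by (rule poly_hom_eqI[OF comm_ring_hom_comp[OF hom const] const])
      (simp_all add: inner unnest_generator nest_Var)
  thus ?thesis
    by (rule poly_hom_eqI[OF hom comm_ring_hom_ident]) (simp add: unnest_generator nest_Var)
qed

lemma comm_ring_isom_nest: "comm_ring_isom (nest :: 'k::comm_ring_1 pol3 \<Rightarrow> _)"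
proof -
  have "surj (nest :: 'k pol3 \<Rightarrow> _)" by (rule surjI[of _ unnest]) (rule nest_unnest)
  moreover have "p = 0" if "nest p = 0" for p :: "'k pol3"
    using unnest_nest[of p] by (simp add: that unnest_def)
  ultimately show ?thesis by unfold_locales auto
qed

lemma irreducible_imp_prime_elem_pol3:
  fixes p :: "'k::field pol3"
  assumes "irreducible p"
  shows "prime_elem p"
proof -
  interpret nest: comm_ring_isom "nest :: 'k pol3 \<Rightarrow> _" by (rule comm_ring_isom_nest)
  have prime: "prime_elem (nest p)" using assms by (simp add: nest.irreducible_hom)
  show ?thesis
  proof (rule prime_elemI)
    show "p dvd a \<or> p dvd b" if "p dvd a * b" for a b
      using prime_elem_dvd_multD[OF prime, of "nest a" "nest b"] that
      by (simp only: nest.hom_dvd_hom flip: nest.hom_mult)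
  qed (use assms in \<open>auto dest: irreducible_not_unit\<close>)
qed


section \<open>Forms vanishing on a plane curve\<close>

lemma homog_split_var:
  assumes "homog n p"
  obtains q where "homog (n - 1) q" "p = var_coeff v 0 p + Var v * q"
proof
  define q where "q = (\<Sum>i<n. var_coeff v (Suc i) p * Var v ^ i)"
  have "homog (n - 1) (var_coeff v (Suc i) p * Var v ^ i)" if "i < n" for i
  proof -
    have "n - 1 = n - Suc i + i" using that by simp
    thus ?thesis by (simp only:) (intro homog_mult homog_var_coeff homog_Var_power assms)
  qed
  thus "homog (n - 1) q" unfolding q_def by (intro homog_sum) simp
  have "p = (\<Sum>i<Suc n. var_coeff v i p * Var v ^ i)" by (rule homog_sum_var_coeff[OF assms, symmetric])
  also have "\<dots> = var_coeff v 0 p + Var v * q"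
    by (simp add: sum.lessThan_Suc_shift q_def sum_distrib_left ac_simps del: sum.lessThan_Suc)
  finally show "p = var_coeff v 0 p + Var v * q" .
qed

definition smooth_form :: "('v, 'k::comm_ring_1) mpol \<Rightarrow> bool" where
  "smooth_form J \<longleftrightarrow> (\<forall>x\<in>proj_zeros J. \<exists>j. mp_eval (mp_pderiv j J) x \<noteq> 0)"

lemma ex_mp_eval_nonzero:
  fixes p :: "('v::finite, 'k::field) mpol"
  assumes infinite_k: "infinite (UNIV :: 'k set)" and "p \<noteq> 0"
  shows "\<exists>x. mp_eval p x \<noteq> 0"
proof -
  have "\<exists>x. mp_eval p x \<noteq> 0" if "finite V" "p \<in> polys_in V" "p \<noteq> 0" for V and p :: "('v, 'k) mpol"
    using that
  proof (induction V arbitrary: p rule: finite_induct)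
    case empty
    hence "homog 0 p" by (auto simp: polys_in_def homog_def)
    hence "p = Cst (lookup p 0)" by (rule homog_0_eq_Cst)
    thus ?case using empty.prems(2) by (metis Cst.hom_zero mp_eval_Cst)
  next
    case (insert v V)
    obtain n where n: "(\<Sum>i<n. var_coeff v i p * Var v ^ i) = p" by (rule var_coeff_expansion)
    have "\<exists>i. var_coeff v i p \<noteq> 0"
    proof (rule ccontr)
      assume "\<nexists>i. var_coeff v i p \<noteq> 0"
      thus False using n insert.prems(2) by simp
    qed
    then obtain i a where "mp_eval (var_coeff v i p) a \<noteq> 0"
      using insert.IH polys_in_var_coeff[OF insert.prems(1)] by blast
    hence "fiber_poly a v p \<noteq> 0"
      using coeff_fiber_poly[OF insert.prems(1) insert.hyps(2), of a i] by auto
    hence "finite {c. poly (fiber_poly a v p) c = 0}" by (rule poly_roots_finite)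
    then obtain c where "poly (fiber_poly a v p) c \<noteq> 0" using infinite_k by (metis (mono_tags) UNIV_eq_I mem_Collect_eq)
    thus ?case unfolding poly_fiber_poly by blast
  qed
  from this[of UNIV p] show ?thesis using assms(2) by simp
qed

context algebraically_closed
begin

lemma infinite_field: "infinite (UNIV :: 'k set)"
proof
  assume finite_k: "finite (UNIV :: 'k set)"
  define p where "p = (\<Prod>a\<in>UNIV. [:- a, 1 :: 'k:])"
  have "degree p = CARD('k)" by (simp add: p_def degree_prod_eq_sum_degree)
  hence "degree (p + 1) \<ge> 1" using finite_k by (simp add: degree_add_eq_left finite_UNIV_card_ge_0 Suc_leI)
  then obtain x where "poly (p + 1) x = 0" using ex_root by blast
  moreover have "poly p x = 0" using finite_k by (auto simp: p_def poly_prod intro!: prod_zero)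
  ultimately show False by simp
qed

lemma smooth_form_irreducible:
  fixes J :: "'k pol3"
  assumes J: "homog e J" "e \<ge> 1" "smooth_form J"
  shows "irreducible J"
proof (rule irreducibleI)
  show J_nonzero: "J \<noteq> 0"
  proof
    assume "J = 0"
    thus False using J(3) by (auto simp: smooth_form_def proj_zeros_def dest: spec[of _ "\<lambda>_. 1"])
  qed
  show "\<not> J dvd 1"
  proof
    assume "J dvd 1"
    then obtain q where "1 = J * q" by (elim dvdE)
    from arg_cong[OF this, of "\<lambda>p. mp_eval p (\<lambda>_. 0)"] show False
      using mp_eval_origin[OF J(1,2)] by (simp add: hom_distribs)
  qed
  show "p dvd 1 \<or> q dvd 1" if J_eq: "J = p * q" for p q
  proof -
    obtain a b where factors: "homog a p" "homog b q" using homog_factors[of e p q] J(1) J_nonzero J_eq by metis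
    have "a = 0 \<or> b = 0"
    proof (rule ccontr)
      assume "\<not> (a = 0 \<or> b = 0)"
      then obtain x where x: "x \<in> proj_zeros p" "x \<in> proj_zeros q"
        using plane_curves_intersect[OF factors(1) _ factors(2)] by fastforce
      hence "x \<in> proj_zeros J" "mp_eval (mp_pderiv j J) x = 0" for j
        by (simp_all add: J_eq proj_zeros_def mp_pderiv_mult hom_distribs)
      thus False using J(3) unfolding smooth_form_def by blast
    qed
    thus ?thesis using factors homog_0_dvd_1 J_nonzero J_eq by auto
  qed
qed

lemma ex_base_point_free_pencil:
  fixes J :: "'k pol3"
  assumes J: "homog e J" "e \<ge> 1" "J \<noteq> 0" and b: "b \<ge> 1"
  shows "\<exists>l l'. homog b l \<and> homog b l' \<and>
    (\<forall>x\<in>proj_zeros J. mp_eval l x \<noteq> 0 \<or> mp_eval l' x \<noteq> 0)"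
proof -
  obtain y where y: "mp_eval J y \<noteq> 0" using ex_mp_eval_nonzero[OF infinite_field J(3)] by blast
  hence "y \<noteq> (\<lambda>_. 0)" using mp_eval_origin[OF J(1,2)] by blast
  then obtain i where i: "y i \<noteq> 0" by auto
  define l where "l j = Cst (y i) * Var j - Cst (y j) * Var i" for j
  have homog: "homog b (l j ^ b)" for j
    using homog_power[of 1 "l j" b] unfolding l_def by (simp add: homog_diff homog_Cst_mult homog_Var[simplified])
  have "mp_eval (l (i + 1) ^ b) x \<noteq> 0 \<or> mp_eval (l (i + 2) ^ b) x \<noteq> 0" if x: "x \<in> proj_zeros J" for x
  proof (rule ccontr)
    assume "\<not> (mp_eval (l (i + 1) ^ b) x \<noteq> 0 \<or> mp_eval (l (i + 2) ^ b) x \<noteq> 0)"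
    hence "y i * x j = y j * x i" if "j = i \<or> j = i + 1 \<or> j = i + 2" for j
      using that b by (auto simp: l_def hom_distribs mult.commute)
    moreover have "j = i \<or> j = i + 1 \<or> j = i + 2" for j
      using exhaust_3[of i] exhaust_3[of j] by auto
    ultimately have "x = (\<lambda>j. (x i / y i) * y j)" using i by (auto simp: field_simps)
    hence "mp_eval J x = (x i / y i) ^ e * mp_eval J y" using mp_eval_scale[OF J(1)] by metis
    moreover have "x i \<noteq> 0" using x \<open>x = _\<close> by (auto simp: proj_zeros_def)
    ultimately show False using x y i by (simp add: proj_zeros_def)
  qed
  thus ?thesis using homog by blast
qed

lemma ex_pencil_member_zero:
  fixes J l l' :: "'k pol3"
  assumes J: "homog e J" "e \<ge> 1" and l: "homog b l" "homog b l'" "b \<ge> 1"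
    and base_point_free: "\<And>x. x \<in> proj_zeros J \<Longrightarrow> mp_eval l x \<noteq> 0 \<or> mp_eval l' x \<noteq> 0"
  shows "\<exists>x\<in>proj_zeros J. \<exists>\<mu>. c = \<mu> * mp_eval l x \<and> c' = \<mu> * mp_eval l' x"
proof -
  have "homog b (Cst c' * l - Cst c * l')" by (intro homog_diff homog_Cst_mult l)
  from plane_curves_intersect[OF J this l(3)] obtain x where
    "x \<in> proj_zeros J \<inter> proj_zeros (Cst c' * l - Cst c * l')" by blast
  hence x: "x \<in> proj_zeros J" "c' * mp_eval l x = c * mp_eval l' x"
    by (simp_all add: proj_zeros_def hom_distribs)
  have "\<exists>\<mu>. c = \<mu> * mp_eval l x \<and> c' = \<mu> * mp_eval l' x"
  proof (cases "mp_eval l x = 0")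
    case True
    hence "mp_eval l' x \<noteq> 0" "c = 0" using base_point_free[OF x(1)] x(2) by auto
    thus ?thesis using True by (intro exI[of _ "c' / mp_eval l' x"]) simp
  next
    case False
    thus ?thesis using x(2) by (intro exI[of _ "c / mp_eval l x"]) (simp add: field_simps)
  qed
  with x(1) show ?thesis by blast
qed

lemma ex_relation_with_binary_part:
  fixes J :: "'k pol3" and s :: "3 \<Rightarrow> 'k pol3"
  assumes J: "homog e J" "prime_elem J" and s: "\<And>i. homog D (s i)" "D \<ge> 1" and not_dvd: "\<not> J dvd s 0"
  shows "\<exists>n F. homog n F \<and> J dvd pullback s F \<and> var_coeff 0 0 F \<noteq> 0"
proof -
  have J_nonzero: "J \<noteq> 0" using J(2) by auto
  obtain n F where F: "homog n F" "F \<noteq> 0" "J dvd pullback s F"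
    and minimal: "\<And>m G. m < n \<Longrightarrow> homog m G \<Longrightarrow> J dvd pullback s G \<Longrightarrow> G = 0"
    by (rule minimal_algebraic_relation_mod[where s = s, OF J(1) J_nonzero s]) blast
  obtain G where G: "homog (n - 1) G" "F = var_coeff 0 0 F + Var 0 * G"
    by (rule homog_split_var[OF F(1), of 0])
  have "var_coeff 0 0 F \<noteq> 0"
  proof
    assume zero: "var_coeff 0 0 F = 0"
    hence F_eq: "F = Var 0 * G" using G(2) by simp
    hence "n \<ge> 1" using homog_dvd_degree_le[OF homog_Var F(1,2), of 0] by simp
    have "J dvd s 0 * pullback s G" using F(3) by (simp add: F_eq hom_distribs)
    hence "J dvd pullback s G" using J(2) not_dvd by (simp add: prime_elem_dvd_mult_iff)
    hence "G = 0" using minimal[of "n - 1"] G(1) \<open>n \<ge> 1\<close> by simp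
    thus False using F(2) F_eq by simp
  qed
  thus ?thesis using F by blast
qed

text \<open>If \<open>J\<close> does not divide \<open>h\<close>, there is a nontrivial relation modulo \<open>J\<close> between \<open>h\<close> and a pencil \<open>l, l'\<close>
  without base points on the curve, which restricts to a binary form in \<open>l, l'\<close> that vanishes on the curve; but
  every member of the pencil has a zero on the curve.\<close>

lemma prime_form_dvd_of_vanishing:
  fixes J h :: "'k pol3"
  assumes J: "homog e J" "e \<ge> 1" "prime_elem J" and h: "homog b h" "b \<ge> 1"
    and vanishing: "\<And>x. x \<in> proj_zeros J \<Longrightarrow> mp_eval h x = 0"
  shows "J dvd h"
proof (rule ccontr)
  assume not_dvd: "\<not> J dvd h"
  have "J \<noteq> 0" using J(3) by auto
  from ex_base_point_free_pencil[OF J(1,2) this h(2)] obtain l l' where l: "homog b l" "homog b l'"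
    and base_point_free: "\<And>x. x \<in> proj_zeros J \<Longrightarrow> mp_eval l x \<noteq> 0 \<or> mp_eval l' x \<noteq> 0" by blast
  define s :: "3 \<Rightarrow> 'k pol3" where "s i = (if i = 0 then h else if i = 1 then l else l')" for i
  have "homog b (s i)" for i using h l by (simp add: s_def)
  moreover have "\<not> J dvd s 0" using not_dvd by (simp add: s_def)
  ultimately obtain n F where F: "homog n F" "J dvd pullback s F" "var_coeff 0 0 F \<noteq> 0"
    using ex_relation_with_binary_part[OF J(1,3) _ h(2), of s] by blast
  define B where "B = var_coeff 0 0 F"
  have B: "B \<in> polys_in {1, 2}" "homog n B"
    using polys_in_var_coeff[of F 0 "{1, 2}"] homog_var_coeff[OF F(1), of 0 0]
    by (simp_all add: B_def flip: UNIV_3)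
  obtain z where z: "mp_eval B z \<noteq> 0" using ex_mp_eval_nonzero[OF infinite_field] F(3) by (auto simp: B_def)
  obtain x \<mu> where x: "x \<in> proj_zeros J" and "z 1 = \<mu> * mp_eval l x" "z 2 = \<mu> * mp_eval l' x"
    using ex_pencil_member_zero[OF J(1,2) l h(2) base_point_free] by blast
  moreover define y where "y i = mp_eval (s i) x" for i
  ultimately have "z v = \<mu> * y v" if "v \<in> {1, 2}" for v
    using that by (auto simp: s_def)
  hence "mp_eval B z = \<mu> ^ n * mp_eval B y"
    using mp_eval_cong_polys_in[OF B(1), of z "\<lambda>v. \<mu> * y v"] mp_eval_scale[OF B(2)] by metis
  moreover obtain G where "F = B + Var 0 * G" using homog_split_var[OF F(1), of 0] unfolding B_def by blast
  hence "mp_eval B y = mp_eval F y" using vanishing[OF x] by (simp add: hom_distribs y_def s_def)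
  moreover have "mp_eval F y = mp_eval (pullback s F) x" by (simp add: mp_eval_pullback flip: y_def)
  moreover have "mp_eval (pullback s F) x = 0" by (rule mp_eval_eq_0_of_dvd[OF F(2) x])
  ultimately show False using z by simp
qed

lemma prime_form_dvd_of_finitely_many_ratios:
  fixes J u w :: "'k pol3"
  assumes J: "homog e J" "e \<ge> 1" "prime_elem J" and u: "homog D u" and w: "homog D w" "\<not> J dvd w" and D: "D \<ge> 1"
    and finite_R: "finite R" and ratio: "\<And>x. x \<in> proj_zeros J \<Longrightarrow> mp_eval w x \<noteq> 0 \<Longrightarrow> \<exists>r\<in>R. mp_eval u x = r * mp_eval w x"
  shows "\<exists>r\<in>R. J dvd u - Cst r * w"
proof -
  have "J dvd w * (\<Prod>r\<in>R. u - Cst r * w)"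
  proof (rule prime_form_dvd_of_vanishing[OF J])
    show "homog (D + (\<Sum>r\<in>R. D)) (w * (\<Prod>r\<in>R. u - Cst r * w))"
      by (intro homog_mult homog_prod homog_diff homog_Cst_mult u w)
    show "D + (\<Sum>r\<in>R. D) \<ge> 1" using D by simp
    show "mp_eval (w * (\<Prod>r\<in>R. u - Cst r * w)) x = 0" if "x \<in> proj_zeros J" for x
      using ratio[OF that] finite_R by (cases "mp_eval w x = 0") (auto simp: hom_distribs intro!: prod_zero)
  qed
  hence "J dvd (\<Prod>r\<in>R. u - Cst r * w)" using J(3) w(2) by (simp add: prime_elem_dvd_mult_iff)
  thus ?thesis by (rule prime_elem_dvd_prodD[OF J(3) finite_R])
qed

end


section \<open>Ratios of forms along a curve\<close>

definition monomial_list :: "nat \<Rightarrow> ('v::finite \<Rightarrow>\<^sub>0 nat) list" where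
  "monomial_list n = (SOME ms. set ms = monomials n \<and> distinct ms)"

lemma set_monomial_list [simp]: "set (monomial_list n) = monomials n"
  and distinct_monomial_list: "distinct (monomial_list n)"
  using someI_ex[OF finite_distinct_list[OF finite_monomials[of n]]]
  unfolding monomial_list_def by auto

lemma mp_eval_eq_sum_list:
  assumes "homog n p"
  shows "mp_eval p x = (\<Sum>m\<leftarrow>monomial_list n. lookup p m * mon_eval x m)"
proof -
  have "keys p \<subseteq> monomials n" using assms by (auto simp: homog_def monomials_def)
  hence "mp_eval p x = (\<Sum>m\<in>monomials n. lookup p m * mon_eval x m)"
    unfolding mp_eval_eq_mp_subst
    by (intro comm_ring_hom.mp_subst_superset[OF comm_ring_hom_ident]) simp_all
  thus ?thesis by (simp add: sum_list_distinct_conv_sum_set distinct_monomial_list)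
qed

definition form_matrix ::
    "nat \<Rightarrow> (('v::finite \<Rightarrow>\<^sub>0 nat) \<Rightarrow> ('v, 'k::comm_ring_1) mpol) \<Rightarrow> 'k mat" where
  "form_matrix n Q = (let ms = monomial_list n; l = length ms in
     mat l l (\<lambda>(a, b). lookup (Q (ms ! a)) (ms ! b)))"

definition monomial_vec :: "nat \<Rightarrow> ('v::finite \<Rightarrow> 'k::comm_ring_1) \<Rightarrow> 'k vec" where
  "monomial_vec n x = (let ms = monomial_list n in vec (length ms) (\<lambda>a. mon_eval x (ms ! a)))"

lemma form_matrix_carrier:
  "form_matrix n Q \<in> carrier_mat (dim_row (form_matrix n Q)) (dim_row (form_matrix n Q))"
  by (simp add: form_matrix_def Let_def)

lemma monomial_vec_carrier: "monomial_vec n x \<in> carrier_vec (dim_row (form_matrix n Q))"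
  for x :: "'v::finite \<Rightarrow> 'k::comm_ring_1" and Q :: "('v \<Rightarrow>\<^sub>0 nat) \<Rightarrow> ('v, 'k) mpol"
  by (simp add: form_matrix_def monomial_vec_def Let_def)

lemma monomial_vec_nonzero:
  fixes x :: "'v::finite \<Rightarrow> 'k::field"
  assumes "x i \<noteq> 0"
  shows "monomial_vec n x \<noteq> 0\<^sub>v l"
proof
  assume zero: "monomial_vec n x = 0\<^sub>v l"
  have "single i n \<in> set (monomial_list n)" by (simp add: monomials_def)
  then obtain b where b: "b < length (monomial_list n :: ('v \<Rightarrow>\<^sub>0 nat) list)" "monomial_list n ! b = single i n"
    by (metis in_set_conv_nth)
  moreover have "b < l" using arg_cong[OF zero, of dim_vec] b(1) by (simp add: monomial_vec_def Let_def)
  ultimately have "x i ^ n = 0" using arg_cong[OF zero, of "\<lambda>v. v $ b"] by (simp add: monomial_vec_def Let_def)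
  thus False using assms by simp
qed

lemma form_matrix_mult_monomial_vec:
  assumes homog: "\<And>m. m \<in> monomials n \<Longrightarrow> homog n (Q m)"
    and ratio: "\<And>m. m \<in> monomials n \<Longrightarrow> mp_eval (Q m) x = r * mon_eval x m"
  shows "form_matrix n Q *\<^sub>v monomial_vec n x = r \<cdot>\<^sub>v monomial_vec n x"
proof -
  define ms where "ms = (monomial_list n :: ('a \<Rightarrow>\<^sub>0 nat) list)"
  have "(form_matrix n Q *\<^sub>v monomial_vec n x) $ a = r * mon_eval x (ms ! a)" if a: "a < length ms" for a
  proof -
    have m: "ms ! a \<in> monomials n" using nth_mem[OF a] by (simp add: ms_def)
    have "(form_matrix n Q *\<^sub>v monomial_vec n x) $ a = (\<Sum>m\<leftarrow>ms. lookup (Q (ms ! a)) m * mon_eval x m)"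
      using a by (simp add: form_matrix_def monomial_vec_def Let_def ms_def scalar_prod_def sum_list_sum_nth)
    also have "\<dots> = mp_eval (Q (ms ! a)) x"
      unfolding ms_def by (rule mp_eval_eq_sum_list[symmetric]) (use homog[OF m] in \<open>simp add: ms_def\<close>)
    finally show ?thesis using ratio[OF m] by simp
  qed
  thus ?thesis
    by (intro eq_vecI) (simp_all add: form_matrix_def monomial_vec_def Let_def ms_def)
qed

lemma eigenvalue_form_matrix:
  fixes x :: "'v::finite \<Rightarrow> 'k::field"
  assumes "\<And>m. m \<in> monomials n \<Longrightarrow> homog n (Q m)"
    and "\<And>m. m \<in> monomials n \<Longrightarrow> mp_eval (Q m) x = r * mon_eval x m"
    and "x i \<noteq> 0"
  shows "eigenvalue (form_matrix n Q) r"
  unfolding eigenvalue_def eigenvector_def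
  using form_matrix_mult_monomial_vec[OF assms(1,2)] monomial_vec_nonzero[of x, OF assms(3)] monomial_vec_carrier
  by blast

context algebraically_closed
begin

lemma monomials_eq_sum_mod:
  fixes J :: "('v::finite, 'k) mpol" and w :: "'i::finite \<Rightarrow> ('v, 'k) mpol"
  assumes J: "homog e J" and w: "\<And>k. homog D (w k)"
    and nonzero: "\<And>x. x \<in> proj_zeros J \<Longrightarrow> \<exists>k. mp_eval (w k) x \<noteq> 0"
  shows "\<exists>n\<ge>D. \<exists>c. \<forall>m\<in>monomials n.
    (\<forall>k. homog (n - D) (c m k)) \<and> J dvd single m 1 - (\<Sum>k\<in>UNIV. c m k * w k)"
proof -
  define h where "h = case_option J w"
  define d where "d i = (if i = None then e else D)" for i :: "'i option"
  have "\<exists>N. \<forall>n\<ge>N. \<exists>c. \<forall>m\<in>monomials n.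
    (\<forall>i\<in>UNIV. homog (n - d i) (c m i)) \<and> single m 1 = (\<Sum>i\<in>UNIV. c m i * h i)"
  proof (rule nullstellensatz_monomials)
    show "homog (d i) (h i)" for i using J w by (cases i) (auto simp: h_def d_def)
    show "x = (\<lambda>_. 0)" if zero: "\<forall>i\<in>UNIV. mp_eval (h i) x = 0" for x
    proof (rule ccontr)
      assume "x \<noteq> (\<lambda>_. 0)"
      hence "x \<in> proj_zeros J" using zero[THEN bspec, of None] by (auto simp: proj_zeros_def h_def)
      then obtain k where "mp_eval (w k) x \<noteq> 0" using nonzero by blast
      thus False using zero[THEN bspec, of "Some k"] by (simp add: h_def)
    qed
  qed simp
  then obtain N where "\<forall>n\<ge>N. \<exists>c. \<forall>m\<in>monomials n.
    (\<forall>i\<in>UNIV. homog (n - d i) (c m i)) \<and> single m 1 = (\<Sum>i\<in>UNIV. c m i * h i)" ..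
  from this[rule_format, of "max N D"]
  obtain c where combination: "\<And>m i. m \<in> monomials (max N D) \<Longrightarrow> homog (max N D - d i) (c m i)"
    "\<And>m. m \<in> monomials (max N D) \<Longrightarrow> single m 1 = (\<Sum>i\<in>UNIV. c m i * h i)" by auto
  have "homog (max N D - D) (c m (Some k)) \<and> J dvd single m 1 - (\<Sum>k\<in>UNIV. c m (Some k) * w k)"
    if "m \<in> monomials (max N D)" for m k
    using combination(1)[OF that, of "Some k"] combination(2)[OF that] by (simp add: UNIV_option_conv sum.reindex h_def d_def)
  thus ?thesis by (intro exI[of _ "max N D"] conjI exI[of _ "\<lambda>m k. c m (Some k)"]) auto
qed

text \<open>If \<open>u = \<sigma> w\<close> on the curve, then multiplication by \<open>\<sigma>\<close> maps forms of large degree to forms of the same degree,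
  since these are combinations of the \<open>w\<^sub>k\<close> modulo \<open>J\<close>; and \<open>\<sigma> x\<close> is an eigenvalue of this map, with
  the monomials in \<open>x\<close> as eigenvector.\<close>

lemma finitely_many_ratios_on_curve:
  fixes J :: "('v::finite, 'k) mpol" and u w :: "'i::finite \<Rightarrow> ('v, 'k) mpol"
  assumes J: "homog e J" and u: "\<And>k. homog D (u k)" and w: "\<And>k. homog D (w k)"
    and nonzero: "\<And>x. x \<in> proj_zeros J \<Longrightarrow> \<exists>k. mp_eval (w k) x \<noteq> 0"
    and parallel: "\<And>x k l. x \<in> proj_zeros J \<Longrightarrow>
      mp_eval (u k) x * mp_eval (w l) x = mp_eval (u l) x * mp_eval (w k) x"
  shows "\<exists>R. finite R \<and> (\<forall>x\<in>proj_zeros J. \<exists>r\<in>R. \<forall>k. mp_eval (u k) x = r * mp_eval (w k) x)"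
proof -
  obtain n c where n: "n \<ge> D" and combination: "\<And>m k. m \<in> monomials n \<Longrightarrow> homog (n - D) (c m k)"
    "\<And>m. m \<in> monomials n \<Longrightarrow> J dvd single m 1 - (\<Sum>k\<in>UNIV. c m k * w k)"
    using monomials_eq_sum_mod[OF J w nonzero] by blast
  define Q where "Q m = (\<Sum>k\<in>UNIV. c m k * u k)" for m
  have Q: "homog n (Q m)" if "m \<in> monomials n" for m
  proof -
    have "homog (n - D + D) (Q m)" unfolding Q_def by (intro homog_sum homog_mult combination that u)
    thus ?thesis using n by simp
  qed
  have "\<exists>r\<in>spectrum (form_matrix n Q). \<forall>k. mp_eval (u k) x = r * mp_eval (w k) x" if x: "x \<in> proj_zeros J" for x
  proof -
    obtain l where l: "mp_eval (w l) x \<noteq> 0" using nonzero[OF x] by blast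
    define r where "r = mp_eval (u l) x / mp_eval (w l) x"
    have r: "mp_eval (u k) x = r * mp_eval (w k) x" for k
      using parallel[OF x, of k l] l by (simp add: r_def field_simps)
    have "mp_eval (Q m) x = r * mon_eval x m" if m: "m \<in> monomials n" for m
    proof -
      have "mp_eval (single m 1 - (\<Sum>k\<in>UNIV. c m k * w k)) x = 0"
        by (rule mp_eval_eq_0_of_dvd[OF combination(2)[OF m] x])
      hence "mon_eval x m = (\<Sum>k\<in>UNIV. mp_eval (c m k) x * mp_eval (w k) x)"
        by (simp add: hom_distribs mp_eval_single)
      thus ?thesis by (simp add: Q_def hom_distribs r sum_distrib_left ac_simps)
    qed
    moreover obtain i where "x i \<noteq> 0" using x by (auto simp: proj_zeros_def)
    ultimately have "eigenvalue (form_matrix n Q) r" using Q by (intro eigenvalue_form_matrix)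
    thus ?thesis using r by (auto simp: spectrum_def)
  qed
  thus ?thesis using card_finite_spectrum(1)[OF form_matrix_carrier] by blast
qed

end


section \<open>Derivations along a smooth plane curve\<close>

definition bracket :: "'k::comm_ring_1 pol3 \<Rightarrow> 'k pol3 \<Rightarrow> 'k pol3 \<Rightarrow> 'k pol3" where
  "bracket J u v = jac (\<lambda>i. if i = 0 then J else if i = 1 then u else v)"

lemma bracket_mult: "bracket J (u * u') v = bracket J u v * u' + u * bracket J u' v"
  and bracket_same [simp]: "bracket J u u = 0" "bracket J J v = 0"
  and bracket_swap: "bracket J v u = - bracket J u v"
  by (simp_all add: bracket_def jac_def det3_def mp_pderiv_add mp_pderiv_diff mp_pderiv_mult algebra_simps)

lemma bracket_eq_sum: "bracket J u v = (\<Sum>j\<in>UNIV. mp_pderiv j u * bracket J (Var j) v)"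
  by (simp add: bracket_def jac_def det3_def mp_pderiv_Var sum_3 algebra_simps)

lemma bracket_pullback:
  fixes s :: "'w::finite \<Rightarrow> 'k::comm_ring_1 pol3"
  shows "bracket J (pullback s F) v = (\<Sum>i\<in>UNIV. pullback s (mp_pderiv i F) * bracket J (s i) v)"
proof -
  have "bracket J (pullback s F) v
      = (\<Sum>j\<in>UNIV. \<Sum>i\<in>UNIV. pullback s (mp_pderiv i F) * (mp_pderiv j (s i) * bracket J (Var j) v))"
    by (simp add: bracket_eq_sum[of J "pullback s F"] mp_pderiv_pullback sum_distrib_right mult.assoc)
  also have "\<dots> = (\<Sum>i\<in>UNIV. pullback s (mp_pderiv i F) * bracket J (s i) v)"
    by (subst sum.swap) (simp add: bracket_eq_sum[of J "s _"] flip: sum_distrib_left)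
  finally show ?thesis .
qed

lemma bracket_power: "bracket J (u ^ n) v = of_nat n * u ^ (n - 1) * bracket J u v"
  by (simp add: bracket_eq_sum[of J "u ^ n"] bracket_eq_sum[of J u] mp_pderiv_power sum_distrib_left mult.assoc)

lemma polys_in_of_mp_pderiv_eq_0:
  fixes p :: "('v, 'k::field_char_0) mpol"
  assumes "mp_pderiv v p = 0"
  shows "p \<in> polys_in (UNIV - {v})"
proof -
  have "lookup m v = 0" if "m \<in> keys p" for m
  proof (rule ccontr)
    assume "lookup m v \<noteq> 0"
    hence m: "m - single v 1 + single v 1 = m" by (intro diff_single_add) simp
    have "of_nat (lookup (m - single v 1) v + 1) * lookup p m = lookup (mp_pderiv v p) (m - single v 1)"
      unfolding lookup_mp_pderiv m ..
    also have "\<dots> = 0" by (simp add: assms)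
    finally show False using that by (simp add: in_keys_iff del: of_nat_Suc of_nat_add)
  qed
  thus ?thesis by (auto simp: polys_in_def in_keys_iff)
qed

locale algebraically_closed_char_0 = algebraically_closed field_type
  for field_type :: "'k::field_char_0 itself"

locale smooth_plane_curve = algebraically_closed_char_0 field_type
  for field_type :: "'k::field_char_0 itself" +
  fixes J :: "'k pol3" and e :: nat
  assumes homog_J: "homog e J" and e_ge_2: "e \<ge> 2" and smooth_J: "smooth_form J"
begin

lemma e_ge_1: "e \<ge> 1"
  using e_ge_2 by simp

lemma prime_J: "prime_elem J"
  by (intro irreducible_imp_prime_elem_pol3 smooth_form_irreducible[OF homog_J e_ge_1 smooth_J])

lemma dvd_mult_iff: "J dvd a * b \<longleftrightarrow> J dvd a \<or> J dvd b"
  by (rule prime_elem_dvd_mult_iff[OF prime_J])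

lemma not_dvd_Var_power: "\<not> J dvd Var i ^ n"
proof
  assume "J dvd Var i ^ n"
  hence "J dvd Var i" by (rule prime_elem_dvd_power[OF prime_J])
  hence "e \<le> 1" by (rule homog_dvd_degree_le[OF homog_J homog_Var Var_nonzero])
  thus False using e_ge_2 by simp
qed

lemma dvd_iff_vanishing:
  assumes "homog b h"
  shows "J dvd h \<longleftrightarrow> (\<forall>x\<in>proj_zeros J. mp_eval h x = 0)"
proof
  assume "\<forall>x\<in>proj_zeros J. mp_eval h x = 0"
  hence "J dvd h * Var 2"
    by (intro prime_form_dvd_of_vanishing[OF homog_J e_ge_1 prime_J homog_mult[OF assms homog_Var]])
      (auto simp: hom_distribs)
  thus "J dvd h" using not_dvd_Var_power[of 2 1] by (simp add: dvd_mult_iff)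
qed (use mp_eval_eq_0_of_dvd in blast)

text \<open>If \<open>\<delta> = d\<^sub>w - d\<^sub>n\<close>, then \<open>x\<^sub>2\<^sup>\<delta> n / w\<close> takes finitely many values on the curve, hence is constant; and it
  vanishes where \<open>x\<^sub>2\<close> does.\<close>

lemma negative_section_zero:
  fixes n w :: "'i::finite \<Rightarrow> 'k pol3"
  assumes w: "\<And>k. homog d\<^sub>w (w k)" and n: "\<And>k. homog d\<^sub>n (n k)" and less: "d\<^sub>n < d\<^sub>w"
    and nonzero: "\<And>x. x \<in> proj_zeros J \<Longrightarrow> \<exists>k. mp_eval (w k) x \<noteq> 0"
    and parallel: "\<And>x k l. x \<in> proj_zeros J \<Longrightarrow>
      mp_eval (n k) x * mp_eval (w l) x = mp_eval (n l) x * mp_eval (w k) x"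
  shows "J dvd n k"
proof -
  define \<delta> where "\<delta> = d\<^sub>w - d\<^sub>n"
  define u where "u k = Var 2 ^ \<delta> * n k" for k
  have u: "homog d\<^sub>w (u k)" for k
    using homog_mult[OF homog_Var_power n, of \<delta> 2 k] less by (simp add: u_def \<delta>_def)
  have "\<exists>R. finite R \<and> (\<forall>x\<in>proj_zeros J. \<exists>r\<in>R. \<forall>k. mp_eval (u k) x = r * mp_eval (w k) x)"
  proof (rule finitely_many_ratios_on_curve[OF homog_J u w nonzero])
    show "mp_eval (u k) x * mp_eval (w l) x = mp_eval (u l) x * mp_eval (w k) x" if "x \<in> proj_zeros J" for x k l
      using parallel[OF that, of k l] by (simp add: u_def hom_distribs mult.assoc)
  qed
  then obtain R where R: "finite R" "\<And>x. x \<in> proj_zeros J \<Longrightarrow> \<exists>r\<in>R. \<forall>k. mp_eval (u k) x = r * mp_eval (w k) x"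
    by blast
  have "proj_zeros J \<inter> proj_zeros (Var 2) \<noteq> {}"
    by (rule plane_curves_intersect[OF homog_J e_ge_1 homog_Var]) simp
  then obtain y where y: "y \<in> proj_zeros J" "y 2 = 0" by (auto simp: proj_zeros_def)
  obtain l where l: "mp_eval (w l) y \<noteq> 0" using nonzero[OF y(1)] by blast
  hence not_dvd: "\<not> J dvd w l" using mp_eval_eq_0_of_dvd y(1) by blast
  have "\<exists>r\<in>R. J dvd u l - Cst r * w l"
    using R less
    by (intro prime_form_dvd_of_finitely_many_ratios[OF homog_J e_ge_1 prime_J u w not_dvd]) auto
  then obtain r where r: "J dvd u l - Cst r * w l" by blast
  have "mp_eval (u l - Cst r * w l) y = 0" by (rule mp_eval_eq_0_of_dvd[OF r y(1)])
  hence "r = 0" using l y(2) less by (simp add: u_def hom_distribs \<delta>_def zero_power)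
  hence "J dvd n l" using r not_dvd_Var_power by (simp add: u_def dvd_mult_iff)
  hence "J dvd n k * w l"
    using less parallel[of _ k l] mp_eval_eq_0_of_dvd
    by (auto simp: dvd_iff_vanishing[OF homog_mult[OF n w]] hom_distribs)
  thus ?thesis using not_dvd by (simp add: dvd_mult_iff)
qed

lemma proj_zeros_nonempty: "proj_zeros J \<noteq> {}"
  using plane_curves_intersect[OF homog_J e_ge_1 homog_J e_ge_1] by blast

lemma not_dvd_of_nat:
  assumes "n \<ge> 1" shows "\<not> J dvd of_nat n"
proof
  assume dvd: "J dvd of_nat n"
  obtain x where "x \<in> proj_zeros J" using proj_zeros_nonempty by blast
  from mp_eval_eq_0_of_dvd[OF dvd this] show False using assms by (simp add: hom_distribs)
qed

lemma irreducible_P2_proj_zeros: "irreducible_P2 (proj_zeros J)"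
  unfolding irreducible_P2_def
proof (intro allI impI)
  fix A B assume "zclosed_P2 A" "zclosed_P2 B" and covering: "proj_zeros J \<subseteq> A \<union> B"
  then obtain P Q where P: "\<forall>p\<in>P. is_homog p" "A = {x. (\<exists>i. x i \<noteq> 0) \<and> (\<forall>p\<in>P. mp_eval p x = 0)}"
    and Q: "\<forall>q\<in>Q. is_homog q" "B = {x. (\<exists>i. x i \<noteq> 0) \<and> (\<forall>q\<in>Q. mp_eval q x = 0)}"
    unfolding zclosed_P2_def by blast
  show "proj_zeros J \<subseteq> A \<or> proj_zeros J \<subseteq> B"
  proof (rule ccontr)
    assume "\<not> (proj_zeros J \<subseteq> A \<or> proj_zeros J \<subseteq> B)"
    then obtain x y where not_covered: "x \<in> proj_zeros J" "x \<notin> A" "y \<in> proj_zeros J" "y \<notin> B" by blast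
    obtain p where p: "p \<in> P" "mp_eval p x \<noteq> 0" using not_covered(1,2) by (auto simp: P(2) proj_zeros_def)
    obtain q where q: "q \<in> Q" "mp_eval q y \<noteq> 0" using not_covered(3,4) by (auto simp: Q(2) proj_zeros_def)
    obtain a b where "homog a p" "homog b q" using P(1) Q(1) p(1) q(1) unfolding is_homog_def by blast
    hence "homog (a + b) (p * q)" by (rule homog_mult)
    moreover have "mp_eval (p * q) z = 0" if "z \<in> proj_zeros J" for z
      using that covering p(1) q(1) by (auto simp: P(2) Q(2) hom_distribs)
    ultimately have "J dvd p * q" by (simp add: dvd_iff_vanishing)
    thus False using not_covered p(2) q(2) mp_eval_eq_0_of_dvd by (auto simp: dvd_mult_iff)
  qed
qed

lemma ex_bracket_Var_not_dvd:
  assumes w: "homog D w" "D \<ge> 1" "\<not> J dvd w"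
  shows "\<exists>i. \<not> J dvd bracket J (Var i) w"
proof (rule ccontr)
  assume "\<nexists>i. \<not> J dvd bracket J (Var i) w"
  hence dvd: "J dvd bracket J (Var i) w" for i by blast
  obtain x where x: "x \<in> proj_zeros J" "mp_eval w x \<noteq> 0" using w(3) dvd_iff_vanishing[OF w(1)] by blast
  define a where "a j = mp_eval (mp_pderiv j J) x" for j
  define b where "b j = mp_eval (mp_pderiv j w) x" for j
  have "mp_eval (bracket J (Var i) w) x = 0" for i using dvd x(1) by (rule mp_eval_eq_0_of_dvd)
  from this[of 0] this[of 1] this[of 2]
  have "a 1 * b 2 = a 2 * b 1" "a 0 * b 2 = a 2 * b 0" "a 0 * b 1 = a 1 * b 0"
    by (simp_all add: bracket_def jac_def det3_def mp_pderiv_Var hom_distribs a_def b_def)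
  hence parallel: "a k * b j = b k * a j" for j k
    using exhaust_3[of j] exhaust_3[of k] by (auto simp: mult.commute)
  obtain k where a_k: "a k \<noteq> 0" using smooth_J x(1) by (auto simp: smooth_form_def a_def)
  have "a k * (\<Sum>j\<in>UNIV. x j * b j) = b k * (\<Sum>j\<in>UNIV. x j * a j)"
    by (simp add: sum_distrib_left mult.left_commute[of _ "x _"] parallel)
  also have "\<dots> = 0"
    using Euler_homog_mp_eval[OF homog_J, of x] x(1) by (simp add: a_def proj_zeros_def)
  finally have "of_nat D * mp_eval w x = 0"
    using a_k Euler_homog_mp_eval[OF w(1), of x] by (simp add: b_def)
  thus False using w(2) x(2) by simp
qed

text \<open>A relation \<open>F (u, w, v) \<equiv> 0\<close> of minimal degree with a third form \<open>v\<close> does not involve \<open>v\<close>: differentiation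
  along the curve turns it into \<open>(\<partial>F/\<partial>v) (u, w, v) \<equiv> 0\<close>, provided that \<open>v\<close> is not constant relative to \<open>w\<close>.\<close>

lemma ex_binary_relation_of_zero_derivative:
  assumes u: "homog D u" and w: "homog D w" "\<not> J dvd w" and D: "D \<ge> 1" and zero: "J dvd bracket J u w"
  shows "\<exists>n F s. homog n F \<and> F \<noteq> 0 \<and> F \<in> polys_in {0, 1} \<and> J dvd pullback s F \<and> s 0 = u \<and> s (1 :: 3) = w"
proof -
  obtain i where i: "\<not> J dvd bracket J (Var i) w" using ex_bracket_Var_not_dvd[OF w(1) D w(2)] by blast
  define s :: "3 \<Rightarrow> 'k pol3" where "s j = (if j = 0 then u else if j = 1 then w else Var i ^ D)" for j
  have not_dvd: "\<not> J dvd bracket J (s 2) w"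
    using i not_dvd_Var_power not_dvd_of_nat[OF D] by (simp add: s_def bracket_power dvd_mult_iff)
  have "homog D (s j)" for j using u w(1) by (simp add: s_def homog_Var_power)
  then obtain n F where F: "homog n F" "F \<noteq> 0" "J dvd pullback s F"
    and minimal: "\<And>m G. m < n \<Longrightarrow> homog m G \<Longrightarrow> J dvd pullback s G \<Longrightarrow> G = 0"
    using minimal_algebraic_relation_mod[OF homog_J _ _ D, of s] prime_J by (metis not_prime_elem_zero)
  obtain h where relation: "pullback s F = J * h" using F(3) ..
  have "J dvd bracket J (J * h) w" by (simp add: bracket_mult)
  moreover have "bracket J (s 0) w = bracket J u w" "bracket J (s 1) w = 0" by (simp_all add: s_def)
  ultimately have "J dvd pullback s (mp_pderiv 2 F) * bracket J (s 2) w"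
    using zero by (simp add: bracket_pullback sum_3 dvd_add_right_iff flip: relation)
  hence dvd: "J dvd pullback s (mp_pderiv 2 F)" using not_dvd by (simp add: dvd_mult_iff)
  have "mp_pderiv 2 F = 0"
  proof (cases "n = 0")
    case True
    thus ?thesis using homog_0_eq_Cst[of F] F(1) by (metis mp_pderiv_Cst)
  next
    case False
    thus ?thesis by (intro minimal[OF _ homog_mp_pderiv[OF F(1)] dvd]) simp
  qed
  moreover have "UNIV - {2} = {0, 1 :: 3}" using UNIV_3 by auto
  ultimately have "F \<in> polys_in {0, 1}" using polys_in_of_mp_pderiv_eq_0[of 2 F] by simp
  thus ?thesis using F by (intro exI[of _ n] exI[of _ F] exI[of _ s]) (simp add: s_def)
qed

lemma constant_of_zero_derivative:
  assumes u: "homog D u" and w: "homog D w" "\<not> J dvd w" and D: "D \<ge> 1" and zero: "J dvd bracket J u w"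
  shows "\<exists>r. J dvd u - Cst r * w"
proof -
  obtain n F s where F: "homog n F" "F \<noteq> 0" "F \<in> polys_in {0, 1}" "J dvd pullback s F"
    and s: "s 0 = u" "s (1 :: 3) = w"
    using ex_binary_relation_of_zero_derivative[OF assms] by blast
  define R where "R = {r. poly (fiber_poly ((\<lambda>_. 0)(1 := 1)) 0 F) r = 0}"
  have scale: "mp_eval F y = y 1 ^ n * poly (fiber_poly ((\<lambda>_. 0)(1 := 1)) 0 F) (y 0 / y 1)" if "y 1 \<noteq> 0" for y
  proof -
    have "mp_eval F y = mp_eval F (\<lambda>v. y 1 * (((\<lambda>_. 0)(1 := 1, 0 := y 0 / y 1)) v))"
      using that by (intro mp_eval_cong_polys_in[OF F(3)]) auto
    thus ?thesis unfolding mp_eval_scale[OF F(1)] by (simp add: poly_fiber_poly fun_upd_def)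
  qed
  have "\<exists>r\<in>R. J dvd u - Cst r * w"
  proof (rule prime_form_dvd_of_finitely_many_ratios[OF homog_J e_ge_1 prime_J u w D])
    obtain y where "mp_eval (Var 1 * F) y \<noteq> 0"
      using ex_mp_eval_nonzero[OF infinite_field, of "Var 1 * F"] F(2) by auto
    hence "fiber_poly ((\<lambda>_. 0)(1 := 1)) 0 F \<noteq> 0" using scale[of y] by (auto simp: hom_distribs)
    thus "finite R" unfolding R_def by (rule poly_roots_finite)
    fix x assume x: "x \<in> proj_zeros J" "mp_eval w x \<noteq> 0"
    have "mp_eval (pullback s F) x = 0" by (rule mp_eval_eq_0_of_dvd[OF F(4) x(1)])
    hence "mp_eval u x / mp_eval w x \<in> R"
      using scale[of "\<lambda>v. mp_eval (s v) x"] x(2) by (simp add: mp_eval_pullback R_def s)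
    thus "\<exists>r\<in>R. mp_eval u x = r * mp_eval w x" using x(2) by (intro bexI) simp_all
  qed
  thus ?thesis by blast
qed

lemma morphism_bracket_not_dvd:
  fixes g :: "'k endo"
  assumes g: "\<And>i. homog D (g i)" "D \<ge> 1"
    and nonzero: "\<And>x. \<exists>i. x i \<noteq> 0 \<Longrightarrow> \<exists>i. mp_eval (g i) x \<noteq> 0"
  shows "\<exists>a b. \<not> J dvd bracket J (g a) (g b)"
proof (rule ccontr)
  assume zero: "\<nexists>a b. \<not> J dvd bracket J (g a) (g b)"
  obtain x b where x: "x \<in> proj_zeros J" "mp_eval (g b) x \<noteq> 0"
    using proj_zeros_nonempty nonzero unfolding proj_zeros_def by blast
  hence "\<not> J dvd g b" using mp_eval_eq_0_of_dvd by blast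
  hence "\<exists>r. J dvd g a - Cst r * g b" for a
    using zero by (intro constant_of_zero_derivative[OF g(1) g(1) _ g(2)]) auto
  then obtain r where r: "\<And>a. J dvd g a - Cst (r a) * g b" by metis
  have "proj_zeros J \<inter> proj_zeros (g b) \<noteq> {}" by (rule plane_curves_intersect[OF homog_J e_ge_1 g])
  then obtain y where y: "y \<in> proj_zeros J" "mp_eval (g b) y = 0" by (auto simp: proj_zeros_def)
  have "mp_eval (g a) y = 0" for a
    using mp_eval_eq_0_of_dvd[OF r y(1), of a] y(2) by (simp add: hom_distribs)
  thus False using nonzero[of y] y(1) by (auto simp: proj_zeros_def)
qed

end


section \<open>Critical curves are not invariant\<close>

lemma add_3: "(0::3) + 1 = 1" "(1::3) + 1 = 2" "(2::3) + 1 = 0" "(0::3) + 2 = 2" "(1::3) + 2 = 0" "(2::3) + 2 = 1"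
  by simp_all

lemma sum_3_cyclic: "(\<Sum>j\<in>UNIV. f j) = f l + f (l + 1) + f (l + 2)" for l :: 3
  using exhaust_3[of l] by (elim disjE) (simp_all only: sum_3 add_3, simp_all only: ac_simps)

text \<open>Indices in type \<open>3\<close> are cyclic, so \<open>i + 1, i + 2\<close> are the other two indices.\<close>

definition adj3 :: "(3 \<Rightarrow> 3 \<Rightarrow> 'a::comm_ring_1) \<Rightarrow> 3 \<Rightarrow> 3 \<Rightarrow> 'a" where
  "adj3 M i l = M (l + 1) (i + 1) * M (l + 2) (i + 2) - M (l + 1) (i + 2) * M (l + 2) (i + 1)"

lemma mult_adj3: "(\<Sum>j\<in>UNIV. M l j * adj3 M j m) = (if l = m then det3 M else 0)"
  using exhaust_3[of l] exhaust_3[of m]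
  by (elim disjE) (simp_all only: sum_3 adj3_def add_3, simp_all add: det3_def algebra_simps)

lemma left_mult_adj3:
  "(\<Sum>j\<in>UNIV. (\<Sum>i\<in>UNIV. w i * M i j) * adj3 M j m) = w m * det3 M"
proof -
  have "(\<Sum>j\<in>UNIV. (\<Sum>i\<in>UNIV. w i * M i j) * adj3 M j m) = (\<Sum>i\<in>UNIV. w i * (\<Sum>j\<in>UNIV. M i j * adj3 M j m))"
    by (simp add: sum_distrib_left sum_distrib_right mult.assoc) (rule sum.swap)
  also have "\<dots> = (\<Sum>i\<in>UNIV. if i = m then w i * det3 M else 0)"
    by (intro sum.cong) (auto simp: mult_adj3)
  finally show ?thesis by simp
qed

lemma adj3_parallel:
  assumes kernel: "\<And>j. (\<Sum>l\<in>UNIV. w l * M l j) = 0"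
  shows "adj3 M i l * w k = adj3 M i k * w l"
proof -
  have "(3::3) = 0" by simp
  have next_index: "adj3 M i l * w (l + 1) = adj3 M i (l + 1) * w l" for l
  proof -
    have "adj3 M i l * w (l + 1) - adj3 M i (l + 1) * w l =
      M (l + 2) (i + 2) * (\<Sum>l\<in>UNIV. w l * M l (i + 1)) - M (l + 2) (i + 1) * (\<Sum>l\<in>UNIV. w l * M l (i + 2))"
      unfolding sum_3_cyclic[of _ l] by (simp add: adj3_def \<open>3 = 0\<close> add.assoc algebra_simps)
    thus ?thesis by (simp add: kernel)
  qed
  have "k = l \<or> k = l + 1 \<or> l = k + 1"
    using exhaust_3[of k] exhaust_3[of l] by auto
  thus ?thesis using next_index[of k] next_index[of l] by auto
qed

abbreviation jacobian :: "'k::comm_ring_1 endo \<Rightarrow> 3 \<Rightarrow> 3 \<Rightarrow> 'k pol3" where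
  "jacobian g \<equiv> \<lambda>i j. mp_pderiv j (g i)"

lemma gradient_mult_adj3:
  "(\<Sum>j\<in>UNIV. mp_pderiv j J * adj3 (jacobian g) j m) = bracket J (g (m + 1)) (g (m + 2))"
  unfolding sum_3 adj3_def add_3 bracket_def jac_def det3_def by (simp add: algebra_simps)

lemma mp_pderiv_invariant:
  assumes "pullback g J = J * H"
  shows "(\<Sum>i\<in>UNIV. pullback g (mp_pderiv i J) * jacobian g i j) = mp_pderiv j J * H + J * mp_pderiv j H"
  by (simp add: assms mp_pderiv_mult flip: mp_pderiv_pullback)

lemma dvd_mult_bracket_of_invariant:
  assumes H: "pullback g J = J * H" and "J dvd jac g"
  shows "J dvd H * bracket J (g (m + 1)) (g (m + 2))"
proof -
  have "pullback g (mp_pderiv m J) * jac g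
      = (\<Sum>j\<in>UNIV. (mp_pderiv j J * H + J * mp_pderiv j H) * adj3 (jacobian g) j m)"
    using left_mult_adj3[of "\<lambda>i. pullback g (mp_pderiv i J)" "jacobian g" m]
    by (simp add: jac_def mp_pderiv_invariant[OF H])
  also have "\<dots> = H * bracket J (g (m + 1)) (g (m + 2)) + J * (\<Sum>j\<in>UNIV. mp_pderiv j H * adj3 (jacobian g) j m)"
    unfolding gradient_mult_adj3[symmetric] by (simp add: algebra_simps sum.distrib sum_distrib_left)
  finally have "J dvd H * bracket J (g (m + 1)) (g (m + 2)) + J * (\<Sum>j\<in>UNIV. mp_pderiv j H * adj3 (jacobian g) j m)"
    using assms(2) by (metis dvd_mult)
  thus ?thesis by (simp only: dvd_add_left_iff[OF dvd_triv_left])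
qed

context smooth_plane_curve
begin

text \<open>If \<open>J \<circ> g = J H\<close> and \<open>H = 0\<close> on the curve, then \<open>\<nabla>J(g) Dg = H \<nabla>J = 0\<close> there, so the rows of \<open>adj Dg\<close> are
  multiples of \<open>\<nabla>J(g)\<close> by sections of negative degree.\<close>

lemma dvd_adj3_of_invariant:
  assumes g: "\<And>i. homog D (g i)" "D \<ge> 1" and e: "e \<ge> 3"
    and nonzero: "\<And>x. \<exists>i. x i \<noteq> 0 \<Longrightarrow> \<exists>i. mp_eval (g i) x \<noteq> 0"
    and H: "pullback g J = J * H" "J dvd H"
  shows "J dvd adj3 (jacobian g) i l"
proof (rule negative_section_zero)
  let ?w = "\<lambda>i. pullback g (mp_pderiv i J)"
  show "homog ((e - 1) * D) (?w k)" for k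
    by (intro homog_pullback homog_mp_pderiv homog_J g)
  show "homog ((D - 1) + (D - 1)) (adj3 (jacobian g) i k)" for k
    unfolding adj3_def by (intro homog_diff homog_mult homog_mp_pderiv g)
  have "(D - 1) + (D - 1) < 2 * D" using g(2) by simp
  also have "2 * D \<le> (e - 1) * D" using e by (intro mult_right_mono) auto
  finally show "(D - 1) + (D - 1) < (e - 1) * D" .
  fix x assume x: "x \<in> proj_zeros J"
  have "mp_eval J (\<lambda>i. mp_eval (g i) x) = 0"
    using x by (simp add: H(1) hom_distribs proj_zeros_def flip: mp_eval_pullback)
  hence "(\<lambda>i. mp_eval (g i) x) \<in> proj_zeros J"
    using x nonzero by (simp add: proj_zeros_def)
  thus "\<exists>k. mp_eval (?w k) x \<noteq> 0"
    using smooth_J by (auto simp: smooth_form_def mp_eval_pullback)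
  have "(\<Sum>l\<in>UNIV. mp_eval (?w l) x * mp_eval (jacobian g l j) x) = 0" for j
    using arg_cong[OF mp_pderiv_invariant[OF H(1), of j], of "\<lambda>p. mp_eval p x"] x
      mp_eval_eq_0_of_dvd[OF H(2) x] by (simp add: hom_distribs proj_zeros_def)
  from adj3_parallel[of "\<lambda>l. mp_eval (?w l) x" "\<lambda>l j. mp_eval (jacobian g l j) x", OF this]
  show "mp_eval (adj3 (jacobian g) i k) x * mp_eval (?w l) x = mp_eval (adj3 (jacobian g) i l) x * mp_eval (?w k) x" for k l
    by (simp add: adj3_def hom_distribs)
qed

theorem not_invariant_of_dvd_jac:
  assumes g: "\<And>i. homog D (g i)" "D \<ge> 1" and e: "e \<ge> 3"
    and nonzero: "\<And>x. \<exists>i. x i \<noteq> 0 \<Longrightarrow> \<exists>i. mp_eval (g i) x \<noteq> 0"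
    and jac: "J dvd jac g"
  shows "\<exists>x\<in>proj_zeros J. (\<lambda>i. mp_eval (g i) x) \<notin> proj_zeros J"
proof (rule ccontr)
  assume "\<not> ?thesis"
  hence "mp_eval (pullback g J) x = 0" if "x \<in> proj_zeros J" for x
    using that by (auto simp: mp_eval_pullback proj_zeros_def)
  hence "J dvd pullback g J"
    by (simp add: dvd_iff_vanishing[OF homog_pullback[OF homog_J, of D g]] g(1))
  then obtain H where H: "pullback g J = J * H" ..
  have dvd: "J dvd bracket J (g (m + 1)) (g (m + 2))" for m
  proof (cases "J dvd H")
    case True
    thus ?thesis unfolding gradient_mult_adj3[symmetric]
      by (intro dvd_sum dvd_mult dvd_adj3_of_invariant[OF g e nonzero H])
  next
    case False
    thus ?thesis using dvd_mult_bracket_of_invariant[OF H jac] by (simp add: dvd_mult_iff)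
  qed
  have "J dvd bracket J (g a) (g b)" for a b
  proof -
    have "a = b \<or> (\<exists>m. (a = m + 1 \<and> b = m + 2) \<or> (a = m + 2 \<and> b = m + 1))"
      using exhaust_3[of a] exhaust_3[of b] add_3 by metis
    thus ?thesis using dvd by (metis bracket_same(1) bracket_swap dvd_0_right dvd_minus_iff)
  qed
  thus False using morphism_bracket_not_dvd[OF g nonzero] by blast
qed

end


section \<open>Iterates and the critical locus\<close>

fun endo_iterate :: "'k::comm_ring_1 endo \<Rightarrow> nat \<Rightarrow> 'k endo" where
  "endo_iterate f 0 = Var"
| "endo_iterate f (Suc k) = (\<lambda>i. pullback (endo_iterate f k) (f i))"

lemma mp_eval_endo_iterate: "(\<lambda>i. mp_eval (endo_iterate f k i) x) = (apply_endo f ^^ k) x"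
  by (induction k) (simp_all add: mp_eval_pullback apply_endo_def)

lemma homog_endo_iterate: "(\<And>i. homog d (f i)) \<Longrightarrow> homog (d ^ k) (endo_iterate f k i)"
proof (induction k arbitrary: i)
  case 0 show ?case using homog_Var by simp
next
  case (Suc k)
  thus ?case using homog_pullback[of d "f i" "d ^ k" "endo_iterate f k"] by simp
qed

lemma endo_iterate_nonzero:
  assumes f: "f \<in> End2 d" and x: "\<exists>i. x i \<noteq> 0"
  shows "\<exists>i. mp_eval (endo_iterate f k i) x \<noteq> 0"
proof (induction k)
  case (Suc k)
  let ?y = "\<lambda>v. mp_eval (endo_iterate f k v) x"
  have "\<exists>i. mp_eval (f i) ?y \<noteq> 0" using f Suc unfolding End2_def by blast
  thus ?case by (simp add: mp_eval_pullback)
qed (use x in simp)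

lemma det3_mult: "det3 (\<lambda>i j. \<Sum>l\<in>UNIV. A i l * B l j) = det3 A * det3 B"
  unfolding det3_def sum_3 by (simp add: algebra_simps)

lemma (in comm_ring_hom) hom_det3: "hom (det3 M) = det3 (\<lambda>i j. hom (M i j))"
  by (simp add: det3_def hom_distribs)

lemma jac_pullback: "jac (\<lambda>i. pullback g (f i)) = pullback g (jac f) * jac g"
  unfolding jac_def by (simp add: mp_pderiv_pullback pullback.hom_det3 flip: det3_mult)

lemma jac_dvd_jac_endo_iterate: "k \<ge> 1 \<Longrightarrow> jac f dvd jac (endo_iterate f k)"
proof (induction k rule: nat_induct_at_least)
  case base
  show ?case by (simp add: jac_def)
qed (simp add: jac_pullback)

lemma homog_det3:
  assumes "\<And>i j. homog n (M i j)"
  shows "homog (3 * n) (det3 M)"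
proof -
  have "homog (n + n + n) (det3 M)"
    unfolding det3_def by (intro homog_add homog_diff homog_mult assms)
  moreover have "n + n + n = 3 * n" by simp
  ultimately show ?thesis by metis
qed

lemma homog_jac: "(\<And>i. homog d (f i)) \<Longrightarrow> homog (3 * (d - 1)) (jac f)"
  unfolding jac_def by (intro homog_det3 homog_mp_pderiv)

lemma crit_eq_proj_zeros: "crit f = proj_zeros (jac f)"
  by (simp add: crit_def proj_zeros_def)

lemma smooth_crit_iff: "smooth_crit f \<longleftrightarrow> smooth_form (jac f)"
  by (simp add: smooth_crit_def smooth_form_def crit_eq_proj_zeros)

context algebraically_closed_char_0
begin

lemma smooth_plane_curve_jac:
  assumes d: "d \<ge> 2" and f: "f \<in> End2 d" and smooth: "smooth_form (jac f)"
  shows "smooth_plane_curve (jac f :: 'k pol3) (3 * (d - 1))"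
proof
  show "homog (3 * (d - 1)) (jac f)" using f by (intro homog_jac) (simp add: End2_def)
qed (use d smooth ex_root in auto)

lemma Ed_eq_smooth: "d \<ge> 2 \<Longrightarrow> Ed d = {f \<in> End2 d. smooth_form (jac f :: 'k pol3)}"
  using smooth_plane_curve.irreducible_P2_proj_zeros[OF smooth_plane_curve_jac]
  by (auto simp: Ed_def smooth_crit_iff crit_eq_proj_zeros)

theorem Ed_not_pcp:
  fixes f :: "'k endo"
  assumes d: "d \<ge> 2" and f: "f \<in> Ed d"
  shows "\<not> pcp f"
proof
  assume "pcp f"
  then obtain k where invariant: "k \<ge> 1" "\<And>x. x \<in> crit f \<Longrightarrow> (apply_endo f ^^ k) x \<in> crit f"
    unfolding pcp_def by blast
  have End: "f \<in> End2 d" and smooth: "smooth_form (jac f)" using f Ed_eq_smooth[OF d] by auto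
  have "\<exists>x\<in>proj_zeros (jac f). (\<lambda>i. mp_eval (endo_iterate f k i) x) \<notin> proj_zeros (jac f)"
  proof (rule smooth_plane_curve.not_invariant_of_dvd_jac[OF smooth_plane_curve_jac[OF d End smooth]])
    show "homog (d ^ k) (endo_iterate f k i)" for i
      using End by (intro homog_endo_iterate) (simp add: End2_def)
    show "\<exists>i. mp_eval (endo_iterate f k i) x \<noteq> 0" if "\<exists>i. x i \<noteq> 0" for x
      by (rule endo_iterate_nonzero[OF End that])
  qed (use d jac_dvd_jac_endo_iterate[OF invariant(1)] in auto)
  thus False using invariant(2) by (auto simp: mp_eval_endo_iterate crit_eq_proj_zeros)
qed

end


section \<open>Openness\<close>

lemma lookup_mult_eq_sum:
  fixes p q :: "('v::finite, 'k::comm_ring_1) mpol"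
  shows "lookup (p * q) m = (\<Sum>(a, b)\<in>{(a, b). a + b = m}. lookup p a * lookup q b)"
proof -
  have "p * q = (\<Sum>a\<in>keys p. \<Sum>b\<in>keys q. single (a + b) (lookup p a * lookup q b))"
    by (subst (1 2) sum_single_keys[symmetric]) (simp add: sum_product mult_single)
  hence "lookup (p * q) m = (\<Sum>(a, b)\<in>keys p \<times> keys q. if a + b = m then lookup p a * lookup q b else 0)"
    by (simp add: sum.cartesian_product lookup_sum lookup_single when_def case_prod_beta)
  also have "\<dots> = (\<Sum>(a, b)\<in>keys p \<times> keys q \<inter> {(a, b). a + b = m}. lookup p a * lookup q b)"
    by (simp add: sum.inter_restrict case_prod_beta)
  also have "\<dots> = (\<Sum>(a, b)\<in>{(a, b). a + b = m}. lookup p a * lookup q b)"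
  proof (rule sum.mono_neutral_left)
    have "{(a, b). a + b = m} \<subseteq> (\<Union>k\<le>mon_deg m. monomials k) \<times> (\<Union>k\<le>mon_deg m. monomials k)"
      by (auto simp: monomials_def mon_deg_add)
    thus "finite {(a, b). a + b = m}" by (rule finite_subset) simp
  qed (auto simp: in_keys_iff)
  finally show ?thesis .
qed

definition coord_form :: "nat \<Rightarrow> nat \<Rightarrow> ('k::comm_ring_1 endo \<Rightarrow> 'k) \<Rightarrow> bool" where
  "coord_form d n q \<longleftrightarrow> (\<exists>p\<in>polys_in {(i, m). mon_deg m = d}. homog n p \<and>
     (\<forall>f\<in>End2 d. mp_eval p (coord f) = q f))"

lemma coord_form_0: "coord_form d n (\<lambda>_. 0)"
  unfolding coord_form_def by (intro bexI[of _ 0]) simp_all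

lemma coord_form_const: "coord_form d 0 (\<lambda>_. c)"
  unfolding coord_form_def by (intro bexI[of _ "Cst c"]) (simp_all add: homog_Cst)

lemma coord_form_add:
  assumes "coord_form d n q" "coord_form d n r" shows "coord_form d n (\<lambda>f. q f + r f)"
proof -
  obtain a b where "a \<in> polys_in {(i, m). mon_deg m = d}" "homog n a" "\<forall>f\<in>End2 d. mp_eval a (coord f) = q f"
    "b \<in> polys_in {(i, m). mon_deg m = d}" "homog n b" "\<forall>f\<in>End2 d. mp_eval b (coord f) = r f"
    using assms unfolding coord_form_def by blast
  thus ?thesis unfolding coord_form_def
    by (intro bexI[of _ "a + b"]) (auto simp: hom_distribs intro: homog_add polys_in_add)
qed

lemma coord_form_mult:
  assumes "coord_form d n q" "coord_form d k r" shows "coord_form d (n + k) (\<lambda>f. q f * r f)"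
proof -
  obtain a b where "a \<in> polys_in {(i, m). mon_deg m = d}" "homog n a" "\<forall>f\<in>End2 d. mp_eval a (coord f) = q f"
    "b \<in> polys_in {(i, m). mon_deg m = d}" "homog k b" "\<forall>f\<in>End2 d. mp_eval b (coord f) = r f"
    using assms unfolding coord_form_def by blast
  thus ?thesis unfolding coord_form_def
    by (intro bexI[of _ "a * b"]) (auto simp: hom_distribs intro: homog_mult polys_in_mult)
qed

lemma coord_form_cmult: "coord_form d n q \<Longrightarrow> coord_form d n (\<lambda>f. c * q f)"
  using coord_form_mult[OF coord_form_const] by fastforce

lemma coord_form_diff: "coord_form d n q \<Longrightarrow> coord_form d n r \<Longrightarrow> coord_form d n (\<lambda>f. q f - r f)"
  using coord_form_add[of d n q "\<lambda>f. (-1) * r f"] coord_form_cmult[of d n r "-1"] by simp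

lemma coord_form_sum:
  "(\<And>i. i \<in> A \<Longrightarrow> coord_form d n (q i)) \<Longrightarrow> coord_form d n (\<lambda>f. \<Sum>i\<in>A. q i f)"
  by (induction A rule: infinite_finite_induct) (auto intro: coord_form_0 coord_form_add)

lemma coord_form_prod:
  assumes "finite A" "\<And>i. i \<in> A \<Longrightarrow> coord_form d n (q i)"
  shows "coord_form d (card A * n) (\<lambda>f. \<Prod>i\<in>A. q i f)"
  using assms by (induction A rule: finite_induct) (auto intro: coord_form_const coord_form_mult)

lemma coord_form_lookup: "coord_form d 1 (\<lambda>f. lookup (f i) m)"
proof (cases "mon_deg m = d")
  case True
  thus ?thesis unfolding coord_form_def
    by (intro bexI[of _ "Var (i, m)"]) (auto simp: homog_Var[simplified] coord_def intro: polys_in_Var)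
next
  case False
  hence "\<forall>f\<in>End2 d. lookup (f i) m = 0" by (auto simp: End2_def homog_def in_keys_iff)
  thus ?thesis unfolding coord_form_def by (intro bexI[of _ 0]) simp_all
qed

definition coord_form_coeffs :: "nat \<Rightarrow> nat \<Rightarrow> ('k::comm_ring_1 endo \<Rightarrow> 'k pol3) \<Rightarrow> bool" where
  "coord_form_coeffs d n F \<longleftrightarrow> (\<forall>m. coord_form d n (\<lambda>f. lookup (F f) m))"

lemma coord_form_coeffs_add:
  "coord_form_coeffs d n F \<Longrightarrow> coord_form_coeffs d n G \<Longrightarrow> coord_form_coeffs d n (\<lambda>f. F f + G f)"
  by (simp add: coord_form_coeffs_def lookup_add coord_form_add)

lemma coord_form_coeffs_diff:
  "coord_form_coeffs d n F \<Longrightarrow> coord_form_coeffs d n G \<Longrightarrow> coord_form_coeffs d n (\<lambda>f. F f - G f)"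
  by (simp add: coord_form_coeffs_def lookup_minus coord_form_diff)

lemma coord_form_coeffs_mult:
  "coord_form_coeffs d n F \<Longrightarrow> coord_form_coeffs d k G \<Longrightarrow> coord_form_coeffs d (n + k) (\<lambda>f. F f * G f)"
  by (simp add: coord_form_coeffs_def lookup_mult_eq_sum case_prod_beta coord_form_sum coord_form_mult)

lemma coord_form_coeffs_cmult: "coord_form_coeffs d n F \<Longrightarrow> coord_form_coeffs d n (\<lambda>f. c * F f)"
  by (simp add: coord_form_coeffs_def lookup_mult_eq_sum case_prod_beta coord_form_sum coord_form_cmult)

lemma coord_form_coeffs_sum:
  "(\<And>i. i \<in> A \<Longrightarrow> coord_form_coeffs d n (F i)) \<Longrightarrow> coord_form_coeffs d n (\<lambda>f. \<Sum>i\<in>A. F i f)"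
  by (simp add: coord_form_coeffs_def lookup_sum coord_form_sum)

lemma coord_form_coeffs_mp_pderiv:
  "coord_form_coeffs d n F \<Longrightarrow> coord_form_coeffs d n (\<lambda>f. mp_pderiv j (F f))"
  by (simp add: coord_form_coeffs_def lookup_mp_pderiv coord_form_cmult del: of_nat_Suc of_nat_add)

lemma coord_form_coeffs_component: "coord_form_coeffs d 1 (\<lambda>f. f i)"
  unfolding coord_form_coeffs_def by (intro allI coord_form_lookup)

lemma coord_form_coeffs_jac: "coord_form_coeffs d (1 + 1 + 1) jac"
proof -
  have "coord_form_coeffs d 1 (\<lambda>f. mp_pderiv j (f i))" for i j
    by (intro coord_form_coeffs_mp_pderiv coord_form_coeffs_component)
  hence "coord_form_coeffs d (1 + 1 + 1) (\<lambda>f. jac f)"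
    unfolding jac_def det3_def
    by (intro coord_form_coeffs_add coord_form_coeffs_diff coord_form_coeffs_mult)
  thus ?thesis by simp
qed

lemma coord_form_det:
  assumes "\<And>i j. i < n \<Longrightarrow> j < n \<Longrightarrow> coord_form d k (\<lambda>f. B f i j)"
  shows "coord_form d (n * k) (\<lambda>f. det (mat n n (\<lambda>(i, j). B f i j)))"
proof -
  have det_eq_sum: "det (mat n n (\<lambda>(i, j). B f i j)) =
     (\<Sum>p\<in>{p. p permutes {0..<n}}. signof p * (\<Prod>i\<in>{0..<n}. B f i (p i)))" for f
    unfolding det_def by (auto intro!: sum.cong prod.cong simp: permutes_in_image[of _ "{0..<n}", simplified])
  have "coord_form d (card {0..<n} * k) (\<lambda>f. \<Prod>i\<in>{0..<n}. B f i (p i))" if "p permutes {0..<n}" for p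
    using permutes_in_image[OF that] by (intro coord_form_prod assms) auto
  thus ?thesis unfolding det_eq_sum by (intro coord_form_sum coord_form_cmult) simp
qed

lemma coord_form_det_form_matrix:
  assumes "\<And>m. coord_form_coeffs d k (\<lambda>f. Q f m)"
  shows "coord_form d (length (monomial_list n :: (3 \<Rightarrow>\<^sub>0 nat) list) * k) (\<lambda>f. det (form_matrix n (Q f)))"
  unfolding form_matrix_def Let_def
  by (rule coord_form_det) (use assms in \<open>simp add: coord_form_coeffs_def\<close>)

lemma det_form_matrix_eq_0:
  fixes x :: "'v::finite \<Rightarrow> 'k::field"
  assumes "\<And>m. m \<in> monomials n \<Longrightarrow> homog n (Q m)" "\<And>m. m \<in> monomials n \<Longrightarrow> mp_eval (Q m) x = 0"
    and "x i \<noteq> 0"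
  shows "det (form_matrix n Q) = 0"
proof -
  have "eigenvalue (form_matrix n Q) 0" using assms by (intro eigenvalue_form_matrix[of n Q x 0]) simp_all
  then obtain v where "v \<in> carrier_vec (dim_row (form_matrix n Q))" "v \<noteq> 0\<^sub>v (dim_row (form_matrix n Q))"
    "form_matrix n Q *\<^sub>v v = 0 \<cdot>\<^sub>v v" unfolding eigenvalue_def eigenvector_def by blast
  moreover from this have "0 \<cdot>\<^sub>v v = 0\<^sub>v (dim_row (form_matrix n Q))" by (intro eq_vecI) auto
  ultimately show ?thesis using det_0_iff_vec_prod_zero_field[OF form_matrix_carrier[of n Q]] by auto
qed

lemma det_form_matrix_monomials:
  fixes Q :: "('v::finite \<Rightarrow>\<^sub>0 nat) \<Rightarrow> ('v, 'k::comm_ring_1) mpol"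
  assumes "\<And>m. m \<in> monomials n \<Longrightarrow> Q m = single m 1"
  shows "det (form_matrix n Q) = 1"
proof -
  let ?ms = "monomial_list n :: ('v \<Rightarrow>\<^sub>0 nat) list"
  have "?ms ! a \<in> monomials n" if "a < length ?ms" for a
    using nth_mem[OF that] by simp
  hence "form_matrix n Q = 1\<^sub>m (dim_row (form_matrix n Q))"
    by (intro eq_matI) (auto simp: form_matrix_def Let_def assms lookup_single when_def
        nth_eq_iff_index_eq[OF distinct_monomial_list])
  thus ?thesis by (metis det_one)
qed

context algebraically_closed_char_0
begin

lemma smooth_form_monomials_in_jacobian_ideal:
  fixes J :: "('v::finite, 'k) mpol"
  assumes J: "homog e J" "e \<ge> 1" "smooth_form J"
  shows "\<exists>n\<ge>e. \<exists>c. \<forall>m\<in>monomials n.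
    (\<forall>j. homog (n - (e - 1)) (c m j)) \<and> single m 1 = (\<Sum>j\<in>UNIV. c m j * mp_pderiv j J)"
proof -
  have "\<exists>N. \<forall>n\<ge>N. \<exists>c. \<forall>m\<in>monomials n.
    (\<forall>j\<in>UNIV. homog (n - (e - 1)) (c m j)) \<and> single m 1 = (\<Sum>j\<in>UNIV. c m j * mp_pderiv j J)"
  proof (rule nullstellensatz_monomials)
    show "homog (e - 1) (mp_pderiv j J)" for j by (rule homog_mp_pderiv[OF J(1)])
    fix x assume zero: "\<forall>j\<in>UNIV. mp_eval (mp_pderiv j J) x = 0"
    hence "mp_eval J x = 0" using Euler_homog_mp_eval[OF J(1), of x] J(2) by simp
    thus "x = (\<lambda>_. 0)" using J(3) zero by (force simp: smooth_form_def proj_zeros_def)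
  qed simp
  then obtain N where "\<forall>n\<ge>N. \<exists>c. \<forall>m\<in>monomials n.
    (\<forall>j\<in>UNIV. homog (n - (e - 1)) (c m j)) \<and> single m 1 = (\<Sum>j\<in>UNIV. c m j * mp_pderiv j J)" ..
  from this[rule_format, of "max N e"] show ?thesis by (intro exI[of _ "max N e"]) auto
qed

text \<open>\<open>det (\<Phi>\<^sub>f \<circ> T)\<close> separates a smooth \<open>f\<^sub>0\<close> from the singular maps. Here
  \<open>\<Phi>\<^sub>f (c) = \<Sum>\<^sub>j c\<^sub>j \<partial>\<^sub>jJ\<^sub>f\<close> and \<open>T\<close> is a section of \<open>\<Phi>\<^bsub>f\<^sub>0\<^esub>\<close> in a degree where the Nullstellensatz makes
  \<open>\<Phi>\<^bsub>f\<^sub>0\<^esub>\<close> surjective; at a singular point \<open>x\<close> of \<open>J\<^sub>f\<close> the vector of monomials in \<open>x\<close> lies in the kernel.\<close>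

lemma ex_separating_coord_poly:
  fixes f\<^sub>0 :: "'k endo"
  assumes d: "d \<ge> 2" and f\<^sub>0: "f\<^sub>0 \<in> End2 d" "smooth_form (jac f\<^sub>0)"
  shows "\<exists>p. coord_poly d p \<and> mp_eval p (coord f\<^sub>0) \<noteq> 0 \<and>
     (\<forall>f\<in>End2 d. \<not> smooth_form (jac f) \<longrightarrow> mp_eval p (coord f) = 0)"
proof -
  define e where "e = 3 * (d - 1)"
  have homog: "homog e (jac f)" if "f \<in> End2 d" for f :: "'k endo"
    using that unfolding e_def by (intro homog_jac) (simp add: End2_def)
  have "e \<ge> 1" using d by (simp add: e_def)
  from smooth_form_monomials_in_jacobian_ideal[OF homog[OF f\<^sub>0(1)] this f\<^sub>0(2)]
  obtain n c where n: "n \<ge> e"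
    and combination: "\<And>m j. m \<in> monomials n \<Longrightarrow> homog (n - (e - 1)) (c m j)"
      "\<And>m. m \<in> monomials n \<Longrightarrow> single m 1 = (\<Sum>j\<in>UNIV. c m j * mp_pderiv j (jac f\<^sub>0))" by auto
  define Q where "Q f m = (\<Sum>j\<in>UNIV. c m j * mp_pderiv j (jac f))" for f m
  have "coord_form_coeffs d (1 + 1 + 1) (\<lambda>f. Q f m)" for m
    unfolding Q_def
    by (intro coord_form_coeffs_sum coord_form_coeffs_cmult coord_form_coeffs_mp_pderiv coord_form_coeffs_jac)
  then obtain l p where p: "p \<in> polys_in {(i, m). mon_deg m = d}" "homog l p"
    "\<And>f. f \<in> End2 d \<Longrightarrow> mp_eval p (coord f) = det (form_matrix n (Q f))"
    using coord_form_det_form_matrix[of d _ Q n] unfolding coord_form_def by blast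
  have "coord_poly d p" using p(1,2) by (auto simp: coord_poly_def is_homog_def polys_in_def)
  moreover have "mp_eval p (coord f\<^sub>0) \<noteq> 0"
    using combination(2) by (simp add: p(3)[OF f\<^sub>0(1)] det_form_matrix_monomials Q_def)
  moreover have "mp_eval p (coord f) = 0" if f: "f \<in> End2 d" "\<not> smooth_form (jac f)" for f
  proof -
    obtain x i where x: "x i \<noteq> 0" "\<And>j. mp_eval (mp_pderiv j (jac f)) x = 0"
      using f(2) unfolding smooth_form_def proj_zeros_def by blast
    have "homog (n - (e - 1) + (e - 1)) (Q f m)" if "m \<in> monomials n" for m
      unfolding Q_def by (intro homog_sum homog_mult combination that homog_mp_pderiv homog f)
    hence "det (form_matrix n (Q f)) = 0"
      using n x by (intro det_form_matrix_eq_0[of n "Q f" x i]) (simp_all add: Q_def hom_distribs)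
    thus ?thesis using p(3)[OF f(1)] by simp
  qed
  ultimately show ?thesis by blast
qed

lemma zopen_Ed:
  assumes d: "d \<ge> 2"
  shows "zopen_End d (Ed d :: 'k endo set)"
proof -
  define P where "P = {p. coord_poly d p \<and>
    (\<forall>f :: 'k endo \<in> End2 d. \<not> smooth_form (jac f) \<longrightarrow> mp_eval p (coord f) = 0)}"
  have "End2 d - Ed d = {f\<in>End2 d. \<forall>p\<in>P. mp_eval p (coord f) = 0}"
    using ex_separating_coord_poly[OF d] by (fastforce simp: Ed_eq_smooth[OF d] P_def)
  moreover have "\<forall>p\<in>P. coord_poly d p" by (simp add: P_def)
  ultimately have "zclosed_End d (End2 d - Ed d :: 'k endo set)" unfolding zclosed_End_def by blast
  thus ?thesis by (auto simp: zopen_End_def Ed_def)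
qed

end


section \<open>Linear maps\<close>

lemma det3_nonzero_of_trivial_kernel:
  fixes M :: "3 \<Rightarrow> 3 \<Rightarrow> 'k::field"
  assumes kernel: "\<And>v. (\<And>i. (\<Sum>j\<in>UNIV. M i j * v j) = 0) \<Longrightarrow> v = (\<lambda>_. 0)"
  shows "det3 M \<noteq> 0"
proof -
  have "\<exists>v. \<forall>i. (\<Sum>j\<in>UNIV. M i j * v j) = (if i = k then 1 else 0)" for k
  proof -
    define v where "v a i = (case a of None \<Rightarrow> if i = k then 1 else 0 | Some j \<Rightarrow> M i j)" for a i
    have "card (UNIV :: 3 set) < card (UNIV :: 3 option set)"
      by (simp add: UNIV_option_conv card_image)
    from ex_linear_relation[OF finite finite this, of v]
    obtain c where nonzero: "\<exists>a. c a \<noteq> 0" and "\<And>i. (\<Sum>a\<in>UNIV. c a * v a i) = 0" by auto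
    hence relation: "c None * (if i = k then 1 else 0) + (\<Sum>j\<in>UNIV. M i j * c (Some j)) = 0" for i
      by (simp add: UNIV_option_conv sum.reindex v_def mult.commute)
    have "c None \<noteq> 0"
    proof
      assume None: "c None = 0"
      hence "(\<lambda>j. c (Some j)) = (\<lambda>_. 0)" using relation by (intro kernel) simp
      thus False using None nonzero by (metis option.exhaust)
    qed
    thus ?thesis using relation
      by (intro exI[of _ "\<lambda>j. - c (Some j) / c None"])
        (simp add: sum_negf add_eq_0_iff field_simps flip: sum_divide_distrib)
  qed
  then obtain N where "\<And>i k. (\<Sum>j\<in>UNIV. M i j * N k j) = (if i = k then 1 else 0)" by metis
  hence "det3 M * det3 (\<lambda>j k. N k j) = det3 (\<lambda>i k. if i = k then 1 else 0)"
    by (simp flip: det3_mult)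
  thus ?thesis by (auto simp: det3_def)
qed

lemma crit_linear_map:
  fixes f :: "'k::field endo"
  assumes f: "f \<in> End2 1"
  shows "crit f = {}"
proof (rule ccontr)
  assume "crit f \<noteq> {}"
  then obtain x where x: "mp_eval (jac f) x = 0" by (auto simp: crit_def)
  have homog: "homog 1 (f i)" for i using f by (simp add: End2_def)
  have const: "mp_eval (mp_pderiv j (f i)) y = mp_eval (mp_pderiv j (f i)) x" for i j y
    using homog_0_eq_Cst[of "mp_pderiv j (f i)"] homog_mp_pderiv[OF homog, of j i] by (metis diff_self_eq_0 mp_eval_Cst)
  have "det3 (\<lambda>i j. mp_eval (mp_pderiv j (f i)) x) \<noteq> 0"
  proof (rule det3_nonzero_of_trivial_kernel)
    fix v assume "\<And>i. (\<Sum>j\<in>UNIV. mp_eval (mp_pderiv j (f i)) x * v j) = 0"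
    hence "mp_eval (f i) v = 0" for i
      using Euler_homog_mp_eval[OF homog, of v i] const[of _ _ v] by (simp add: mult.commute)
    thus "v = (\<lambda>_. 0)" using f by (auto simp: End2_def)
  qed
  thus False using x by (simp add: jac_def mp_eval.hom_det3)
qed

lemma Ed_1: "(Ed 1 :: 'k::field endo set) = End2 1"
  by (auto simp: Ed_def smooth_crit_def irreducible_P2_def crit_linear_map[simplified])

lemma Ed_1_nonempty: "(Ed 1 :: 'k::field endo set) \<noteq> {}"
proof -
  have "Var \<in> (End2 1 :: 'k endo set)" by (simp add: End2_def homog_Var[simplified])
  thus ?thesis unfolding Ed_1 by blast
qed

lemma zopen_Ed_1: "zopen_End 1 (Ed 1 :: 'k::field endo set)"
proof -
  have "coord_poly 1 (1 :: (3 \<times> (3 \<Rightarrow>\<^sub>0 nat), 'k) mpol)"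
    by (auto simp: coord_poly_def is_homog_def intro: homog_1)
  hence "zclosed_End 1 ({} :: 'k endo set)" unfolding zclosed_End_def by (intro exI[of _ "{1}"]) auto
  thus ?thesis unfolding zopen_End_def Ed_1 by simp
qed


section \<open>A map with smooth critical locus\<close>

definition symmetric_map :: "nat \<Rightarrow> 'k::comm_ring_1 endo" where
  "symmetric_map n i = Var i * (of_nat (Suc n) * (\<Sum>k\<in>UNIV. Var k ^ n) - Var i ^ n)"

definition critical_cubic :: "'a::comm_ring_1 \<Rightarrow> (3 \<Rightarrow> 'a) \<Rightarrow> 'a" where
  "critical_cubic N X = N * (\<Sum>i\<in>UNIV. X i) ^ 3
     + (1 - 2 * N) * (\<Sum>i\<in>UNIV. X i) * (X 0 * X 1 + X 0 * X 2 + X 1 * X 2)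
     + (3 * N - 1) * (X 0 * X 1 * X 2)"

text \<open>The partial derivative with respect to \<open>X\<^sub>i\<close> is the value at \<open>X\<^sub>i\<close> of a quadratic polynomial that does not
  depend on \<open>i\<close>.\<close>

definition critical_cubic_deriv :: "'a::comm_ring_1 \<Rightarrow> (3 \<Rightarrow> 'a) \<Rightarrow> 'a \<Rightarrow> 'a" where
  "critical_cubic_deriv N X t = (3 * N - 1) * t ^ 2 - N * (\<Sum>i\<in>UNIV. X i) * t
     + (N + 1) * (\<Sum>i\<in>UNIV. X i) ^ 2 + N * (X 0 * X 1 + X 0 * X 2 + X 1 * X 2)"

lemma mp_pderiv_critical_cubic:
  "mp_pderiv j (critical_cubic (of_nat n) X)
    = (\<Sum>i\<in>UNIV. critical_cubic_deriv (of_nat n) X (X i) * mp_pderiv j (X i))"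
  by (simp add: critical_cubic_def critical_cubic_deriv_def sum_3 mp_pderiv_add mp_pderiv_diff mp_pderiv_mult
      power2_eq_square power3_eq_cube) (simp add: algebra_simps)

lemma det3_rank_one_update:
  "det3 (\<lambda>i j. (if i = j then D i else 0) + u i * v j) = D 0 * D 1 * D 2
    + (u 0 * v 0 * (D 1 * D 2) + u 1 * v 1 * (D 0 * D 2) + u 2 * v 2 * (D 0 * D 1))"
  by (simp add: det3_def algebra_simps)

lemma jac_symmetric_map:
  "jac (symmetric_map n :: 'k::comm_ring_1 endo)
    = of_nat (Suc n) ^ 3 * critical_cubic (of_nat n) (\<lambda>i. Var i ^ n)"
proof -
  define d where "d = (of_nat (Suc n) :: 'k pol3)"
  define N where "N = (of_nat n :: 'k pol3)"
  define s where "s = (\<Sum>k\<in>UNIV. Var k ^ n :: 'k pol3)"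
  have d_eq: "d = 1 + N" by (simp add: d_def N_def)
  have Var_power_pred: "N * (Var i * Var i ^ (n - 1)) = N * Var i ^ n" for i
    by (cases n) (simp_all add: N_def)
  have pderiv: "mp_pderiv j d = 0" "mp_pderiv j (Var i ^ n) = (if i = j then N * Var i ^ (n - 1) else 0)"
    "mp_pderiv j s = N * Var j ^ (n - 1)" for i j
    by (simp_all add: d_eq N_def s_def mp_pderiv_add mp_pderiv_sum mp_pderiv_power mp_pderiv_Var if_distrib cong: if_cong)
  have "jacobian (symmetric_map n) i j
      = (if i = j then d * (s - Var i ^ n) else 0) + Var i * (d * (N * Var j ^ (n - 1)))" for i j
    unfolding symmetric_map_def d_def[symmetric] s_def[symmetric] mp_pderiv_mult mp_pderiv_diff pderiv mp_pderiv_Var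
    by (simp add: d_eq algebra_simps Var_power_pred[simplified])
  hence "jac (symmetric_map n) = det3 (\<lambda>i j. (if i = j then d * (s - Var i ^ n) else 0)
      + Var i * (d * (N * Var j ^ (n - 1))))" by (simp only: jac_def)
  also have "\<dots> = d ^ 3 * critical_cubic N (\<lambda>i. Var i ^ n)"
  proof -
    have "Var i * (d * (N * Var i ^ (n - 1))) = d * (N * Var i ^ n)" for i
      by (simp only: mult.left_commute[of "Var i"] Var_power_pred)
    thus ?thesis unfolding det3_rank_one_update
      by (simp add: critical_cubic_def s_def sum_3 power3_eq_cube) (simp add: algebra_simps)
  qed
  finally show ?thesis by (simp add: d_def N_def)
qed

lemma two_mult_critical_cubic_deriv:
  "2 * critical_cubic_deriv N X t = 2 * (3 * N - 1) * t ^ 2 - 2 * N * (\<Sum>i\<in>UNIV. X i) * t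
     + (3 * N + 2) * (\<Sum>i\<in>UNIV. X i) ^ 2 - N * (\<Sum>i\<in>UNIV. X i ^ 2)"
  by (simp add: critical_cubic_deriv_def sum_3 power2_eq_square algebra_simps)

lemma of_nat_mult_neq:
  assumes "a * n \<noteq> b"
  shows "of_nat a * of_nat n - of_nat b \<noteq> (0 :: 'k::field_char_0)"
proof -
  have "of_nat (a * n) \<noteq> (of_nat b :: 'k)" using assms by (simp only: of_nat_eq_iff) simp
  thus ?thesis by simp
qed

lemma sum_of_two_values:
  fixes X :: "'i::finite \<Rightarrow> 'a::semiring_1"
  assumes in_values: "\<And>i. X i \<in> {0, u, v}" and distinct: "u \<noteq> 0" "v \<noteq> 0" "u \<noteq> v" and zero: "h 0 = 0"
  shows "(\<Sum>i\<in>UNIV. h (X i)) = of_nat (card {i. X i = u}) * h u + of_nat (card {i. X i = v}) * h v"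
proof -
  have "h (X i) = (if X i = u then h u else 0) + (if X i = v then h v else 0)" for i
    using in_values[of i] distinct zero by auto
  thus ?thesis by (simp add: sum.distrib sum.If_cases)
qed

lemma critical_cubic_deriv_one_value:
  fixes u :: "'k::field_char_0"
  assumes n: "n \<ge> 1" and u: "u \<noteq> 0" "X j = u" and in_values: "\<And>i. X i \<in> {0, u}"
  shows "critical_cubic_deriv (of_nat n) X u \<noteq> 0"
proof -
  define a where "a = card {i. X i = u}"
  have "{i. X i = u} \<noteq> {}" using u by auto
  hence "a > 0" by (simp add: a_def card_gt_0_iff)
  then obtain b where a: "a = Suc b" using gr0_implies_Suc by blast
  have "X i \<noteq> - u" for i using in_values[of i] u by auto
  hence "card {i. X i = - u} = 0" by simp
  hence sum: "(\<Sum>i\<in>UNIV. h (X i)) = of_nat a * h u" if "h 0 = 0" for h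
    using sum_of_two_values[of X u "- u" h] in_values u that by (auto simp: a_def)
  have "2 * critical_cubic_deriv (of_nat n) X u
      = of_nat (6 * n + 3 * n * (b * b + b) + 2 * (b * b + 2 * b)) * u ^ 2"
    using sum[of "\<lambda>t. t"] sum[of "\<lambda>t. t ^ 2"] unfolding two_mult_critical_cubic_deriv
    by (simp add: a power2_eq_square algebra_simps)
  moreover have "6 * n + 3 * n * (b * b + b) + 2 * (b * b + 2 * b) \<noteq> 0" using n by simp
  ultimately show ?thesis using u(1) by (metis mult_eq_0_iff of_nat_eq_0_iff power_not_zero mult_zero_right)
qed

lemma quadratic_at_double_value_nonzero:
  fixes u v :: "'k::field_char_0"
  defines "s \<equiv> 2 * u + v"
  assumes n: "n \<ge> 1" and u: "u \<noteq> 0" and sum: "(3 * of_nat n - 1) * (u + v) = of_nat n * s"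
  shows "2 * (3 * of_nat n - 1) * u ^ 2 - 2 * of_nat n * s * u + (3 * of_nat n + 2) * s ^ 2
    - of_nat n * (2 * u ^ 2 + v ^ 2) \<noteq> 0"
proof -
  define N where "N = (of_nat n :: 'k)"
  have "2 * n \<noteq> 1" "5 * n \<noteq> 2" by presburger+
  hence N: "2 * N - 1 \<noteq> 0" "5 * N - 2 \<noteq> 0" "N \<noteq> 0"
    using of_nat_mult_neq[of 2 n 1, where 'k = 'k] of_nat_mult_neq[of 5 n 2, where 'k = 'k] n
    by (simp_all add: N_def)
  define w where "w = u / (2 * N - 1)"
  have u_eq: "u = (2 * N - 1) * w" using N by (simp add: w_def)
  have "(2 * N - 1) * v = (2 * N - 1) * (- (N - 1) * w)"
    using sum unfolding s_def N_def[symmetric] u_eq by (simp add: algebra_simps)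
  hence v_eq: "v = - (N - 1) * w" using N by simp
  have "2 * (3 * N - 1) * u ^ 2 - 2 * N * s * u + (3 * N + 2) * s ^ 2 - N * (2 * u ^ 2 + v ^ 2)
      = 6 * N ^ 2 * (5 * N - 2) * w ^ 2"
    unfolding s_def u_eq v_eq by (simp add: power2_eq_square algebra_simps)
  thus ?thesis using N u by (simp add: N_def[symmetric] u_eq)
qed

lemma critical_cubic_deriv_two_values:
  fixes u v :: "'k::field_char_0"
  assumes n: "n \<ge> 1" and nonzero: "u \<noteq> 0" "v \<noteq> 0" "u \<noteq> v" and X: "X j = u" "X k = v"
    and in_values: "\<And>i. X i \<in> {0, u, v}"
    and sum: "(3 * of_nat n - 1) * (u + v) = of_nat n * (\<Sum>i\<in>UNIV. X i)"
  shows "critical_cubic_deriv (of_nat n) X u \<noteq> 0 \<or> critical_cubic_deriv (of_nat n) X v \<noteq> 0"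
proof -
  define a b where "a = card {i. X i = u}" and "b = card {i. X i = v}"
  have sums: "(\<Sum>i\<in>UNIV. X i) = of_nat a * u + of_nat b * v"
    "(\<Sum>i\<in>UNIV. X i ^ 2) = of_nat a * u ^ 2 + of_nat b * v ^ 2"
    using sum_of_two_values[of X u v "\<lambda>t. t", OF in_values nonzero]
      sum_of_two_values[of X u v "\<lambda>t. t ^ 2", OF in_values nonzero] by (simp_all add: a_def b_def)
  have "a + b = card ({i. X i = u} \<union> {i. X i = v})"
    unfolding a_def b_def using nonzero(3) by (intro card_Un_disjoint[symmetric]) auto
  also have "\<dots> \<le> card (UNIV :: 3 set)" by (rule card_mono) auto
  finally have "a + b \<le> 3" by simp
  moreover have "{i. X i = u} \<noteq> {}" "{i. X i = v} \<noteq> {}" using X by auto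
  hence "a \<ge> 1" "b \<ge> 1" by (simp_all add: a_def b_def Suc_le_eq card_gt_0_iff)
  ultimately consider "a = 1" "b = 1" | "a = 2" "b = 1" | "a = 1" "b = 2" by linarith
  thus ?thesis
  proof cases
    assume [simp]: "a = 1" "b = 1"
    have "2 * n \<noteq> 1" by presburger
    hence N: "2 * of_nat n - 1 \<noteq> (0 :: 'k)" using of_nat_mult_neq[of 2 n 1, where 'k = 'k] by simp
    have "(2 * of_nat n - 1) * (u + v) = 0" using sum by (simp add: sums algebra_simps)
    hence v: "v = - u" using N by (simp add: add_eq_0_iff)
    have "2 * critical_cubic_deriv (of_nat n) X u = 2 * ((2 * of_nat n - 1) * u ^ 2)"
      unfolding two_mult_critical_cubic_deriv sums v by (simp add: algebra_simps)
    thus ?thesis using N nonzero(1) by simp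
  next
    assume [simp]: "a = 2" "b = 1"
    have "2 * critical_cubic_deriv (of_nat n) X u \<noteq> 0"
      using quadratic_at_double_value_nonzero[OF n nonzero(1), of v] sum
      unfolding two_mult_critical_cubic_deriv sums by simp
    thus ?thesis by simp
  next
    assume [simp]: "a = 1" "b = 2"
    have "2 * critical_cubic_deriv (of_nat n) X v \<noteq> 0"
      using quadratic_at_double_value_nonzero[OF n nonzero(2), of u] sum
      unfolding two_mult_critical_cubic_deriv sums by (simp add: add.commute)
    thus ?thesis by simp
  qed
qed

lemma critical_cubic_nonsingular:
  fixes X :: "3 \<Rightarrow> 'k::field_char_0"
  assumes n: "n \<ge> 1" and zero: "\<And>i. X i = 0 \<or> critical_cubic_deriv (of_nat n) X (X i) = 0"
  shows "X i = 0"
proof (rule ccontr)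
  assume i: "X i \<noteq> 0"
  have sum: "(3 * of_nat n - 1) * (X j + X k) = of_nat n * (\<Sum>i\<in>UNIV. X i)"
    if "X j \<noteq> 0" "X k \<noteq> 0" "X j \<noteq> X k" for j k
  proof -
    have "(X j - X k) * ((3 * of_nat n - 1) * (X j + X k) - of_nat n * (\<Sum>i\<in>UNIV. X i))
        = critical_cubic_deriv (of_nat n) X (X j) - critical_cubic_deriv (of_nat n) X (X k)"
      by (simp add: critical_cubic_deriv_def power2_eq_square algebra_simps)
    thus ?thesis using zero[of j] zero[of k] that by simp
  qed
  have "\<exists>k. X k \<notin> {0, X i}"
    using critical_cubic_deriv_one_value[of n "X i" X, OF n i refl] zero[of i] i by blast
  then obtain k where k: "X k \<noteq> 0" "X k \<noteq> X i" by blast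
  have "3 * n \<noteq> 1" by presburger
  hence "3 * of_nat n - 1 \<noteq> (0 :: 'k)" using of_nat_mult_neq[of 3 n 1, where 'k = 'k] by simp
  have "X l \<in> {0, X i, X k}" for l
  proof (rule ccontr)
    assume "X l \<notin> {0, X i, X k}"
    hence "(3 * of_nat n - 1) * (X i + X k) = (3 * of_nat n - 1) * (X i + X l)"
      using sum[of i k] sum[of i l] i k by auto
    thus False using \<open>3 * of_nat n - 1 \<noteq> (0 :: 'k)\<close> \<open>X l \<notin> {0, X i, X k}\<close> by simp
  qed
  from critical_cubic_deriv_two_values[of n "X i" "X k" X, OF n i k(1) _ refl refl this sum] show False
    using zero[of i] zero[of k] i k by auto
qed

lemma mp_eval_critical_cubic_deriv:
  "mp_eval (critical_cubic_deriv (of_nat n) X t) x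
    = critical_cubic_deriv (of_nat n) (\<lambda>i. mp_eval (X i) x) (mp_eval t x)"
  by (simp add: critical_cubic_deriv_def hom_distribs)

lemma smooth_form_jac_symmetric_map:
  assumes n: "n \<ge> 1"
  shows "smooth_form (jac (symmetric_map n :: 'k::field_char_0 endo))"
  unfolding smooth_form_def
proof (rule ballI, rule ccontr)
  let ?J = "jac (symmetric_map n) :: 'k pol3"
  fix x assume "x \<in> proj_zeros ?J" and singular: "\<nexists>j. mp_eval (mp_pderiv j ?J) x \<noteq> 0"
  then obtain i where i: "x i \<noteq> 0" by (auto simp: proj_zeros_def)
  let ?X = "\<lambda>i. x i ^ n"
  have "mp_eval (mp_pderiv j ?J) x = of_nat (Suc n) ^ 3 *
      (critical_cubic_deriv (of_nat n) ?X (x j ^ n) * (of_nat n * x j ^ (n - 1)))" for j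
    by (simp add: jac_symmetric_map mp_pderiv_mult mp_pderiv_power mp_pderiv_critical_cubic mp_pderiv_Var
        if_distrib hom_distribs mp_eval_critical_cubic_deriv cong: if_cong del: of_nat_Suc)
  hence "x j ^ n = 0 \<or> critical_cubic_deriv (of_nat n) ?X (x j ^ n) = 0" for j
    using singular n by (auto simp del: of_nat_Suc)
  hence "x i ^ n = 0" by (rule critical_cubic_nonsingular[OF n])
  thus False using i by simp
qed

lemma symmetric_map_End2:
  assumes n: "n \<ge> 1"
  shows "(symmetric_map n :: 'k::field_char_0 endo) \<in> End2 (Suc n)"
proof -
  have "homog (1 + (0 + n)) (symmetric_map n i :: 'k pol3)" for i
    unfolding symmetric_map_def
    by (intro homog_mult homog_Var homog_diff homog_of_nat homog_sum homog_Var_power) (simp add: homog_Var_power)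
  moreover have "x i = 0" if zero: "\<And>i. mp_eval (symmetric_map n i) x = 0" for x :: "3 \<Rightarrow> 'k" and i
  proof -
    define s where "s = (\<Sum>k\<in>UNIV. x k ^ n)"
    have power: "x i ^ n = (if x i = 0 then 0 else of_nat (Suc n) * s)" for i
      using zero[of i] n by (auto simp: symmetric_map_def hom_distribs s_def sum_distrib_left simp del: of_nat_Suc)
    have "s = of_nat (card {k. x k \<noteq> 0}) * (of_nat (Suc n) * s)"
      unfolding s_def by (subst power) (simp add: sum.If_cases Collect_neg_eq s_def del: of_nat_Suc)
    hence "(of_nat (card {k. x k \<noteq> 0}) * of_nat (Suc n) - of_nat 1) * s = 0"
      by (simp add: algebra_simps)
    moreover have "card {k. x k \<noteq> 0} * Suc n \<noteq> 1" using n by (simp only: nat_mult_eq_1_iff) simp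
    ultimately have "s = 0"
      using of_nat_mult_neq[where 'k = 'k] by (metis mult_eq_0_iff)
    hence "x i ^ n = 0" using power[of i] by simp
    thus ?thesis by simp
  qed
  ultimately show ?thesis by (simp add: End2_def)
qed

lemma (in algebraically_closed_char_0) Ed_nonempty:
  assumes d: "d \<ge> 2"
  shows "(Ed d :: 'k endo set) \<noteq> {}"
proof -
  obtain n where n: "n \<ge> 1" "d = Suc n" using d by (cases d) auto
  have "(symmetric_map n :: 'k endo) \<in> Ed d"
    using symmetric_map_End2[OF n(1)] smooth_form_jac_symmetric_map[OF n(1)]
    by (simp add: Ed_eq_smooth[OF d] flip: n(2))
  thus ?thesis by blast
qed


theorem theorem15:
  assumes alg_closed: "\<And>p :: 'k::field_char_0 poly. degree p \<ge> 1 \<Longrightarrow> \<exists>x. poly p x = 0"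
  shows "(\<forall>d\<ge>1. (Ed d :: 'k endo set) \<noteq> {} \<and> zopen_End d (Ed d :: 'k endo set))
       \<and> (\<forall>d\<ge>2. \<forall>f\<in>(Ed d :: 'k endo set). \<not> pcp f)
       \<and> (\<forall>d\<ge>2. \<not> zdense_End d {f \<in> (End2 d :: 'k endo set). pcp f})"
proof -
  interpret algebraically_closed_char_0 "TYPE('k)" by unfold_locales (rule alg_closed)
  have open_nonempty: "(Ed d :: 'k endo set) \<noteq> {} \<and> zopen_End d (Ed d :: 'k endo set)" if "d \<ge> 1" for d
  proof (cases "d = 1")
    case True
    thus ?thesis using Ed_1_nonempty zopen_Ed_1 by blast
  next
    case False
    with that have "d \<ge> 2" by simp
    thus ?thesis using Ed_nonempty zopen_Ed by blast
  qed
  have "\<not> zdense_End d {f \<in> (End2 d :: 'k endo set). pcp f}" if d: "d \<ge> 2" for d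
  proof
    assume dense: "zdense_End d {f \<in> (End2 d :: 'k endo set). pcp f}"
    have "Ed d \<noteq> ({} :: 'k endo set)" "zclosed_End d (End2 d - Ed d :: 'k endo set)" "Ed d \<subseteq> (End2 d :: 'k endo set)"
      using open_nonempty[of d] d by (auto simp: zopen_End_def)
    moreover have "{f \<in> (End2 d :: 'k endo set). pcp f} \<subseteq> End2 d - Ed d"
      using Ed_not_pcp[OF d] by blast
    ultimately show False using dense unfolding zdense_End_def by blast
  qed
  with open_nonempty Ed_not_pcp show ?thesis by blast
qed

end
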